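(* Let $\widehat{\Omega}=\{r_P<0\}\subset\mathbb{C}^{d+1}$ be a limit domain obtained from the scaling construction described in the context (with $2m$ the type of the boundary point $u_\infty$). Then there exists a constant $A\geq1$ such that for every $(z;X)\in\widehat{\Omega}\times\mathbb{C}^{d+1}$, $X=(x_0,x_1,\ldots,x_d)$, if \[ M_{r_P}(z;X):=\frac{\big|x_0+2x_1P'(z_1)+2\sum^d_{\alpha=2}x_\alpha\overline{z}_\alpha\big|}{|r_P(z)|}+|x_1|\sum^{2m}_{\ell=2}\bigg|\frac{A^P_\ell(z_1)}{r_P(z)}\bigg|^{1/\ell}+\sum^d_{\alpha=2}\frac{|x_\alpha|}{\sqrt{|r_P(z)|}}, \] where $P'(z_1)=\partial P(z_1,\overline z_1)/\partial z_1$ and $A^P_{\ell}(z_1)=\max\big\{\big|\frac{\partial^{j+k}P}{\partial z_1^j\partial\overline{z}_1^k}(z_1)\big| : j,k>0,\ j+k=\ell\big\}$, then \[ A^{-1}M_{r_P}(z;X)\leq F_{\widehat{\Omega}}(z;X)\leq A\,M_{r_P}(z;X), \] where $F_{\widehat\Omega}$ is the Kobayashi metric of $\widehat\Omega$.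
   Context: Scaling construction. Points of $\mathbb{C}^{d+1}$ are written $z=(z_0,z_1,\ldots,z_d)$, and $(a,{}'0)\in\mathbb{C}\times\mathbb{C}^d$. Let $\Omega\subset\mathbb{C}^{d+1}$ be a bounded pseudoconvex domain of finite type (D'Angelo) with $\mathcal{C}^\infty$ boundary whose Levi form has rank at least $d-1$ at every boundary point. Let $(u_n)\subset\Omega$ converge to $u_\infty\in\partial\Omega$, a point of type $2m$. Coordinates are chosen so that $u_\infty=0$, and $r$ is a smooth defining function of $\Omega$ on a (small) neighbourhood $W$ of $0$ with $\partial r/\partial z_0(0)=1/2$, $|\partial r/\partial z_0|\ge c>0$ on $W$, such that, with $L_0^r=\partial/\partial z_0$ and $L_j^r=\partial/\partial z_j-(\partial r/\partial z_0)^{-1}(\partial r/\partial z_j)\,\partial/\partial z_0$ for $1\le j\le d$, the matrix $(\partial\overline\partial r[L_i^r,\overline{L_j^r}])_{2\le i,j\le d}$ is positive definite on $W$ and equals the identity at $0$. For $x\in W$, $\Phi_x$ is Cho's special-coordinate biholomorphism of $\mathbb{C}^{d+1}$: $\Phi_x(x)=0$, $\Phi_x(x+(-\epsilon,{}'0))=(-2\epsilon\,\partial r/\partial\overline z_0(x),{}'0)$, and \[ r\circ\Phi_x^{-1}(\zeta)=r(x)+\operatorname{Re}\zeta_0+\sum_{\alpha=2}^d\sum_{\substack{j+k\le m\\ j,k>0}}\operatorname{Re}\big(b^\alpha_{j,k}(x)\zeta_1^j\overline\zeta_1^k\zeta_\alpha\big)+\sum_{\substack{j+k\le2m\\ j,k>0}}a_{j,k}(x)\zeta_1^j\overline\zeta_1^k+\sum_{\alpha=2}^d|\zeta_\alpha|^2+R(x;\zeta),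 \] where, with $\zeta_*=(\zeta_2,\ldots,\zeta_d)$, $R(x;\zeta)=O(|\zeta_0||\zeta|+|\zeta_*|^2|\zeta|+|\zeta_*||\zeta_1|^{m+1}+|\zeta_1|^{2m+1})$ uniformly in $x$. Put $A_\ell(x)=\max\{|a_{j,k}(x)|:j+k=\ell\}$ and $\tau(x,\delta)=\min\{(\delta/A_\ell(x))^{1/\ell}:2\le\ell\le2m\}$. For $n$ large choose $\epsilon_n>0$ with $\xi_n:=u_n+(\epsilon_n,{}'0)\in\partial\Omega$ (so $\epsilon_n\to0$), let $\Lambda_n(\zeta)=(\zeta_0/\epsilon_n,\zeta_1/\tau(\xi_n,\epsilon_n),\zeta_2/\sqrt{\epsilon_n},\ldots,\zeta_d/\sqrt{\epsilon_n})$, and set $\psi_n=\Lambda_n\circ\Phi_{\xi_n}$, $\Omega_n=\psi_n(\Omega)$, $r_n=\epsilon_n^{-1}r\circ\psi_n^{-1}$. Then $\psi_n(u_n)\to(-1,{}'0)$ and, after passing to a subsequence (done once and for all), $r_n\to r_P$ uniformly on compact subsets of $\mathbb{C}^{d+1}$, where $r_P(\zeta)=\operatorname{Re}\zeta_0+P(\zeta_1,\overline\zeta_1)+\sum_{\alpha=2}^d|\zeta_\alpha|^2$ and $P$ is a nonzero subharmonic real polynomial without harmonic terms, $P(0)=0$, of degree $2m'\le2m$. The limit domain is $\widehat\Omega=\{r_P<0\}$. The Kobayashi metric is $F_D(p;X)=\inf\{|\lambda|: f\colon\Delta\to D\text{ holomorphic},f(0)=p,df_{|0}\lambda=X\}$.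 *)

theory Defs
  imports "HOL-Complex_Analysis.Complex_Analysis" "HOL-Library.Landau_Symbols"
begin

text \<open>
  The space of dimension d + 1 is rendered as \<open>complex ^ 'n\<close> with two distinguished, distinct indices
  \<open>i0\<close> and \<open>i1\<close> (the coordinates 0 and 1); the coordinates 2, ..., d are those indexed by
  \<open>- {i0, i1}\<close>. Hence d = CARD('n) - 1, every d \<open>\<ge>\<close> 1 is covered, and the point (a, '0) is \<open>axis i0 a\<close>.
\<close>

section \<open>Smoothness and complex derivatives\<close>

primrec ck_on :: "nat \<Rightarrow> 'a::real_normed_vector set \<Rightarrow> ('a \<Rightarrow> 'b::real_normed_vector) \<Rightarrow> bool" where
  "ck_on 0 S f \<longleftrightarrow> continuous_on S f"
| "ck_on (Suc k) S f \<longleftrightarrow>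
     (\<forall>x\<in>S. f differentiable (at x)) \<and> (\<forall>v. ck_on k S (\<lambda>x. frechet_derivative f (at x) v))"

definition smooth_on :: "'a::real_normed_vector set \<Rightarrow> ('a \<Rightarrow> 'b::real_normed_vector) \<Rightarrow> bool" where
  "smooth_on S f \<longleftrightarrow> (\<forall>k. ck_on k S f)"

definition dz :: "(complex \<Rightarrow> complex) \<Rightarrow> complex \<Rightarrow> complex" where
  "dz f z = (frechet_derivative f (at z) 1 - \<i> * frechet_derivative f (at z) \<i>) / 2"

definition dzbar :: "(complex \<Rightarrow> complex) \<Rightarrow> complex \<Rightarrow> complex" where
  "dzbar f z = (frechet_derivative f (at z) 1 + \<i> * frechet_derivative f (at z) \<i>) / 2"

definition pdz :: "'n::finite \<Rightarrow> (complex^'n \<Rightarrow> complex) \<Rightarrow> complex^'n \<Rightarrow> complex" where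
  "pdz j f z = (frechet_derivative f (at z) (axis j 1)
                - \<i> * frechet_derivative f (at z) (axis j \<i>)) / 2"

definition pdzbar :: "'n::finite \<Rightarrow> (complex^'n \<Rightarrow> complex) \<Rightarrow> complex^'n \<Rightarrow> complex" where
  "pdzbar j f z = (frechet_derivative f (at z) (axis j 1)
                   + \<i> * frechet_derivative f (at z) (axis j \<i>)) / 2"

definition holomorphic_map_on :: "(complex^'n \<Rightarrow> complex^'k) \<Rightarrow> (complex^'n::finite) set \<Rightarrow> bool" where
  "holomorphic_map_on f S \<longleftrightarrow>
     (\<forall>x\<in>S. \<exists>D. (f has_derivative D) (at x) \<and> (\<forall>c v. D (c *s v) = c *s D v))"

definition holomorphic_curve_on :: "(complex \<Rightarrow> complex^'n::finite) \<Rightarrow> complex set \<Rightarrow> bool" where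
  "holomorphic_curve_on f S \<longleftrightarrow> (\<forall>i. (\<lambda>t. f t $ i) holomorphic_on S)"

definition kobayashi :: "(complex^'n::finite) set \<Rightarrow> complex^'n \<Rightarrow> complex^'n \<Rightarrow> real" where
  "kobayashi D p X = Inf {cmod l | l. \<exists>f. holomorphic_curve_on f (ball 0 1) \<and> f ` ball 0 1 \<subseteq> D \<and>
      f 0 = p \<and> (\<forall>i. deriv (\<lambda>t. f t $ i) 0 * l = X $ i)}"

section \<open>Pseudoconvexity\<close>

text \<open>Only continuous (pluri)subharmonic functions occur below.\<close>

definition subharmonic_on :: "complex set \<Rightarrow> (complex \<Rightarrow> real) \<Rightarrow> bool" where
  "subharmonic_on S u \<longleftrightarrow> continuous_on S u \<and>
     (\<forall>a \<rho>. \<rho> > 0 \<and> cball a \<rho> \<subseteq> S \<longrightarrow>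
        u a \<le> 1 / (2 * pi) * integral {0..2 * pi} (\<lambda>\<theta>. u (a + of_real \<rho> * cis \<theta>)))"

definition plurisubharmonic_on :: "(complex^'n::finite) set \<Rightarrow> (complex^'n \<Rightarrow> real) \<Rightarrow> bool" where
  "plurisubharmonic_on S u \<longleftrightarrow> continuous_on S u \<and>
     (\<forall>a v. subharmonic_on {t. a + t *s v \<in> S} (\<lambda>t. u (a + t *s v)))"

definition pseudoconvex :: "(complex^'n::finite) set \<Rightarrow> bool" where
  "pseudoconvex S \<longleftrightarrow>
     (\<exists>u. plurisubharmonic_on S u \<and> (\<forall>c. compact {z \<in> S. u z \<le> c}))"

section \<open>Boundary geometry\<close>

definition local_defining ::
  "(complex^'n::finite) set \<Rightarrow> (complex^'n \<Rightarrow> real) \<Rightarrow> (complex^'n) set \<Rightarrow> complex^'n \<Rightarrow> bool" where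
  "local_defining \<Omega> r U p \<longleftrightarrow> open U \<and> p \<in> U \<and> smooth_on U r \<and> \<Omega> \<inter> U = {z \<in> U. r z < 0} \<and>
     (\<forall>z\<in>U. frechet_derivative r (at z) \<noteq> (\<lambda>_. 0))"

definition smooth_boundary :: "(complex^'n::finite) set \<Rightarrow> bool" where
  "smooth_boundary \<Omega> \<longleftrightarrow> (\<forall>p\<in>frontier \<Omega>. \<exists>r U. local_defining \<Omega> r U p)"

definition levi :: "(complex^'n::finite \<Rightarrow> real) \<Rightarrow> complex^'n \<Rightarrow> complex^'n \<Rightarrow> complex^'n \<Rightarrow> complex" where
  "levi r z v w =
     (\<Sum>p\<in>UNIV. \<Sum>q\<in>UNIV. pdz p (pdzbar q (\<lambda>x. of_real (r x))) z * v $ p * cnj (w $ q))"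

definition ctangent :: "(complex^'n::finite \<Rightarrow> real) \<Rightarrow> complex^'n \<Rightarrow> (complex^'n) set" where
  "ctangent r z = {v. (\<Sum>j\<in>UNIV. pdz j (\<lambda>x. of_real (r x)) z * v $ j) = 0}"

text \<open>Rank of the Levi form on the complex tangent space: complex dimension minus that of the radical.\<close>

definition levi_rank :: "(complex^'n::finite \<Rightarrow> real) \<Rightarrow> complex^'n \<Rightarrow> nat" where
  "levi_rank r z = vec.dim (ctangent r z)
     - vec.dim {v \<in> ctangent r z. \<forall>w\<in>ctangent r z. levi r z v w = 0}"

text \<open>Order of vanishing at 0; for a smooth function, \<open>f t = O(|t|^k)\<close> at 0 (and \<open>f 0 = 0\<close>) says that all
  derivatives of order less than \<open>k\<close> vanish.\<close>

definition vanishing_order :: "(complex \<Rightarrow> 'b::real_normed_vector) \<Rightarrow> ereal" where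
  "vanishing_order f =
     (SUP k\<in>{k::nat. (\<lambda>t. norm (f t)) \<in> O[at 0](\<lambda>t. norm t ^ k)}. ereal (real k))"

definition dangelo_type :: "(complex^'n::finite \<Rightarrow> real) \<Rightarrow> complex^'n \<Rightarrow> ereal" where
  "dangelo_type r p =
     (SUP \<gamma>\<in>{\<gamma>. \<exists>\<rho>>0. holomorphic_curve_on \<gamma> (ball 0 \<rho>) \<and> \<gamma> 0 = p \<and> \<not> \<gamma> constant_on ball 0 \<rho>}.
        vanishing_order (\<lambda>t. r (\<gamma> t)) / vanishing_order (\<lambda>t. \<gamma> t - p))"

definition finite_type_boundary :: "(complex^'n::finite) set \<Rightarrow> bool" where
  "finite_type_boundary \<Omega> \<longleftrightarrow>
     (\<forall>p\<in>frontier \<Omega>. \<forall>r U. local_defining \<Omega> r U p \<longrightarrow> dangelo_type r p < \<infinity>)"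

definition levi_corank_le_1 :: "(complex^'n::finite) set \<Rightarrow> bool" where
  "levi_corank_le_1 \<Omega> \<longleftrightarrow>
     (\<forall>p\<in>frontier \<Omega>. \<forall>r U. local_defining \<Omega> r U p \<longrightarrow> CARD('n) - 2 \<le> levi_rank r p)"

definition Lfield :: "'n::finite \<Rightarrow> (complex^'n \<Rightarrow> real) \<Rightarrow> complex^'n \<Rightarrow> 'n \<Rightarrow> complex^'n" where
  "Lfield i0 r z j = axis j 1
     - axis i0 (inverse (pdz i0 (\<lambda>x. of_real (r x)) z) * pdz j (\<lambda>x. of_real (r x)) z)"

section \<open>Special coordinates and scaling\<close>

definition star_norm :: "'n::finite \<Rightarrow> 'n \<Rightarrow> complex^'n \<Rightarrow> real" where
  "star_norm i0 i1 \<zeta> = sqrt (\<Sum>\<alpha>\<in>- {i0, i1}. (cmod (\<zeta> $ \<alpha>))\<^sup>2)"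

definition bidegrees :: "nat \<Rightarrow> (nat \<times> nat) set" where
  "bidegrees N = {(j, k). j > 0 \<and> k > 0 \<and> j + k \<le> N}"

text \<open>The part of the expansion in special coordinates without the remainder; \<open>c\<close> is the value \<open>r(x)\<close>,
  \<open>a j k\<close> and \<open>b \<alpha> j k\<close> are the coefficients at \<open>x\<close>.\<close>

definition cho_normal_form ::
  "'n::finite \<Rightarrow> 'n \<Rightarrow> nat \<Rightarrow> real \<Rightarrow> (nat \<Rightarrow> nat \<Rightarrow> complex) \<Rightarrow> ('n \<Rightarrow> nat \<Rightarrow> nat \<Rightarrow> complex)
     \<Rightarrow> complex^'n \<Rightarrow> complex" where
  "cho_normal_form i0 i1 m c a b \<zeta> =
     of_real (c + Re (\<zeta> $ i0)
       + (\<Sum>\<alpha>\<in>- {i0, i1}. \<Sum>(j, k)\<in>bidegrees m.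
            Re (b \<alpha> j k * (\<zeta> $ i1) ^ j * cnj (\<zeta> $ i1) ^ k * \<zeta> $ \<alpha>)))
     + (\<Sum>(j, k)\<in>bidegrees (2 * m). a j k * (\<zeta> $ i1) ^ j * cnj (\<zeta> $ i1) ^ k)
     + of_real (\<Sum>\<alpha>\<in>- {i0, i1}. (cmod (\<zeta> $ \<alpha>))\<^sup>2)"

definition cho_remainder_bound :: "'n::finite \<Rightarrow> 'n \<Rightarrow> nat \<Rightarrow> complex^'n \<Rightarrow> real" where
  "cho_remainder_bound i0 i1 m \<zeta> =
     cmod (\<zeta> $ i0) * norm \<zeta> + (star_norm i0 i1 \<zeta>)\<^sup>2 * norm \<zeta>
     + star_norm i0 i1 \<zeta> * cmod (\<zeta> $ i1) ^ (m + 1) + cmod (\<zeta> $ i1) ^ (2 * m + 1)"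

definition coeff_max :: "(nat \<Rightarrow> nat \<Rightarrow> complex) \<Rightarrow> nat \<Rightarrow> real" where
  "coeff_max a l = Max {cmod (a j k) | j k. j > 0 \<and> k > 0 \<and> j + k = l}"

text \<open>An index with \<open>coeff_max a l = 0\<close> contributes \<open>\<infinity>\<close> to the minimum, whereas \<open>\<delta> / 0 = 0\<close> here; such
  indices are therefore left out.\<close>

definition tau :: "nat \<Rightarrow> (nat \<Rightarrow> nat \<Rightarrow> complex) \<Rightarrow> real \<Rightarrow> real" where
  "tau m a \<delta> = Min {root l (\<delta> / coeff_max a l) | l. 2 \<le> l \<and> l \<le> 2 * m \<and> coeff_max a l \<noteq> 0}"

definition scale_map :: "'n::finite \<Rightarrow> 'n \<Rightarrow> real \<Rightarrow> real \<Rightarrow> complex^'n \<Rightarrow> complex^'n" where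
  "scale_map i0 i1 e t \<zeta> =
     (\<chi> i. if i = i0 then \<zeta> $ i / of_real e
           else if i = i1 then \<zeta> $ i / of_real t
           else \<zeta> $ i / of_real (sqrt e))"

definition real_polynomial_with ::
  "(complex \<Rightarrow> real) \<Rightarrow> (nat \<Rightarrow> nat \<Rightarrow> complex) \<Rightarrow> bool" where
  "real_polynomial_with P c \<longleftrightarrow> finite {(j, k). c j k \<noteq> 0} \<and>
     (\<forall>z. complex_of_real (P z) = (\<Sum>(j, k)\<in>{(j, k). c j k \<noteq> 0}. c j k * z ^ j * cnj z ^ k))"

definition rP :: "'n::finite \<Rightarrow> 'n \<Rightarrow> (complex \<Rightarrow> real) \<Rightarrow> complex^'n \<Rightarrow> real" where
  "rP i0 i1 P \<zeta> = Re (\<zeta> $ i0) + P (\<zeta> $ i1) + (\<Sum>\<alpha>\<in>- {i0, i1}. (cmod (\<zeta> $ \<alpha>))\<^sup>2)"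

definition limit_domain :: "'n::finite \<Rightarrow> 'n \<Rightarrow> (complex \<Rightarrow> real) \<Rightarrow> (complex^'n) set" where
  "limit_domain i0 i1 P = {\<zeta>. rP i0 i1 P \<zeta> < 0}"

text \<open>The boundary point \<open>u\<^sub>\<infinity>\<close> is the origin, and \<open>s\<close> enumerates the chosen subsequence.\<close>

locale scaling_construction =
  fixes i0 i1 :: "'n::finite"
    and \<Omega> :: "(complex^'n) set"
    and u :: "nat \<Rightarrow> complex^'n"
    and m :: nat
    and r :: "complex^'n \<Rightarrow> real"
    and W :: "(complex^'n) set"
    and \<Phi> :: "complex^'n \<Rightarrow> complex^'n \<Rightarrow> complex^'n"
    and a :: "complex^'n \<Rightarrow> nat \<Rightarrow> nat \<Rightarrow> complex"
    and b :: "complex^'n \<Rightarrow> 'n \<Rightarrow> nat \<Rightarrow> nat \<Rightarrow> complex"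
    and \<epsilon> :: "nat \<Rightarrow> real"
    and s :: "nat \<Rightarrow> nat"
    and P :: "complex \<Rightarrow> real"
  fixes \<xi> \<psi> rn
  defines "\<xi> \<equiv> \<lambda>n. u n + axis i0 (complex_of_real (\<epsilon> n))"
    and "\<psi> \<equiv> \<lambda>n. scale_map i0 i1 (\<epsilon> n) (tau m (a (\<xi> n)) (\<epsilon> n)) \<circ> \<Phi> (\<xi> n)"
    and "rn \<equiv> \<lambda>n \<zeta>. r (inv (\<psi> n) \<zeta>) / \<epsilon> n"
  assumes indices: "i0 \<noteq> i1"
    and domain: "open \<Omega>" "connected \<Omega>" "bounded \<Omega>"
    and pseudoconvex: "pseudoconvex \<Omega>"
    and smooth_boundary: "smooth_boundary \<Omega>"
    and finite_type: "finite_type_boundary \<Omega>"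
    and levi_rank: "levi_corank_le_1 \<Omega>"
    and points: "\<And>n. u n \<in> \<Omega>" "u \<longlonglongrightarrow> 0"
    and base_point: "0 \<in> frontier \<Omega>"
    and defining: "local_defining \<Omega> r W 0"
    and point_type: "dangelo_type r 0 = ereal (real (2 * m))"
    and normal_0: "pdz i0 (\<lambda>x. of_real (r x)) 0 = 1 / 2"
    and normal: "\<exists>c>0. \<forall>z\<in>W. c \<le> cmod (pdz i0 (\<lambda>x. of_real (r x)) z)"
    and levi_pos: "\<And>z v. \<lbrakk>z \<in> W; \<exists>\<alpha>\<in>- {i0, i1}. v \<alpha> \<noteq> 0\<rbrakk> \<Longrightarrow>
          0 < Re (\<Sum>\<alpha>\<in>- {i0, i1}. \<Sum>\<beta>\<in>- {i0, i1}.
                   levi r z (Lfield i0 r z \<alpha>) (Lfield i0 r z \<beta>) * v \<alpha> * cnj (v \<beta>))"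
    and levi_0: "\<And>\<alpha> \<beta>. \<lbrakk>\<alpha> \<in> - {i0, i1}; \<beta> \<in> - {i0, i1}\<rbrakk> \<Longrightarrow>
          levi r 0 (Lfield i0 r 0 \<alpha>) (Lfield i0 r 0 \<beta>) = (if \<alpha> = \<beta> then 1 else 0)"
    and cho_biholomorphic: "\<And>x. x \<in> W \<Longrightarrow>
          bij (\<Phi> x) \<and> holomorphic_map_on (\<Phi> x) UNIV \<and> holomorphic_map_on (inv (\<Phi> x)) UNIV"
    and cho_center: "\<And>x. x \<in> W \<Longrightarrow> \<Phi> x x = 0"
    and cho_normal: "\<And>x e. \<lbrakk>x \<in> W; e > 0\<rbrakk> \<Longrightarrow>
          \<Phi> x (x + axis i0 (complex_of_real (- e)))
            = axis i0 (- 2 * complex_of_real e * pdzbar i0 (\<lambda>x. of_real (r x)) x)"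
    and cho_hermitian: "\<And>x j k. \<lbrakk>x \<in> W; (j, k) \<in> bidegrees (2 * m)\<rbrakk> \<Longrightarrow> a x k j = cnj (a x j k)"
    and cho_expansion: "\<exists>C. \<exists>\<rho>>0. \<forall>x\<in>W. \<forall>\<zeta>. norm \<zeta> < \<rho> \<and> inv (\<Phi> x) \<zeta> \<in> W \<longrightarrow>
          cmod (of_real (r (inv (\<Phi> x) \<zeta>)) - cho_normal_form i0 i1 m (r x) (a x) (b x) \<zeta>)
            \<le> C * cho_remainder_bound i0 i1 m \<zeta>"
    and scaling_parameters: "\<forall>\<^sub>F n in sequentially. \<epsilon> n > 0 \<and> \<xi> n \<in> frontier \<Omega>" "\<epsilon> \<longlonglongrightarrow> 0"
    and subsequence: "strict_mono s"
    \<comment> \<open>\<open>r\<close> is a defining function on \<open>W\<close> only, so \<open>rn n\<close> is meaningful on the image of \<open>W\<close> under \<open>\<psi> n\<close>: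
        local uniform convergence on the whole space includes that these images exhaust it.\<close>
    and exhaustion: "\<And>K. compact K \<Longrightarrow> \<forall>\<^sub>F k in sequentially. K \<subseteq> \<psi> (s k) ` W"
    and convergence: "\<And>K. compact K \<Longrightarrow>
          uniform_limit K (\<lambda>k. rn (s k)) (rP i0 i1 P) sequentially"
    and limit_subharmonic: "subharmonic_on UNIV P"
    and limit_nonzero: "P \<noteq> (\<lambda>_. 0)"
    and limit_at_0: "P 0 = 0"
    and limit_polynomial: "\<exists>c m'. real_polynomial_with P c \<and>
          (\<forall>j>0. c j 0 = 0 \<and> c 0 j = 0) \<and>
          Max {j + k | j k. c j k \<noteq> 0} = 2 * m' \<and> m' \<le> m"

section \<open>The comparison metric\<close>

definition mixed_derivative_max :: "(complex \<Rightarrow> real) \<Rightarrow> nat \<Rightarrow> complex \<Rightarrow> real" where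
  "mixed_derivative_max P l z =
     Max {cmod ((dz ^^ j) ((dzbar ^^ k) (\<lambda>w. of_real (P w))) z) | j k. j > 0 \<and> k > 0 \<and> j + k = l}"

definition M_metric ::
  "'n::finite \<Rightarrow> 'n \<Rightarrow> nat \<Rightarrow> (complex \<Rightarrow> real) \<Rightarrow> complex^'n \<Rightarrow> complex^'n \<Rightarrow> real" where
  "M_metric i0 i1 m P z X =
     cmod (X $ i0 + 2 * X $ i1 * dz (\<lambda>w. of_real (P w)) (z $ i1)
           + 2 * (\<Sum>\<alpha>\<in>- {i0, i1}. X $ \<alpha> * cnj (z $ \<alpha>))) / \<bar>rP i0 i1 P z\<bar>
     + cmod (X $ i1) * (\<Sum>l = 2..2 * m. root l \<bar>mixed_derivative_max P l (z $ i1) / rP i0 i1 P z\<bar>)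
     + (\<Sum>\<alpha>\<in>- {i0, i1}. cmod (X $ \<alpha>) / sqrt \<bar>rP i0 i1 P z\<bar>)"

end

theory Submission
  imports Defs
begin

text \<open>
  After an automorphism of \<open>\<complex> \<times> \<complex>\<^sup>d\<close> removing the harmonic terms of the Taylor expansion of \<open>P\<close> at \<open>z\<^sub>1\<close>,
  and an anisotropic dilation, the point becomes \<open>(-1, 0, 0)\<close>, the quantity \<open>M\<close> becomes comparable to
  the norm, and the domain is \<open>Re \<zeta>\<^sub>0 + Q(\<zeta>\<^sub>1) + |\<zeta>\<^sub>*|\<^sup>2 < 0\<close> with \<open>Q\<close> subharmonic, without harmonic terms and
  with coefficients that are bounded and not all small. The upper bound comes from affine discs.
  For the lower bound let \<open>g = (g\<^sub>0, F, g\<^sub>*)\<close> be a disc centred at \<open>(-1, 0, 0)\<close>. Averaging over a circle gives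
  \<open>\<integral> Q(F) + |g\<^sub>*|\<^sup>2 \<le> 1\<close>, which bounds \<open>g\<^sub>*'(0)\<close>. Let \<open>V\<close> be the logarithmic potential of
  \<open>(1 + |w|\<^sup>2)\<^sup>-\<^sup>N\<close> times the Laplacian of \<open>Q\<close>; then \<open>V = \<kappa> log (1 + |w|\<^sup>2) + O(1)\<close> with \<open>\<kappa> > 0\<close> bounded below, and
  \<open>Q - V\<close> is subharmonic, so that the circle mean of \<open>log (1 + |F|\<^sup>2)\<close> is bounded. Applying the sub-mean value
  property to \<open>(F - F(t)) / (\<cdot> - t)\<close> then gives \<open>|F| \<le> 1\<close> on a disc of fixed radius. There \<open>Re g\<^sub>0\<close> is bounded
  above, and both \<open>F'(0)\<close> and \<open>g\<^sub>0'(0)\<close> are under control.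
\<close>

section \<open>Wirtinger derivatives and circle means\<close>

text \<open>The obstacle is that \<open>Q\<close> need not be proper: a subharmonic polynomial
  without harmonic terms can tend to minus infinity along some rays, so a bound for the mean of
  \<open>Q(F)\<close> says nothing directly about the size of \<open>F\<close>. What has a sign is
  the Laplacian, and the comparison with a logarithm uses nothing else. The weight gives the
  Laplacian a finite total mass, so that its potential is a logarithm up to a bounded error; being
  at most 1, it leaves a nonnegative density for \<open>Q - V\<close>. It is rational because the
  potentials of weighted monomials then follow from finite recursions, without any singular
  integral. The mass is a combination of the diagonal coefficients only. That it controls all
  coefficients rests on positivity: a Fourier coefficient of a nonnegative function is at most its
  mean. The sub-mean value property is only available at the centre of a circle. Passing to the
  difference quotient turns the value at \<open>t\<close> into \<open>F(t) / t\<close> at the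
  centre, and the factor \<open>1 / t\<close> makes \<open>F\<close> not only bounded but small. All
  constants depend on the degree and on a lower bound for one coefficient, so no compactness
  argument is needed.\<close>

definition has_wirtinger ::
  "complex set \<Rightarrow> (complex \<Rightarrow> complex) \<Rightarrow> (complex \<Rightarrow> complex) \<Rightarrow> (complex \<Rightarrow> complex) \<Rightarrow> bool" where
  "has_wirtinger S u g h \<longleftrightarrow> (\<forall>z\<in>S. (u has_derivative (\<lambda>x. g z * x + h z * cnj x)) (at z))"

text \<open>Here \<phi> is a quarter of the Laplacian of \<open>u\<close>. Only \<open>g\<close>,
  the derivative in \<open>z\<close>, is differentiated again; for \<open>h\<close> continuity
  suffices, which is what differentiation under the circle integral asks for.\<close>

definition has_ddbar :: "complex set \<Rightarrow> (complex \<Rightarrow> complex) \<Rightarrow> (complex \<Rightarrow> complex) \<Rightarrow> bool" where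
  "has_ddbar S u \<phi> \<longleftrightarrow> (\<exists>g h k. has_wirtinger S u g h \<and> has_wirtinger S g k \<phi> \<and>
     continuous_on S h \<and> continuous_on S k \<and> continuous_on S \<phi>)"

lemma has_wirtingerD:
  "has_wirtinger S u g h \<Longrightarrow> z \<in> S \<Longrightarrow> (u has_derivative (\<lambda>x. g z * x + h z * cnj x)) (at z)"
  by (auto simp: has_wirtinger_def)

lemma has_wirtinger_continuous_on: "has_wirtinger S u g h \<Longrightarrow> continuous_on S u"
  unfolding has_wirtinger_def
  by (meson continuous_at_imp_continuous_on has_derivative_continuous)

lemma has_ddbarI:
  assumes "has_wirtinger S u g h" "has_wirtinger S g k \<phi>"
    "continuous_on S h" "continuous_on S k" "continuous_on S \<phi>"
  shows "has_ddbar S u \<phi>"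
  using assms unfolding has_ddbar_def by blast

lemma has_wirtinger_cong:
  assumes "has_wirtinger S u g h" "\<And>z. u' z = u z" "\<And>z. z \<in> S \<Longrightarrow> g' z = g z" "\<And>z. z \<in> S \<Longrightarrow> h' z = h z"
  shows "has_wirtinger S u' g' h'"
proof -
  have "u' = u" using assms(2) by auto
  thus ?thesis using assms by (simp add: has_wirtinger_def)
qed

lemma has_wirtinger_id: "has_wirtinger S (\<lambda>z. z) (\<lambda>_. 1) (\<lambda>_. 0)"
  by (auto simp: has_wirtinger_def)

lemma has_wirtinger_const: "has_wirtinger S (\<lambda>_. c) (\<lambda>_. 0) (\<lambda>_. 0)"
  by (auto simp: has_wirtinger_def)

lemma has_wirtinger_add:
  assumes "has_wirtinger S u g h" "has_wirtinger S v k l"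
  shows "has_wirtinger S (\<lambda>z. u z + v z) (\<lambda>z. g z + k z) (\<lambda>z. h z + l z)"
  unfolding has_wirtinger_def
proof
  fix z assume z: "z \<in> S"
  show "((\<lambda>z. u z + v z) has_derivative (\<lambda>x. (g z + k z) * x + (h z + l z) * cnj x)) (at z)"
    using has_derivative_add[OF has_wirtingerD[OF assms(1) z] has_wirtingerD[OF assms(2) z]]
    by (simp add: algebra_simps)
qed

lemma has_wirtinger_mult:
  assumes "has_wirtinger S u g h" "has_wirtinger S v k l"
  shows "has_wirtinger S (\<lambda>z. u z * v z) (\<lambda>z. u z * k z + g z * v z) (\<lambda>z. u z * l z + h z * v z)"
  unfolding has_wirtinger_def
proof
  fix z assume z: "z \<in> S"
  show "((\<lambda>z. u z * v z) has_derivative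
      (\<lambda>x. (u z * k z + g z * v z) * x + (u z * l z + h z * v z) * cnj x)) (at z)"
    using has_derivative_mult[OF has_wirtingerD[OF assms(1) z] has_wirtingerD[OF assms(2) z]]
    by (simp add: algebra_simps)
qed

lemma has_wirtinger_cmult:
  assumes "has_wirtinger S u g h"
  shows "has_wirtinger S (\<lambda>z. c * u z) (\<lambda>z. c * g z) (\<lambda>z. c * h z)"
  using has_wirtinger_mult[OF has_wirtinger_const[of S c] assms] by simp

lemma has_wirtinger_sum:
  assumes "finite I" "\<And>i. i \<in> I \<Longrightarrow> has_wirtinger S (u i) (g i) (h i)"
  shows "has_wirtinger S (\<lambda>z. \<Sum>i\<in>I. u i z) (\<lambda>z. \<Sum>i\<in>I. g i z) (\<lambda>z. \<Sum>i\<in>I. h i z)"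
  using assms
proof (induction I rule: finite_induct)
  case empty
  show ?case by (simp add: has_wirtinger_const)
next
  case (insert i I)
  show ?case
    using has_wirtinger_add[OF insert(4)[of i] insert(3)] insert by simp
qed

lemma has_wirtinger_holomorphic:
  assumes "f holomorphic_on S" "open S"
  shows "has_wirtinger S f (deriv f) (\<lambda>_. 0)"
  unfolding has_wirtinger_def
proof
  fix z assume "z \<in> S"
  hence "(f has_field_derivative deriv f z) (at z)"
    using assms holomorphic_derivI by blast
  thus "(f has_derivative (\<lambda>x. deriv f z * x + 0 * cnj x)) (at z)"
    by (simp add: has_field_derivative_def)
qed

lemma has_wirtinger_compose:
  assumes u: "has_wirtinger T u g h" and f: "f holomorphic_on S" "open S" "f ` S \<subseteq> T"
  shows "has_wirtinger S (\<lambda>z. u (f z)) (\<lambda>z. g (f z) * deriv f z) (\<lambda>z. h (f z) * cnj (deriv f z))"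
  unfolding has_wirtinger_def
proof
  fix z assume z: "z \<in> S"
  hence fz: "f z \<in> T" using f by blast
  show "((\<lambda>z. u (f z)) has_derivative
      (\<lambda>x. g (f z) * deriv f z * x + h (f z) * cnj (deriv f z) * cnj x)) (at z)"
    using has_derivative_compose[OF has_wirtingerD[OF has_wirtinger_holomorphic[OF f(1,2)] z]
        has_wirtingerD[OF u fz]] by (simp add: algebra_simps)
qed

lemma has_ddbar_continuous_on: "has_ddbar S u \<phi> \<Longrightarrow> continuous_on S u"
  unfolding has_ddbar_def using has_wirtinger_continuous_on by blast

text \<open>The factor \<open>|f'|^2\<close> is nonnegative, so a sign of the Laplacian on the plane
  passes to every holomorphic disc, including the points where \<open>f'\<close> vanishes.\<close>

lemma has_ddbar_compose:
  assumes u: "has_ddbar UNIV u \<phi>" and f: "f holomorphic_on S" "open S"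
  shows "has_ddbar S (\<lambda>z. u (f z)) (\<lambda>z. \<phi> (f z) * of_real ((cmod (deriv f z))\<^sup>2))"
proof -
  obtain g h k where w: "has_wirtinger UNIV u g h" "has_wirtinger UNIV g k \<phi>"
    and c: "continuous_on UNIV h" "continuous_on UNIV k" "continuous_on UNIV \<phi>"
    using u unfolding has_ddbar_def by blast
  have d: "deriv f holomorphic_on S" using f by (simp add: holomorphic_deriv)
  have d2: "deriv (deriv f) holomorphic_on S" using d f by (simp add: holomorphic_deriv)
  have cc: "continuous_on S f" "continuous_on S (deriv f)" "continuous_on S (deriv (deriv f))"
    using f d d2 by (simp_all add: holomorphic_on_imp_continuous_on)
  note cg = has_wirtinger_continuous_on[OF w(2)]
  note comp = continuous_on_compose2[OF _ cc(1)]
  show ?thesis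
  proof (rule has_ddbarI)
    show "has_wirtinger S (\<lambda>z. u (f z)) (\<lambda>z. g (f z) * deriv f z) (\<lambda>z. h (f z) * cnj (deriv f z))"
      using has_wirtinger_compose[OF w(1) f] by simp
    show "has_wirtinger S (\<lambda>z. g (f z) * deriv f z)
        (\<lambda>z. g (f z) * deriv (deriv f) z + (k (f z) * deriv f z) * deriv f z)
        (\<lambda>z. \<phi> (f z) * of_real ((cmod (deriv f z))\<^sup>2))"
    proof (rule has_wirtinger_cong[OF has_wirtinger_mult[OF has_wirtinger_compose[OF w(2) f]
              has_wirtinger_holomorphic[OF d f(2)]]])
    qed (simp_all add: algebra_simps complex_norm_square del: of_real_power)
  qed (intro continuous_intros cc comp[OF c(1)] comp[OF c(2)] comp[OF c(3)] comp[OF cg]; simp)+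
qed

lemma has_ddbar_add:
  assumes "has_ddbar S u \<phi>" "has_ddbar S v \<psi>"
  shows "has_ddbar S (\<lambda>z. u z + v z) (\<lambda>z. \<phi> z + \<psi> z)"
proof -
  obtain g h k where w: "has_wirtinger S u g h" "has_wirtinger S g k \<phi>"
    and c: "continuous_on S h" "continuous_on S k" "continuous_on S \<phi>"
    using assms unfolding has_ddbar_def by blast
  obtain g' h' k' where w': "has_wirtinger S v g' h'" "has_wirtinger S g' k' \<psi>"
    and c': "continuous_on S h'" "continuous_on S k'" "continuous_on S \<psi>"
    using assms unfolding has_ddbar_def by blast
  show ?thesis
    by (rule has_ddbarI[OF has_wirtinger_add[OF w(1) w'(1)] has_wirtinger_add[OF w(2) w'(2)]])
       (intro continuous_intros c c')+
qed

lemma has_ddbar_cmult: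
  assumes "has_ddbar S u \<phi>"
  shows "has_ddbar S (\<lambda>z. c * u z) (\<lambda>z. c * \<phi> z)"
proof -
  obtain g h k where w: "has_wirtinger S u g h" "has_wirtinger S g k \<phi>"
    and c: "continuous_on S h" "continuous_on S k" "continuous_on S \<phi>"
    using assms unfolding has_ddbar_def by blast
  show ?thesis
    by (rule has_ddbarI[OF has_wirtinger_cmult[OF w(1)] has_wirtinger_cmult[OF w(2)]])
       (intro continuous_intros c)+
qed

lemma has_ddbar_const: "has_ddbar S (\<lambda>_. c) (\<lambda>_. 0)"
  by (rule has_ddbarI[OF has_wirtinger_const has_wirtinger_const]) auto

lemma has_ddbar_sum:
  assumes "finite I" "\<And>i. i \<in> I \<Longrightarrow> has_ddbar S (u i) (\<phi> i)"
  shows "has_ddbar S (\<lambda>z. \<Sum>i\<in>I. u i z) (\<lambda>z. \<Sum>i\<in>I. \<phi> i z)"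
  using assms
proof (induction I rule: finite_induct)
  case empty
  show ?case by (simp add: has_ddbar_const)
next
  case (insert i I)
  show ?case using has_ddbar_add[OF insert(4)[of i] insert(3)] insert by simp
qed

section \<open>Polar coordinates and the sub-mean value property\<close>

lemma has_wirtinger_polar:
  assumes w: "has_wirtinger (ball 0 R) u g h" and r: "\<bar>r\<bar> < R"
  shows "((\<lambda>r. u (of_real r * cis t)) has_vector_derivative
            (g (of_real r * cis t) * cis t + h (of_real r * cis t) * cis (-t))) (at r)"
    and "((\<lambda>t. u (of_real r * cis t)) has_vector_derivative
            (\<i> * of_real r * (g (of_real r * cis t) * cis t - h (of_real r * cis t) * cis (-t)))) (at t)"
proof -
  let ?z = "of_real r * cis t :: complex"
  have z: "?z \<in> ball 0 R" using r by (simp add: norm_mult)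
  note D = has_wirtingerD[OF w z]
  have "((\<lambda>r. of_real r * cis t) has_derivative (\<lambda>x. of_real x * cis t)) (at r)"
    by (auto intro!: derivative_eq_intros)
  from has_derivative_compose[OF this D]
  show "((\<lambda>r. u (of_real r * cis t)) has_vector_derivative
            (g ?z * cis t + h ?z * cis (-t))) (at r)"
    by (simp add: has_vector_derivative_def scaleR_conv_of_real cis_cnj algebra_simps)
  have "(cis has_vector_derivative (\<i> * cis t)) (at t)"
    unfolding has_vector_derivative_complex_iff
    by (auto intro!: derivative_eq_intros)
  hence "((\<lambda>t. of_real r * cis t) has_derivative (\<lambda>x. of_real r * (of_real x * (\<i> * cis t)))) (at t)"
    unfolding has_vector_derivative_def
    by (auto intro!: derivative_eq_intros simp: scaleR_conv_of_real)
  from has_derivative_compose[OF this D]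
  show "((\<lambda>t. u (of_real r * cis t)) has_vector_derivative
            (\<i> * of_real r * (g ?z * cis t - h ?z * cis (-t)))) (at t)"
    by (simp add: has_vector_derivative_def scaleR_conv_of_real cis_cnj algebra_simps)
qed

text \<open>
  Writing \<open>M(r)\<close> for the circle integral of \<open>u\<close> and \<open>J(r)\<close> for that of \<open>r e\<^sup>i\<^sup>t \<partial>u\<close>, integration by parts in the
  angle gives \<open>r M' = 2 J\<close> and \<open>J' = 2 r \<integral> \<phi>\<close>.
\<close>

lemma circle_mean_ge:
  assumes dd: "has_ddbar (ball 0 R) u \<phi>" and pos: "\<And>z. z \<in> ball 0 R \<Longrightarrow> Re (\<phi> z) \<ge> 0"
    and s: "0 < s" "s < R"
  shows "2 * pi * Re (u 0) \<le> Re (integral {0..2*pi} (\<lambda>t. u (of_real s * cis t)))"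
proof -
  obtain g h k where w: "has_wirtinger (ball 0 R) u g h" "has_wirtinger (ball 0 R) g k \<phi>"
    and c: "continuous_on (ball 0 R) h" "continuous_on (ball 0 R) k" "continuous_on (ball 0 R) \<phi>"
    using dd unfolding has_ddbar_def by blast
  note cu = has_wirtinger_continuous_on[OF w(1)] and cg = has_wirtinger_continuous_on[OF w(2)]
  \<comment> \<open>Negative radii make \<open>r = 0\<close> an interior point, so that
    \<open>M\<close> and \<open>J\<close> have two-sided derivatives there.\<close>
  let ?U = "{-R<..<R}"
  have mem: "of_real r * cis t \<in> ball 0 R" if "r \<in> ?U" for r t
    using that by (auto simp: norm_mult)
  have c2: "continuous_on (?U \<times> cbox 0 (2*pi)) (\<lambda>x. v (of_real (fst x) * cis (snd x)))"
    if "continuous_on (ball 0 R) v" for v :: "complex \<Rightarrow> complex"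
    by (rule continuous_on_compose2[OF that]) (use mem in \<open>auto intro!: continuous_intros\<close>)
  have c1: "continuous_on T (\<lambda>t. v (of_real r * cis t))"
    if "continuous_on (ball 0 R) v" "r \<in> ?U" for v :: "complex \<Rightarrow> complex" and r T
    by (rule continuous_on_compose2[OF that(1)]) (use mem that(2) in \<open>auto intro!: continuous_intros\<close>)
  define M where "M r = integral (cbox 0 (2*pi)) (\<lambda>t. u (of_real r * cis t))" for r
  define J where "J r = integral (cbox 0 (2*pi)) (\<lambda>t. of_real r * (g (of_real r * cis t) * cis t))" for r
  have M': "(M has_vector_derivative integral (cbox 0 (2*pi))
      (\<lambda>t. g (of_real r * cis t) * cis t + h (of_real r * cis t) * cis (-t))) (at r)" if r: "r \<in> ?U" for r
  proof -
    have "(M has_vector_derivative integral (cbox 0 (2*pi))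
      (\<lambda>t. g (of_real r * cis t) * cis t + h (of_real r * cis t) * cis (-t))) (at r within ?U)"
      unfolding M_def
    proof (rule leibniz_rule_vector_derivative[OF _ _ _ r])
      fix r t assume "r \<in> ?U"
      thus "((\<lambda>r. u (of_real r * cis t)) has_vector_derivative
            (g (of_real r * cis t) * cis t + h (of_real r * cis t) * cis (-t))) (at r within ?U)"
        by (intro has_wirtinger_polar[OF w(1), THEN has_vector_derivative_at_within]) auto
    next
      fix r assume "r \<in> ?U"
      thus "(\<lambda>t. u (of_real r * cis t)) integrable_on cbox 0 (2*pi)"
        by (intro integrable_continuous c1[OF cu])
    next
      show "continuous_on (?U \<times> cbox 0 (2*pi)) (\<lambda>(r, t).
          g (of_real r * cis t) * cis t + h (of_real r * cis t) * cis (-t))"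
        unfolding case_prod_unfold by (intro continuous_intros c2[OF cg] c2[OF c(1)])
    qed simp
    thus ?thesis using has_vector_derivative_within_open[OF r open_greaterThanLessThan] by blast
  qed
  have J': "(J has_vector_derivative integral (cbox 0 (2*pi))
      (\<lambda>t. of_real r * ((k (of_real r * cis t) * cis t + \<phi> (of_real r * cis t) * cis (-t)) * cis t)
          + g (of_real r * cis t) * cis t)) (at r)" if r: "r \<in> ?U" for r
  proof -
    have "(J has_vector_derivative integral (cbox 0 (2*pi))
      (\<lambda>t. of_real r * ((k (of_real r * cis t) * cis t + \<phi> (of_real r * cis t) * cis (-t)) * cis t)
          + g (of_real r * cis t) * cis t)) (at r within ?U)"
      unfolding J_def
    proof (rule leibniz_rule_vector_derivative[OF _ _ _ r])
      fix r t assume "r \<in> ?U"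
      hence "((\<lambda>r. g (of_real r * cis t)) has_vector_derivative
            (k (of_real r * cis t) * cis t + \<phi> (of_real r * cis t) * cis (-t))) (at r within ?U)"
        by (intro has_wirtinger_polar[OF w(2), THEN has_vector_derivative_at_within]) auto
      hence 1: "((\<lambda>r. g (of_real r * cis t) * cis t) has_vector_derivative
            ((k (of_real r * cis t) * cis t + \<phi> (of_real r * cis t) * cis (-t)) * cis t)) (at r within ?U)"
        by (rule has_vector_derivative_mult_left)
      have 2: "((\<lambda>r. of_real r :: complex) has_vector_derivative 1) (at r within ?U)"
        using has_derivative_of_real[OF has_derivative_ident]
        by (simp add: has_vector_derivative_def scaleR_conv_of_real)
      show "((\<lambda>r. of_real r * (g (of_real r * cis t) * cis t)) has_vector_derivative
         of_real r * ((k (of_real r * cis t) * cis t + \<phi> (of_real r * cis t) * cis (-t)) * cis t)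
          + g (of_real r * cis t) * cis t) (at r within ?U)"
        using has_vector_derivative_mult[OF 2 1] by simp
    next
      fix r assume "r \<in> ?U"
      thus "(\<lambda>t. of_real r * (g (of_real r * cis t) * cis t)) integrable_on cbox 0 (2*pi)"
        by (intro integrable_continuous continuous_intros c1[OF cg])
    next
      show "continuous_on (?U \<times> cbox 0 (2*pi)) (\<lambda>(r, t).
          of_real r * ((k (of_real r * cis t) * cis t + \<phi> (of_real r * cis t) * cis (-t)) * cis t)
          + g (of_real r * cis t) * cis t)"
        unfolding case_prod_unfold by (intro continuous_intros c2[OF cg] c2[OF c(2)] c2[OF c(3)])
    qed simp
    thus ?thesis using has_vector_derivative_within_open[OF r open_greaterThanLessThan] by blast
  qed
  \<comment> \<open>The integral of the angular derivative of \<open>u\<close> over a period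
    vanishes, so the \<open>g\<close> and \<open>h\<close> contributions are equal after
    multiplication by \<open>r\<close>.\<close>
  have MJ: "of_real r * integral (cbox 0 (2*pi))
      (\<lambda>t. g (of_real r * cis t) * cis t + h (of_real r * cis t) * cis (-t)) = 2 * J r"
    if r: "r \<in> ?U" for r
  proof -
    have i: "(\<lambda>t. g (of_real r * cis t) * cis t) integrable_on cbox 0 (2*pi)"
      "(\<lambda>t. h (of_real r * cis t) * cis (-t)) integrable_on cbox 0 (2*pi)"
      by (intro integrable_continuous continuous_intros c1[OF cg r] c1[OF c(1) r])+
    have "((\<lambda>t. \<i> * of_real r * (g (of_real r * cis t) * cis t - h (of_real r * cis t) * cis (-t)))
        has_integral (u (of_real r * cis (2*pi)) - u (of_real r * cis 0))) {0..2*pi}"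
      by (rule fundamental_theorem_of_calculus)
        (use r in \<open>auto intro!: has_wirtinger_polar[OF w(1), THEN has_vector_derivative_at_within]\<close>)
    from integral_unique[OF this]
    have "of_real r * integral (cbox 0 (2*pi)) (\<lambda>t. g (of_real r * cis t) * cis t)
         = of_real r * integral (cbox 0 (2*pi)) (\<lambda>t. h (of_real r * cis t) * cis (-t))"
      using i by (auto simp: integral_mult_right integral_diff)
    moreover have "J r = of_real r * integral (cbox 0 (2*pi)) (\<lambda>t. g (of_real r * cis t) * cis t)"
      unfolding J_def by (rule integral_mult_right)
    ultimately show ?thesis
      using i by (simp only: integral_add distrib_left mult_2)
  qed
  have Jp: "Re (integral (cbox 0 (2*pi))
      (\<lambda>t. of_real r * ((k (of_real r * cis t) * cis t + \<phi> (of_real r * cis t) * cis (-t)) * cis t)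
          + g (of_real r * cis t) * cis t)) \<ge> 0" if r: "r \<in> ?U" "r \<ge> 0" for r
  proof -
    note cc = continuous_intros c1[OF cg r(1)] c1[OF c(2) r(1)] c1[OF c(3) r(1)]
    \<comment> \<open>\<open>A\<close> is the angular derivative of \<open>g e^(it)\<close> and
      integrates to 0 over a period. The integrand of \<open>J'\<close> is \<open>- \<i> * A\<close>
      plus \<open>2 r \<phi>\<close>, so only \<phi> survives.\<close>
    define A where "A t = \<i> * (of_real r * ((k (of_real r * cis t) * cis t - \<phi> (of_real r * cis t) * cis (-t)) * cis t)
          + g (of_real r * cis t) * cis t)" for t
    have cA: "A integrable_on cbox 0 (2*pi)"
      unfolding A_def by (intro integrable_continuous cc)
    have d: "((\<lambda>t. g (of_real r * cis t) * cis t) has_vector_derivative A t) (at t within {0..2*pi})" for t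
    proof -
      have 1: "((\<lambda>t. g (of_real r * cis t)) has_vector_derivative
            (\<i> * of_real r * (k (of_real r * cis t) * cis t - \<phi> (of_real r * cis t) * cis (-t)))) (at t)"
        using r by (intro has_wirtinger_polar[OF w(2)]) auto
      have 2: "(cis has_vector_derivative (\<i> * cis t)) (at t)"
        unfolding has_vector_derivative_complex_iff
        by (auto intro!: derivative_eq_intros)
      have "((\<lambda>t. g (of_real r * cis t) * cis t) has_vector_derivative A t) (at t)"
        using has_vector_derivative_mult[OF 1 2] unfolding A_def by (simp add: algebra_simps)
      thus ?thesis by (rule has_vector_derivative_at_within)
    qed
    have "(A has_integral (g (of_real r * cis (2*pi)) * cis (2*pi) - g (of_real r * cis 0) * cis 0)) {0..2*pi}"
      by (rule fundamental_theorem_of_calculus) (use d in auto)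
    hence "integral (cbox 0 (2*pi)) A = 0" by (simp add: integral_unique)
    hence 0: "integral (cbox 0 (2*pi)) (\<lambda>t. - \<i> * A t) = 0" using cA by (simp add: integral_mult_right)
    have cz: "cis (- t) * cis t = 1" for t by (simp add: cis_mult)
    have eq: "of_real r * ((k (of_real r * cis t) * cis t + \<phi> (of_real r * cis t) * cis (-t)) * cis t)
          + g (of_real r * cis t) * cis t = - \<i> * A t + of_real (2*r) * \<phi> (of_real r * cis t)" for t
      unfolding A_def using cz[of t] by (simp add: algebra_simps) 
    have iphi: "(\<lambda>t. \<phi> (of_real r * cis t)) integrable_on cbox 0 (2*pi)"
      by (intro integrable_continuous cc)
    have "integral (cbox 0 (2*pi))
      (\<lambda>t. of_real r * ((k (of_real r * cis t) * cis t + \<phi> (of_real r * cis t) * cis (-t)) * cis t)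
          + g (of_real r * cis t) * cis t) =
        integral (cbox 0 (2*pi)) (\<lambda>t. - \<i> * A t + of_real (2*r) * \<phi> (of_real r * cis t))"
      by (simp only: eq)
    also have "\<dots> = integral (cbox 0 (2*pi)) (\<lambda>t. of_real (2*r) * \<phi> (of_real r * cis t))"
      using integral_add[OF integrable_on_mult_right[OF cA, of "- \<i>"]
          integrable_on_mult_right[OF iphi, of "of_real (2*r)"]] 0 by simp
    also have "\<dots> = of_real (2*r) * integral (cbox 0 (2*pi)) (\<lambda>t. \<phi> (of_real r * cis t))"
      using iphi by (simp add: integral_mult_right)
    finally have e: "integral (cbox 0 (2*pi))
      (\<lambda>t. of_real r * ((k (of_real r * cis t) * cis t + \<phi> (of_real r * cis t) * cis (-t)) * cis t)
          + g (of_real r * cis t) * cis t) = of_real (2*r) * integral (cbox 0 (2*pi)) (\<lambda>t. \<phi> (of_real r * cis t))" .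
    have "Re (integral (cbox 0 (2*pi)) (\<lambda>t. \<phi> (of_real r * cis t)))
        = integral (cbox 0 (2*pi)) (\<lambda>t. Re (\<phi> (of_real r * cis t)))"
      using integral_linear[OF iphi bounded_linear_Re] by (simp add: o_def)
    also have "\<dots> \<ge> 0"
    proof (rule integral_nonneg)
      show "(\<lambda>t. Re (\<phi> (of_real r * cis t))) integrable_on cbox 0 (2*pi)"
        by (intro integrable_continuous cc)
    qed (rule pos[OF mem[OF r(1)]])
    finally show ?thesis unfolding e using r by simp
  qed
  have RJ: "((\<lambda>r. Re (J r)) has_real_derivative Re (integral (cbox 0 (2*pi))
      (\<lambda>t. of_real r * ((k (of_real r * cis t) * cis t + \<phi> (of_real r * cis t) * cis (-t)) * cis t)
          + g (of_real r * cis t) * cis t))) (at r)" if "r \<in> ?U" for r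
    using J'[OF that] unfolding has_vector_derivative_complex_iff by blast
  have RM: "((\<lambda>r. Re (M r)) has_real_derivative Re (integral (cbox 0 (2*pi))
      (\<lambda>t. g (of_real r * cis t) * cis t + h (of_real r * cis t) * cis (-t)))) (at r)" if "r \<in> ?U" for r
    using M'[OF that] unfolding has_vector_derivative_complex_iff by blast
  have J0: "Re (J r) \<ge> 0" if "0 \<le> r" "r \<le> s" for r
  proof -
    have "Re (J 0) \<le> Re (J r)"
    proof (rule DERIV_nonneg_imp_nondecreasing[OF that(1)])
      fix x assume "0 \<le> x" "x \<le> r"
      hence x: "x \<in> ?U" "x \<ge> 0" using that s by auto
      show "\<exists>y. ((\<lambda>a. Re (J a)) has_real_derivative y) (at x) \<and> 0 \<le> y"
        using RJ[OF x(1)] Jp[OF x] by blast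
    qed
    thus ?thesis by (simp add: J_def)
  qed
  have "Re (M 0) \<le> Re (M s)"
  \<comment> \<open>The relation \<open>r M' = 2 J\<close> gives no sign of \<open>M'\<close> at
    \<open>r = 0\<close>; continuity is enough at the end points.\<close>
  proof (rule DERIV_nonneg_imp_increasing_open[where f = "\<lambda>r. Re (M r)"])
    fix r assume r: "0 < r" "r < s"
    let ?D = "Re (integral (cbox 0 (2*pi))
      (\<lambda>t. g (of_real r * cis t) * cis t + h (of_real r * cis t) * cis (-t)))"
    have rU: "r \<in> ?U" using r s by auto
    have "r * ?D = 2 * Re (J r)" using arg_cong[OF MJ[OF rU], of Re] by (simp del: integral_mult_right)
    hence "r * ?D \<ge> 0" using J0[of r] r by linarith
    moreover have "y \<ge> 0" if "r * y \<ge> 0" for y using that r(1) by (simp add: zero_le_mult_iff)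
    ultimately have "?D \<ge> 0" by blast
    thus "\<exists>y. ((\<lambda>r. Re (M r)) has_real_derivative y) (at r) \<and> 0 \<le> y"
      using RM[OF rU] by blast
  next
    have "continuous (at r) (\<lambda>r. Re (M r))" if "r \<in> {0..s}" for r
    proof -
      have "r \<in> ?U" using that s by auto
      from DERIV_isCont[OF RM[OF this]] show ?thesis .
    qed
    thus "continuous_on {0..s} (\<lambda>r. Re (M r))"
      by (simp add: continuous_at_imp_continuous_on)
  qed (use s in auto)
  thus ?thesis by (simp add: M_def scaleR_conv_of_real)
qed

section \<open>Logarithmic potentials of weighted monomials\<close>

text \<open>Writing \<open>|z|^2\<close> as \<open>z * cnj z\<close> keeps the family closed under
  both Wirtinger derivatives, with complex coefficients throughout.\<close>

definition weighted_monomial :: "nat \<Rightarrow> nat \<Rightarrow> nat \<Rightarrow> complex \<Rightarrow> complex" where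
  "weighted_monomial a b n z = z ^ a * cnj z ^ b * inverse (1 + z * cnj z) ^ n"

lemma one_plus_norm_sq: "1 + z * cnj z = of_real (1 + (cmod z)\<^sup>2)"
  by (simp add: complex_norm_square del: of_real_power)

lemma one_plus_norm_sq_nonzero: "1 + z * cnj z \<noteq> 0"
  unfolding one_plus_norm_sq of_real_eq_0_iff by (smt (verit) zero_le_power2)

text \<open>Since \<open>|z|^2 / (1 + |z|^2) = 1 - 1 / (1 + |z|^2)\<close>, a common factor
  \<open>|z|^2\<close> can be traded for a change of the weight. This reduces every pair of
  exponents to one with a zero entry.\<close>

lemma weighted_monomial_Suc: "weighted_monomial (Suc a) (Suc b) (Suc n) z = weighted_monomial a b n z - weighted_monomial a b (Suc n) z"
proof -
  have "inverse (1 + z * cnj z) * (z * cnj z) = 1 - inverse (1 + z * cnj z)"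
    using one_plus_norm_sq_nonzero[of z] by (simp add: field_simps)
  hence "z ^ a * cnj z ^ b * inverse (1 + z * cnj z) ^ n * (inverse (1 + z * cnj z) * (z * cnj z))
     = z ^ a * cnj z ^ b * inverse (1 + z * cnj z) ^ n * (1 - inverse (1 + z * cnj z))"
    by simp
  thus ?thesis by (simp add: weighted_monomial_def algebra_simps)
qed

lemma weighted_monomial_bounded:
  assumes "a + b \<le> 2 * n"
  shows "cmod (weighted_monomial a b n z) \<le> 1"
proof -
  let ?t = "1 + (cmod z)\<^sup>2"
  have t: "?t \<ge> 1" by simp
  have "cmod z ^ (a + b) \<le> ?t ^ n"
  proof (cases "cmod z \<le> 1")
    case True
    hence "cmod z ^ (a + b) \<le> 1" by (simp add: power_le_one)
    also have "1 \<le> ?t ^ n" using t by (rule one_le_power)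
    finally show ?thesis .
  next
    case False
    hence "cmod z ^ (a + b) \<le> cmod z ^ (2 * n)" using assms by (simp add: power_increasing)
    also have "\<dots> \<le> ?t ^ n" unfolding power_mult by (rule power_mono) auto
    finally show ?thesis .
  qed
  moreover have "?t ^ n > 0" using t by (smt (verit) zero_less_power)
  moreover have "cmod (weighted_monomial a b n z) = cmod z ^ (a + b) / ?t ^ n"
    unfolding weighted_monomial_def one_plus_norm_sq
    by (simp add: norm_mult norm_power norm_inverse power_add divide_inverse power_inverse del: of_real_add of_real_power)
  ultimately show ?thesis by (simp add: divide_le_eq)
qed

lemma has_wirtinger_power: "has_wirtinger S (\<lambda>z. z ^ a) (\<lambda>z. of_nat a * z ^ (a - 1)) (\<lambda>_. 0)"
  by (auto simp: has_wirtinger_def has_field_derivative_def[symmetric] intro!: derivative_eq_intros)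

lemma has_wirtinger_cnj_power:
  "has_wirtinger S (\<lambda>z. cnj z ^ a) (\<lambda>_. 0) (\<lambda>z. of_nat a * cnj z ^ (a - 1))"
  unfolding has_wirtinger_def
proof
  fix z assume "z \<in> S"
  show "((\<lambda>z. cnj z ^ a) has_derivative (\<lambda>x. 0 * x + of_nat a * cnj z ^ (a - 1) * cnj x)) (at z)"
    using has_derivative_cnj[OF has_wirtingerD[OF has_wirtinger_power[of UNIV a], of z]] by simp
qed

lemma has_wirtinger_inverse_one_plus:
  "has_wirtinger S (\<lambda>z. inverse (1 + z * cnj z) ^ n)
     (\<lambda>z. - of_nat n * cnj z * inverse (1 + z * cnj z) ^ Suc n)
     (\<lambda>z. - of_nat n * z * inverse (1 + z * cnj z) ^ Suc n)"
  unfolding has_wirtinger_def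
proof
  fix z assume "z \<in> S"
  have 1: "((\<lambda>z. 1 + z * cnj z) has_derivative (\<lambda>x. z * cnj x + x * cnj z)) (at z)"
    by (auto intro!: derivative_eq_intros)
  have "((\<lambda>w. inverse w ^ n) has_field_derivative - of_nat n * inverse w ^ Suc n) (at w)"
    if "w \<noteq> 0" for w :: complex
  proof (cases n)
    case (Suc k)
    have "((\<lambda>w. inverse w ^ n) has_field_derivative
        of_nat n * (- (inverse w ^ Suc (Suc 0)) * inverse w ^ (n - Suc 0))) (at w)"
      by (rule DERIV_power[OF DERIV_inverse[OF that]])
    thus ?thesis using Suc by (simp add: algebra_simps)
  qed simp
  hence 2: "((\<lambda>w. inverse w ^ n) has_derivative
      (\<lambda>x. (- of_nat n * inverse (1 + z * cnj z) ^ Suc n) * x)) (at (1 + z * cnj z))"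
    unfolding has_field_derivative_def[symmetric]
    using one_plus_norm_sq_nonzero[of z] by blast
  show "((\<lambda>z. inverse (1 + z * cnj z) ^ n) has_derivative
     (\<lambda>x. - of_nat n * cnj z * inverse (1 + z * cnj z) ^ Suc n * x +
          - of_nat n * z * inverse (1 + z * cnj z) ^ Suc n * cnj x)) (at z)"
    using has_derivative_compose[OF 1 2] by (simp add: algebra_simps)
qed

lemma has_wirtinger_weighted_monomial:
  "has_wirtinger S (weighted_monomial a b n)
     (\<lambda>z. of_nat a * weighted_monomial (a - 1) b n z - of_nat n * weighted_monomial a (Suc b) (Suc n) z)
     (\<lambda>z. of_nat b * weighted_monomial a (b - 1) n z - of_nat n * weighted_monomial (Suc a) b (Suc n) z)"
  by (rule has_wirtinger_cong[OF has_wirtinger_mult[OF has_wirtinger_mult[OF has_wirtinger_power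
          has_wirtinger_cnj_power] has_wirtinger_inverse_one_plus], of _ a b n])
     (simp_all add: weighted_monomial_def algebra_simps)

lemma continuous_on_weighted_monomial [continuous_intros]: "continuous_on S (weighted_monomial a b n)"
  using has_wirtinger_weighted_monomial has_wirtinger_continuous_on by blast

text \<open>On the axes the exponents \<open>a\<close>, \<open>b\<close> do not change, so this is a
  two-term relation in the weight alone and can be solved for the weight \<open>n + 2\<close>. The
  first term drops out for \<open>n = a + b\<close>, which starts the recursion.\<close>

lemma has_ddbar_weighted_monomial:
  assumes "a = 0 \<or> b = 0"
  shows "has_ddbar S (weighted_monomial a b n)
    (\<lambda>z. of_nat n * (of_nat n - of_nat (a + b)) * weighted_monomial a b (Suc n) z
         - of_nat n * of_nat (Suc n) * weighted_monomial a b (Suc (Suc n)) z)"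
proof (rule has_ddbarI)
  show "has_wirtinger S (weighted_monomial a b n)
     (\<lambda>z. of_nat a * weighted_monomial (a - 1) b n z + (- of_nat n) * weighted_monomial a (Suc b) (Suc n) z)
     (\<lambda>z. of_nat b * weighted_monomial a (b - 1) n z - of_nat n * weighted_monomial (Suc a) b (Suc n) z)"
    by (rule has_wirtinger_cong[OF has_wirtinger_weighted_monomial]) auto
  show "has_wirtinger S (\<lambda>z. of_nat a * weighted_monomial (a - 1) b n z + (- of_nat n) * weighted_monomial a (Suc b) (Suc n) z)
     (\<lambda>z. of_nat a * (of_nat (a - 1) * weighted_monomial (a - 1 - 1) b n z - of_nat n * weighted_monomial (a - 1) (Suc b) (Suc n) z)
       + (- of_nat n) * (of_nat a * weighted_monomial (a - 1) (Suc b) (Suc n) z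
            - of_nat (Suc n) * weighted_monomial a (Suc (Suc b)) (Suc (Suc n)) z))
     (\<lambda>z. of_nat n * (of_nat n - of_nat (a + b)) * weighted_monomial a b (Suc n) z
         - of_nat n * of_nat (Suc n) * weighted_monomial a b (Suc (Suc n)) z)"
  proof (rule has_wirtinger_cong[OF has_wirtinger_add[OF has_wirtinger_cmult[OF has_wirtinger_weighted_monomial]
            has_wirtinger_cmult[OF has_wirtinger_weighted_monomial]]])
    fix z
    show "of_nat n * (of_nat n - of_nat (a + b)) * weighted_monomial a b (Suc n) z
         - of_nat n * of_nat (Suc n) * weighted_monomial a b (Suc (Suc n)) z
      = of_nat a * (of_nat b * weighted_monomial (a - 1) (b - 1) n z - of_nat n * weighted_monomial (Suc (a - 1)) b (Suc n) z)
       + - of_nat n * (of_nat (Suc b) * weighted_monomial a (Suc b - 1) (Suc n) z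
            - of_nat (Suc n) * weighted_monomial (Suc a) (Suc b) (Suc (Suc n)) z)"
      using assms by (cases a) (auto simp: weighted_monomial_Suc algebra_simps)
  qed simp_all
qed (intro continuous_intros)+

lemma has_wirtinger_ln:
  "has_wirtinger S (\<lambda>z. of_real (ln (1 + (cmod z)\<^sup>2))) (weighted_monomial 0 1 1) (weighted_monomial 1 0 1)"
  unfolding has_wirtinger_def
proof
  fix z :: complex
  have p: "1 + z \<bullet> z > 0" by (smt (verit) inner_ge_zero)
  have "((\<lambda>z. of_real (ln (1 + z \<bullet> z)) :: complex) has_derivative
      (\<lambda>x. of_real (2 * (z \<bullet> x) / (1 + z \<bullet> z)))) (at z)"
    using p by (auto intro!: derivative_eq_intros simp: inner_commute divide_inverse)
  moreover have "of_real (2 * (z \<bullet> x) / (1 + z \<bullet> z)) = weighted_monomial 0 1 1 z * x + weighted_monomial 1 0 1 z * cnj x" for x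
  proof -
    have "complex_of_real (2 * (z \<bullet> x)) = cnj z * x + z * cnj x"
      by (simp add: complex_eq_iff inner_complex_def)
    moreover have "complex_of_real (1 + z \<bullet> z) = 1 + z * cnj z"
      by (simp add: complex_eq_iff inner_complex_def)
    ultimately show ?thesis
      by (simp only: of_real_divide) (simp add: weighted_monomial_def divide_inverse algebra_simps)
  qed
  ultimately show "((\<lambda>z. of_real (ln (1 + (cmod z)\<^sup>2))) has_derivative
      (\<lambda>x. weighted_monomial 0 1 1 z * x + weighted_monomial 1 0 1 z * cnj x)) (at z)"
    by (simp add: power2_norm_eq_inner)
qed

text \<open>This density is the reference one: its potential carries the logarithmic growth, and any
  other density is compared with it by total mass.\<close>

lemma has_ddbar_ln: "has_ddbar S (\<lambda>z. of_real (ln (1 + (cmod z)\<^sup>2))) (weighted_monomial 0 0 2)"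
proof (rule has_ddbarI[OF has_wirtinger_ln])
  show "has_wirtinger S (weighted_monomial 0 1 1) (\<lambda>z. 0 - weighted_monomial 0 2 2 z) (weighted_monomial 0 0 2)"
    by (rule has_wirtinger_cong[OF has_wirtinger_weighted_monomial[of S 0 1 1]])
       (use weighted_monomial_Suc[of 0 0 1] in \<open>simp_all add: numeral_2_eq_2\<close>)
qed (intro continuous_intros)+

text \<open>The Beta integral is \<open>1 / \<pi>\<close> times the total mass of the weighted monomial over the plane.\<close>

definition log_mass :: "nat \<Rightarrow> nat \<Rightarrow> nat \<Rightarrow> real" where
  "log_mass a b n = (if a = b then integral {0..1} (\<lambda>y. y ^ a * (1 - y) ^ (n - 2 - a)) else 0)"

lemma log_mass_0: "n \<ge> 2 \<Longrightarrow> log_mass 0 0 n = 1 / (real n - 1)"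
proof -
  assume n: "n \<ge> 2"
  have "((\<lambda>y. (1 - y) ^ (n - 2)) has_integral
     (- ((1 - 1) ^ (n - 1) / (real n - 1)) - - ((1 - 0) ^ (n - 1) / (real n - 1)))) {0..1::real}"
  proof (rule fundamental_theorem_of_calculus)
    fix x :: real
    have "((\<lambda>y. - ((1 - y) ^ (n - 1) / (real n - 1))) has_real_derivative (1 - x) ^ (n - 2)) (at x within {0..1})"
      using n by (auto intro!: derivative_eq_intros simp: of_nat_diff diff_diff_eq numeral_2_eq_2)
    thus "((\<lambda>y. - ((1 - y) ^ (n - 1) / (real n - 1))) has_vector_derivative (1 - x) ^ (n - 2)) (at x within {0..1})"
      by (simp add: has_real_derivative_iff_has_vector_derivative)
  qed simp
  from integral_unique[OF this] n show ?thesis by (simp add: log_mass_def power_0_left)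
qed

text \<open>The masses obey the recursion of \<open>weighted_monomial_Suc\<close>, here because
  \<open>y = 1 - (1 - y)\<close>. The bound on \<open>n\<close> keeps the natural-number exponents
  free of truncation.\<close>

lemma log_mass_Suc:
  assumes "max a b + 2 \<le> n"
  shows "log_mass (Suc a) (Suc b) (Suc n) = log_mass a b n - log_mass a b (Suc n)"
proof (cases "a = b")
  case True
  have i: "(\<lambda>y. y ^ a * (1 - y) ^ (n - 2 - a)) integrable_on {0..1::real}"
    "(\<lambda>y. y ^ a * (1 - y) ^ (Suc n - 2 - a)) integrable_on {0..1::real}"
    by (intro integrable_continuous_real continuous_intros)+
  have "Suc n - 2 - a = Suc (n - 2 - a)" "Suc n - 2 - Suc a = n - 2 - a" using assms True by auto
  hence "y ^ Suc a * (1 - y) ^ (Suc n - 2 - Suc a) =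
      y ^ a * (1 - y) ^ (n - 2 - a) - y ^ a * (1 - y) ^ (Suc n - 2 - a)" for y :: real
    by (simp add: algebra_simps)
  thus ?thesis using True integral_diff[OF i] by (simp add: log_mass_def)
qed (simp add: log_mass_def)

text \<open>For the smallest weight either the density is the reference one, or its mass is 0 and a
  multiple of \<open>weighted_monomial a b (a + b)\<close> is a potential. Each further step solves
  the two-term relation of \<open>has_ddbar_weighted_monomial\<close>; the masses change by the same
  ratio \<open>?c\<close>.\<close>

lemma ex_bounded_potential_axis:
  assumes "a = 0 \<or> b = 0"
  shows "\<exists>E C. has_ddbar UNIV E (\<lambda>z. weighted_monomial a b (a + b + 2 + i) z - of_real (log_mass a b (a + b + 2 + i)) * weighted_monomial 0 0 2 z)
           \<and> (\<forall>z. cmod (E z) \<le> C)"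
proof (induction i)
  case 0
  show ?case
  proof (cases "a + b = 0")
    case True
    hence "log_mass a b (a + b + 2 + 0) = log_mass 0 0 (Suc (Suc 0))" by simp
    also have "\<dots> = 1" using log_mass_0[of "Suc (Suc 0)"] by simp
    finally have "log_mass a b (a + b + 2 + 0) = 1" .
    hence "(\<lambda>z. weighted_monomial a b (a + b + 2 + 0) z - of_real (log_mass a b (a + b + 2 + 0)) * weighted_monomial 0 0 2 z) = (\<lambda>_. 0)"
      using True by (simp add: numeral_2_eq_2)
    thus ?thesis by (metis has_ddbar_const order_refl)
  next
    case False
    define n where "n = a + b"
    have n: "n > 0" using False n_def by simp
    have "log_mass a b (a + b + 2 + 0) = 0" using False assms by (auto simp: log_mass_def)
    moreover have "has_ddbar UNIV (\<lambda>z. (- inverse (of_nat n * of_nat (Suc n))) * weighted_monomial a b n z)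
       (\<lambda>z. (- inverse (of_nat n * of_nat (Suc n))) *
          (of_nat n * (of_nat n - of_nat (a + b)) * weighted_monomial a b (Suc n) z
         - of_nat n * of_nat (Suc n) * weighted_monomial a b (Suc (Suc n)) z))"
      by (rule has_ddbar_cmult[OF has_ddbar_weighted_monomial[OF assms]])
    moreover have "(\<lambda>z. (- inverse (of_nat n * of_nat (Suc n))) *
          (of_nat n * (of_nat n - of_nat (a + b)) * weighted_monomial a b (Suc n) z
         - of_nat n * of_nat (Suc n) * weighted_monomial a b (Suc (Suc n)) z)) = weighted_monomial a b (a + b + 2 + 0)"
      using n by (auto simp: fun_eq_iff n_def field_simps simp del: of_nat_Suc of_nat_add)
    moreover have "cmod ((- inverse (of_nat n * of_nat (Suc n))) * weighted_monomial a b n z)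
        \<le> cmod (- inverse (of_nat n * of_nat (Suc n))) * 1" for z
      unfolding norm_mult by (intro mult_left_mono weighted_monomial_bounded) (auto simp: n_def)
    ultimately show ?thesis by (intro exI conjI allI) auto
  qed
next
  case (Suc i)
  then obtain E C where E: "has_ddbar UNIV E (\<lambda>z. weighted_monomial a b (a + b + 2 + i) z - of_real (log_mass a b (a + b + 2 + i)) * weighted_monomial 0 0 2 z)"
    and C: "\<And>z. cmod (E z) \<le> C" by blast
  define n where "n = a + b + i + 1"
  have n: "n > 0" "a + b + 2 + i = Suc n" "a + b + 2 + Suc i = Suc (Suc n)" by (auto simp: n_def)
  let ?k = "inverse (of_nat n * of_nat (Suc n)) :: complex"
  let ?c = "of_nat (n - a - b) / of_nat (Suc n) :: complex"
  have k0: "of_nat n \<noteq> (0::complex)" "of_nat (Suc n) \<noteq> (0::complex)" using n(1) of_nat_eq_0_iff[of "Suc n"] of_nat_eq_0_iff[of n] by blast+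
  have lm: "of_real (log_mass a b (Suc (Suc n))) = ?c * of_real (log_mass a b (Suc n))"
  proof (cases "a = b")
    case True
    hence "a = 0" "b = 0" using assms by auto
    thus ?thesis using n(1) by (simp add: log_mass_0 add.commute)
  qed (simp add: log_mass_def)
  have "has_ddbar UNIV (\<lambda>z. ?c * E z + (- ?k) * weighted_monomial a b n z)
     (\<lambda>z. ?c * (weighted_monomial a b (Suc n) z - of_real (log_mass a b (Suc n)) * weighted_monomial 0 0 2 z) + (- ?k) *
        (of_nat n * (of_nat n - of_nat (a + b)) * weighted_monomial a b (Suc n) z
         - of_nat n * of_nat (Suc n) * weighted_monomial a b (Suc (Suc n)) z))"
    by (rule has_ddbar_add[OF has_ddbar_cmult[OF E[unfolded n]] has_ddbar_cmult[OF has_ddbar_weighted_monomial[OF assms]]])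
  moreover have "(\<lambda>z. ?c * (weighted_monomial a b (Suc n) z - of_real (log_mass a b (Suc n)) * weighted_monomial 0 0 2 z) + (- ?k) *
        (of_nat n * (of_nat n - of_nat (a + b)) * weighted_monomial a b (Suc n) z
         - of_nat n * of_nat (Suc n) * weighted_monomial a b (Suc (Suc n)) z)) =
      (\<lambda>z. weighted_monomial a b (Suc (Suc n)) z - of_real (log_mass a b (Suc (Suc n))) * weighted_monomial 0 0 2 z)"
  proof
    fix z
    have e: "of_nat n - of_nat (a + b) = (of_nat (n - a - b) :: complex)"
      by (simp add: n_def)
    show "?c * (weighted_monomial a b (Suc n) z - of_real (log_mass a b (Suc n)) * weighted_monomial 0 0 2 z) + (- ?k) *
        (of_nat n * (of_nat n - of_nat (a + b)) * weighted_monomial a b (Suc n) z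
         - of_nat n * of_nat (Suc n) * weighted_monomial a b (Suc (Suc n)) z) =
      weighted_monomial a b (Suc (Suc n)) z - of_real (log_mass a b (Suc (Suc n))) * weighted_monomial 0 0 2 z"
      unfolding e lm using k0 by (simp add: field_simps del: of_nat_Suc of_nat_add of_nat_diff)
  qed
  moreover have "cmod (?c * E z + (- ?k) * weighted_monomial a b n z) \<le> cmod ?c * C + cmod ?k * 1" for z
  proof -
    have "cmod (weighted_monomial a b n z) \<le> 1" by (rule weighted_monomial_bounded) (simp add: n_def)
    hence "cmod (?c * E z) + cmod ((- ?k) * weighted_monomial a b n z) \<le> cmod ?c * C + cmod ?k * 1"
      unfolding norm_mult norm_minus_cancel by (intro add_mono mult_left_mono C) auto
    thus ?thesis using norm_triangle_ineq order_trans by blast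
  qed
  ultimately show ?case unfolding n(3) by (intro exI conjI allI) auto
qed

text \<open>Removing the mass with the reference density is what makes a bounded potential possible.
  The induction lowers both exponents together until one is 0; density and mass obey the same
  recursion, so the potentials are simply subtracted.\<close>

lemma ex_bounded_potential:
  assumes "max a b + 2 \<le> n"
  shows "\<exists>E C. has_ddbar UNIV E (\<lambda>z. weighted_monomial a b n z - of_real (log_mass a b n) * weighted_monomial 0 0 2 z)
           \<and> (\<forall>z. cmod (E z) \<le> C)"
  using assms
proof (induction a arbitrary: b n)
  case 0
  hence "0 + b + 2 + (n - b - 2) = n" by simp
  thus ?case using ex_bounded_potential_axis[of 0 b "n - b - 2"] by (simp only: simp_thms)
next
  case (Suc a)
  show ?case
  proof (cases b)
    case 0
    moreover have "Suc a + 0 + 2 + (n - Suc a - 2) = n" using Suc(2) by simp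
    ultimately show ?thesis
      using ex_bounded_potential_axis[of "Suc a" 0 "n - Suc a - 2"] by (simp only: simp_thms)
  next
    case [simp]: (Suc b')
    obtain n' where [simp]: "n = Suc n'" using Suc.prems by (cases n) auto
    have le: "max a b' + 2 \<le> n'" "max a b' + 2 \<le> Suc n'" using Suc.prems by auto
    obtain E C where E: "has_ddbar UNIV E (\<lambda>z. weighted_monomial a b' n' z - of_real (log_mass a b' n') * weighted_monomial 0 0 2 z)"
      and C: "\<And>z. cmod (E z) \<le> C" using Suc.IH[OF le(1)] by blast
    obtain E' C' where E': "has_ddbar UNIV E' (\<lambda>z. weighted_monomial a b' (Suc n') z - of_real (log_mass a b' (Suc n')) * weighted_monomial 0 0 2 z)"
      and C': "\<And>z. cmod (E' z) \<le> C'" using Suc.IH[OF le(2)] by blast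
    have "has_ddbar UNIV (\<lambda>z. E z + (-1) * E' z)
      (\<lambda>z. weighted_monomial a b' n' z - of_real (log_mass a b' n') * weighted_monomial 0 0 2 z
        + (-1) * (weighted_monomial a b' (Suc n') z - of_real (log_mass a b' (Suc n')) * weighted_monomial 0 0 2 z))"
      by (rule has_ddbar_add[OF E has_ddbar_cmult[OF E']])
    moreover have "(\<lambda>z. weighted_monomial a b' n' z - of_real (log_mass a b' n') * weighted_monomial 0 0 2 z
        + (-1) * (weighted_monomial a b' (Suc n') z - of_real (log_mass a b' (Suc n')) * weighted_monomial 0 0 2 z))
      = (\<lambda>z. weighted_monomial (Suc a) b n z - of_real (log_mass (Suc a) b n) * weighted_monomial 0 0 2 z)"
      by (simp add: log_mass_Suc[OF le(1)] weighted_monomial_Suc fun_eq_iff algebra_simps)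
    moreover have "cmod (E z + (-1) * E' z) \<le> C + C'" for z
      using norm_triangle_ineq4[of "E z" "E' z"] C[of z] C'[of z] by simp
    ultimately show ?thesis by (intro exI conjI allI) auto
  qed
qed

section \<open>Coefficients of nonnegative polynomials\<close>

lemma integral_cis_int: "integral {0..2*pi} (\<lambda>t. cis (of_int n * t)) = (if n = 0 then 2 * of_real pi else 0)"
proof (cases "n = 0")
  case False
  have "((\<lambda>t. cis (of_int n * t)) has_integral
     (inverse (\<i> * of_int n) * cis (of_int n * (2 * pi)) - inverse (\<i> * of_int n) * cis (of_int n * 0))) {0..2*pi}"
  proof (rule fundamental_theorem_of_calculus)
    fix t :: real
    have "((\<lambda>t. cis (of_int n * t)) has_vector_derivative (\<i> * of_int n * cis (of_int n * t))) (at t within {0..2*pi})"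
      unfolding has_vector_derivative_complex_iff
      by (auto intro!: derivative_eq_intros)
    from has_vector_derivative_mult_right[OF this, of "inverse (\<i> * of_int n)"]
    have "((\<lambda>t. inverse (\<i> * of_int n) * cis (of_int n * t)) has_vector_derivative
        inverse (\<i> * of_int n) * (\<i> * of_int n * cis (of_int n * t))) (at t within {0..2*pi})" .
    moreover have "inverse (\<i> * of_int n) * (\<i> * of_int n * cis (of_int n * t)) = cis (of_int n * t)"
      using False by (metis complex_i_not_zero left_inverse mult.assoc mult.left_neutral mult_eq_0_iff of_int_eq_0_iff)
    ultimately show "((\<lambda>t. inverse (\<i> * of_int n) * cis (of_int n * t)) has_vector_derivative cis (of_int n * t)) (at t within {0..2*pi})"
      by (simp only:)
  qed simp
  moreover have "cis (of_int n * (2 * pi)) = 1"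
    using cis_multiple_2pi[of "of_int n"] by (simp add: mult.commute mult.left_commute)
  ultimately show ?thesis using False by (simp add: integral_unique)
qed (simp add: scaleR_conv_of_real)

text \<open>The weight \<open>r\<close> is that of the area element, and it reappears as the
  Jacobian when Beta integrals are rewritten in the radius.\<close>

definition radial_norm :: "(real \<Rightarrow> complex) \<Rightarrow> real" where
  "radial_norm g = integral {0..1} (\<lambda>r. r * cmod (g r))"

lemma radial_norm_nonneg:
  assumes "continuous_on UNIV g"
  shows "0 \<le> radial_norm g"
  unfolding radial_norm_def
  by (rule integral_nonneg)
     (auto intro!: integrable_continuous_real continuous_intros continuous_on_subset[OF assms])

lemma radial_norm_add:
  assumes "continuous_on UNIV f" "continuous_on UNIV g"
  shows "radial_norm (\<lambda>r. f r + g r) \<le> radial_norm f + radial_norm g"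
proof -
  have c: "continuous_on {0..1} f" "continuous_on {0..1} g"
    using assms continuous_on_subset by blast+
  have i: "(\<lambda>r. r * cmod (f r)) integrable_on {0..1}" "(\<lambda>r. r * cmod (g r)) integrable_on {0..1}"
     "(\<lambda>r. r * cmod (f r + g r)) integrable_on {0..1}"
    by (intro integrable_continuous_real continuous_intros c)+
  have "radial_norm (\<lambda>r. f r + g r) \<le> integral {0..1} (\<lambda>r. r * cmod (f r) + r * cmod (g r))"
    unfolding radial_norm_def
    by (rule integral_le[OF i(3) integrable_add[OF i(1,2)]])
       (metis atLeastAtMost_iff distrib_left mult_left_mono norm_triangle_ineq)
  also have "\<dots> = radial_norm f + radial_norm g"
    unfolding radial_norm_def by (rule integral_add[OF i(1,2)])
  finally show ?thesis .
qed

lemma radial_norm_cmult: "radial_norm (\<lambda>r. c * g r) = cmod c * radial_norm g"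
proof -
  have "(\<lambda>r. r * cmod (c * g r)) = (\<lambda>r. cmod c * (r * cmod (g r)))"
    by (simp add: norm_mult fun_eq_iff)
  thus ?thesis unfolding radial_norm_def by simp
qed

lemma radial_norm_dilate:
  assumes "continuous_on UNIV g"
  shows "radial_norm (\<lambda>r. g (r / 2)) \<le> 4 * radial_norm g"
proof -
  define f where "f r = r * cmod (g r)" for r
  have cf: "continuous_on S f" for S
    unfolding f_def by (intro continuous_intros continuous_on_subset[OF assms]) auto
  have "((\<lambda>r. (1/2) *\<^sub>R f (r / 2)) has_integral integral {0/2..1/2} f) {0..1::real}"
    by (rule has_integral_substitution[where c = 0 and d = 1])
       (auto intro!: cf derivative_eq_intros)
  hence "integral {0..1} (\<lambda>r. (1/2) *\<^sub>R f (r / 2)) = integral {0..1/2} f"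
    by (simp only: integral_unique) simp
  also have "\<dots> \<le> integral {0..1} f"
    by (rule integral_subset_le) (auto intro!: integrable_continuous_real cf, simp add: f_def)
  finally have "integral {0..1} (\<lambda>r. (1/2) *\<^sub>R f (r / 2)) \<le> radial_norm g"
    by (simp add: radial_norm_def f_def[abs_def])
  moreover have "(\<lambda>r. (1/2) *\<^sub>R f (r / 2)) = (\<lambda>r. (1/4) * (r * cmod (g (r / 2))))"
    by (simp add: f_def)
  ultimately have "integral {0..1} (\<lambda>r. (1/4) * (r * cmod (g (r / 2)))) \<le> radial_norm g" by (simp only:)
  thus ?thesis unfolding integral_mult_right by (simp add: radial_norm_def)
qed

lemma radial_norm_monomial: "radial_norm (\<lambda>r. of_real r ^ n) = 1 / (real n + 2)"
proof -
  have "((\<lambda>r. r ^ Suc n) has_integral (1 ^ (n + 2) / (real n + 2) - 0 ^ (n + 2) / (real n + 2))) {0..1::real}"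
  proof (rule fundamental_theorem_of_calculus)
    fix x :: real
    have "((\<lambda>r. r ^ (n + 2) / (real n + 2)) has_real_derivative x ^ Suc n) (at x within {0..1})"
    proof -
      have "real (n + 2) * x ^ (n + 2 - Suc 0) / (real n + 2) = x ^ Suc n"
        by (simp add: divide_simps)
      thus ?thesis using DERIV_cdivide[OF DERIV_pow[of "n + 2" x "{0..1}"], of "real n + 2"]
        by (simp only:)
    qed
    thus "((\<lambda>r. r ^ (n + 2) / (real n + 2)) has_vector_derivative x ^ Suc n) (at x within {0..1})"
      by (simp add: has_real_derivative_iff_has_vector_derivative)
  qed simp
  hence "integral {0..1} (\<lambda>r::real. r ^ Suc n) = 1 / (real n + 2)"
    by (simp add: integral_unique)
  moreover have "radial_norm (\<lambda>r. of_real r ^ n) = integral {0..1} (\<lambda>r::real. r ^ Suc n)"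
    unfolding radial_norm_def by (rule integral_cong) (auto simp: norm_power)
  ultimately show ?thesis by simp
qed

lemma radial_norm_sum:
  assumes "finite I" "\<And>i. i \<in> I \<Longrightarrow> continuous_on UNIV (g i)"
  shows "radial_norm (\<lambda>r. \<Sum>i\<in>I. g i r) \<le> (\<Sum>i\<in>I. radial_norm (g i))"
  using assms
proof (induction I rule: finite_induct)
  case empty
  show ?case by (simp add: radial_norm_def)
next
  case (insert i I)
  have "continuous_on UNIV (\<lambda>r. \<Sum>i\<in>I. g i r)"
    using insert by (intro continuous_intros) auto
  thus ?case using radial_norm_add[of "g i" "\<lambda>r. \<Sum>i\<in>I. g i r"] insert by fastforce
qed

text \<open>The dilation \<open>g(r / 2) - 2\<^sup>-\<^sup>e g(r)\<close> removes the monomial of exponent \<open>e\<close> and changes the norm by a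
  bounded factor, so the exponents can be eliminated one by one.\<close>

lemma coeff_le_radial_norm:
  fixes e :: "'i \<Rightarrow> nat"
  assumes "finite I" "inj_on e I"
  shows "\<exists>C\<ge>0. \<forall>x. \<forall>i\<in>I. cmod (x i) \<le> C * radial_norm (\<lambda>r. \<Sum>i\<in>I. x i * of_real r ^ e i)"
  using assms
proof (induction I rule: finite_induct)
  case empty
  show ?case by auto
next
  case (insert i0 I)
  have "inj_on e I" using insert.prems by (simp add: inj_on_insert)
  from insert.IH[OF this] obtain C where C: "C \<ge> 0" "\<And>x i. i \<in> I \<Longrightarrow>
      cmod (x i) \<le> C * radial_norm (\<lambda>r. \<Sum>i\<in>I. x i * of_real r ^ e i)"
    by blast
  define \<delta> :: "'i \<Rightarrow> complex" where "\<delta> i = (1/2) ^ e i - (1/2) ^ e i0" for i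
  have \<delta>: "\<delta> i \<noteq> 0" if "i \<in> I" for i
  proof
    assume "\<delta> i = 0"
    hence "complex_of_real ((1/2) ^ e i) = of_real ((1/2) ^ e i0)" by (simp add: \<delta>_def)
    hence "(1/2 :: real) ^ e i = (1/2) ^ e i0" by (simp only: of_real_eq_iff)
    hence "e i = e i0" by (simp add: power_inject_exp')
    thus False using insert that by (auto simp: inj_on_def)
  qed
  \<comment> \<open>The 5 is the cost \<open>4 + 1\<close> of dilating and subtracting.
    \<open>B0\<close> recovers the eliminated coefficient: the other terms are subtracted, and the
    remaining monomial has norm \<open>1 / (e i0 + 2)\<close> times the modulus of its
    coefficient.\<close>
  define B where "B = (\<Sum>i\<in>I. 5 * C / cmod (\<delta> i))"
  define B0 where "B0 = (real (e i0) + 2) * (1 + real (card I) * B)"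
  have B: "B \<ge> 0" unfolding B_def using C by (intro sum_nonneg) auto
  have main: "(\<forall>i\<in>I. cmod (x i) \<le> B * N) \<and> cmod (x i0) \<le> B0 * N"
    if N: "N = radial_norm (\<lambda>r. \<Sum>i\<in>insert i0 I. x i * of_real r ^ e i)" for x N
  proof -
    let ?g = "\<lambda>r::real. \<Sum>i\<in>insert i0 I. x i * of_real r ^ e i"
    have cg: "continuous_on UNIV ?g" by (intro continuous_intros)
    have cg2: "continuous_on UNIV (\<lambda>r. ?g (r / 2))" by (intro continuous_intros) auto
    have N0: "N \<ge> 0" unfolding N by (rule radial_norm_nonneg[OF cg])
    have eq: "(\<Sum>i\<in>I. (x i * \<delta> i) * of_real r ^ e i) = ?g (r / 2) + (- ((1/2) ^ e i0)) * ?g r" for r :: real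
    proof -
      have "?g (r / 2) + (- ((1/2) ^ e i0)) * ?g r
         = (\<Sum>i\<in>insert i0 I. x i * of_real (r / 2) ^ e i - (1/2) ^ e i0 * (x i * of_real r ^ e i))"
        unfolding sum_subtractf sum_distrib_left by (simp add: sum_negf)
      also have "\<dots> = (\<Sum>i\<in>insert i0 I. (x i * \<delta> i) * of_real r ^ e i)"
        by (intro sum.cong refl) (simp add: \<delta>_def power_divide field_simps)
      also have "\<dots> = (\<Sum>i\<in>I. (x i * \<delta> i) * of_real r ^ e i)"
        using insert by (simp add: \<delta>_def)
      finally show ?thesis by simp
    qed
    have "radial_norm (\<lambda>r. \<Sum>i\<in>I. (x i * \<delta> i) * of_real r ^ e i)
       \<le> radial_norm (\<lambda>r. ?g (r / 2)) + radial_norm (\<lambda>r. (- ((1/2) ^ e i0)) * ?g r)"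
      unfolding eq by (rule radial_norm_add[OF cg2]) (intro continuous_intros)
    also have "\<dots> \<le> 4 * N + cmod (- ((1/2) ^ e i0)) * N"
      unfolding radial_norm_cmult N using radial_norm_dilate[OF cg] by simp
    also have "\<dots> \<le> 4 * N + 1 * N"
      using N0 by (intro add_mono mult_right_mono) (auto simp: norm_power norm_divide power_le_one)
    finally have g5: "radial_norm (\<lambda>r. \<Sum>i\<in>I. (x i * \<delta> i) * of_real r ^ e i) \<le> 5 * N" by simp
    have 1: "cmod (x i) \<le> B * N" if i: "i \<in> I" for i
    proof -
      have "cmod (x i) * cmod (\<delta> i) \<le> C * (5 * N)"
        using C(2)[OF i, of "\<lambda>i. x i * \<delta> i"] mult_left_mono[OF g5 C(1)] by (simp add: norm_mult)
      hence "cmod (x i) \<le> 5 * C / cmod (\<delta> i) * N"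
        using \<delta>[OF i] by (simp add: field_simps)
      also have "\<dots> \<le> B * N"
        unfolding B_def using C N0 insert i
        by (intro mult_right_mono member_le_sum) auto
      finally show ?thesis .
    qed
    have x0: "(\<lambda>r. x i0 * of_real r ^ e i0) = (\<lambda>r::real. ?g r + (-1) * (\<Sum>i\<in>I. x i * of_real r ^ e i))"
      using insert by (simp add: fun_eq_iff)
    have "cmod (x i0) / (real (e i0) + 2) = radial_norm (\<lambda>r. x i0 * of_real r ^ e i0)"
      unfolding radial_norm_cmult radial_norm_monomial by simp
    also have "\<dots> \<le> N + radial_norm (\<lambda>r. (-1) * (\<Sum>i\<in>I. x i * of_real r ^ e i))"
      unfolding x0 N by (intro radial_norm_add continuous_intros)
    also have "\<dots> = N + radial_norm (\<lambda>r. \<Sum>i\<in>I. x i * of_real r ^ e i)"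
      unfolding radial_norm_cmult by simp
    also have "\<dots> \<le> N + (\<Sum>i\<in>I. radial_norm (\<lambda>r. x i * of_real r ^ e i))"
      using insert by (intro add_mono radial_norm_sum continuous_intros) auto
    also have "\<dots> \<le> N + (\<Sum>i\<in>I. B * N)"
    proof (intro add_mono sum_mono order_refl)
      fix i assume i: "i \<in> I"
      have "radial_norm (\<lambda>r. x i * of_real r ^ e i) = cmod (x i) * (1 / (real (e i) + 2))"
        unfolding radial_norm_cmult radial_norm_monomial by simp
      also have "\<dots> \<le> cmod (x i) * 1" by (intro mult_left_mono) auto
      finally show "radial_norm (\<lambda>r. x i * of_real r ^ e i) \<le> B * N" using 1[OF i] by simp
    qed
    also have "\<dots> = (1 + real (card I) * B) * N" by (simp add: algebra_simps)
    finally have "cmod (x i0) \<le> B0 * N" unfolding B0_def by (simp add: field_simps)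
    thus ?thesis using 1 by blast
  qed
  have "cmod (x i) \<le> max B B0 * radial_norm (\<lambda>r. \<Sum>i\<in>insert i0 I. x i * of_real r ^ e i)"
    if "i \<in> insert i0 I" for x i
  proof -
    have "radial_norm (\<lambda>r. \<Sum>i\<in>insert i0 I. x i * of_real r ^ e i) \<ge> 0" (is "?N \<ge> 0")
      by (rule radial_norm_nonneg) (intro continuous_intros)
    hence "B * ?N \<le> max B B0 * ?N" "B0 * ?N \<le> max B B0 * ?N"
      by (auto intro!: mult_right_mono)
    thus ?thesis using main[OF refl, of x] that by fastforce
  qed
  thus ?case using B by (intro exI[of _ "max B B0"]) auto
qed

section \<open>Polynomials in \<open>w\<close> and \<open>cnj w\<close>, each exponent below
  \<open>d\<close>: Fourier analysis on circles\<close>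

definition bipoly :: "nat \<Rightarrow> (nat \<Rightarrow> nat \<Rightarrow> complex) \<Rightarrow> complex \<Rightarrow> complex" where
  "bipoly d q w = (\<Sum>(j, k)\<in>{..<d} \<times> {..<d}. q j k * w ^ j * cnj w ^ k)"

lemma continuous_on_bipoly [continuous_intros]:
  "continuous_on S f \<Longrightarrow> continuous_on S (\<lambda>x. bipoly d q (f x))"
  unfolding bipoly_def case_prod_unfold by (intro continuous_intros)

text \<open>A frequency selects one diagonal \<open>j - k = p\<close>. On a diagonal the radial
  exponent \<open>j + k\<close> determines the pair, which is the injectivity required by
  \<open>coeff_le_radial_norm\<close>.\<close>

lemma bipoly_fourier:
  "integral {0..2*pi} (\<lambda>t. bipoly d q (of_real r * cis t) * cis (- of_int p * t)) =
     2 * of_real pi * (\<Sum>(j, k)\<in>{(j, k)\<in>{..<d} \<times> {..<d}. int j - int k = p}. q j k * of_real r ^ (j + k))"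
proof -
  let ?I = "{..<d} \<times> {..<d}"
  have m: "(of_real r * cis t) ^ j * cnj (of_real r * cis t) ^ k * cis (- of_int p * t)
      = of_real r ^ (j + k) * cis (of_int (int j - int k - p) * t)" for t j k
  proof -
    have "(of_real r * cis t) ^ j * cnj (of_real r * cis t) ^ k * cis (- of_int p * t)
      = of_real r ^ (j + k) * (cis (real j * t) * cis (real k * (- t)) * cis (- of_int p * t))"
      using Complex.DeMoivre[of t j] Complex.DeMoivre[of "-t" k]
      by (simp add: power_mult_distrib cis_cnj power_add del: mult_minus_right mult_minus_left)
    thus ?thesis by (simp add: cis_mult algebra_simps)
  qed
  have "(\<lambda>t. bipoly d q (of_real r * cis t) * cis (- of_int p * t)) =
     (\<lambda>t. \<Sum>x\<in>?I. q (fst x) (snd x) * of_real r ^ (fst x + snd x) * cis (of_int (int (fst x) - int (snd x) - p) * t))"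
    unfolding bipoly_def case_prod_unfold sum_distrib_right
    by (intro ext sum.cong refl) (simp only: mult.assoc m[simplified mult.assoc])
  hence "integral {0..2*pi} (\<lambda>t. bipoly d q (of_real r * cis t) * cis (- of_int p * t)) =
     (\<Sum>x\<in>?I. integral {0..2*pi} (\<lambda>t. q (fst x) (snd x) * of_real r ^ (fst x + snd x)
         * cis (of_int (int (fst x) - int (snd x) - p) * t)))"
    by (simp only:) (intro integral_sum integrable_continuous_real continuous_intros; simp)
  also have "\<dots> = (\<Sum>x\<in>?I. if int (fst x) - int (snd x) = p
       then 2 * of_real pi * (q (fst x) (snd x) * of_real r ^ (fst x + snd x)) else 0)"
    unfolding integral_mult_right integral_cis_int by (intro sum.cong) auto
  also have "\<dots> = (\<Sum>x\<in>{x\<in>?I. int (fst x) - int (snd x) = p}.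
       2 * of_real pi * (q (fst x) (snd x) * of_real r ^ (fst x + snd x)))"
    by (rule sum.inter_filter[symmetric]) simp
  also have "{x\<in>?I. int (fst x) - int (snd x) = p} = {(j, k)\<in>?I. int j - int k = p}" by auto
  finally show ?thesis
    unfolding sum_distrib_left by (simp only: case_prod_unfold)
qed

lemma bipoly_circle_mean:
  "integral {0..2*pi} (\<lambda>t. bipoly n q (of_real r * cis t)) = 2 * of_real pi * (\<Sum>k<n. q k k * of_real r ^ (2 * k))"
proof -
  have D0: "{(j, k)\<in>{..<n} \<times> {..<n}. int j - int k = 0} = (\<lambda>k. (k, k)) ` {..<n}" by auto
  have "(\<Sum>(j, k)\<in>{(j, k)\<in>{..<n} \<times> {..<n}. int j - int k = 0}. q j k * of_real r ^ (j + k))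
      = (\<Sum>k<n. q k k * of_real r ^ (k + k))"
    unfolding D0 by (simp add: sum.reindex inj_on_def)
  hence "integral {0..2*pi} (\<lambda>t. bipoly n q (of_real r * cis t) * cis (- of_int 0 * t))
      = 2 * of_real pi * (\<Sum>k<n. q k k * of_real r ^ (k + k))"
    by (simp only: bipoly_fourier)
  moreover have "k + k = 2 * k" for k :: nat by simp
  ultimately show ?thesis by simp
qed

text \<open>A Fourier coefficient of a nonnegative function is bounded by its mean, and the mean
  involves the main diagonal only.\<close>

lemma diagonal_le_of_nonneg:
  assumes pos: "\<And>w. \<exists>y\<ge>0. bipoly d q w = of_real y"
  shows "cmod (\<Sum>(j, k)\<in>{(j, k)\<in>{..<d} \<times> {..<d}. int j - int k = p}. q j k * of_real r ^ (j + k))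
     \<le> (\<Sum>k<d. Re (q k k) * r ^ (2 * k))" (is "cmod ?S \<le> ?R")
proof -
  have re: "complex_of_real (cmod (bipoly d q w)) = bipoly d q w" for w
    using pos[of w] by auto
  have ib: "(\<lambda>t. bipoly d q (of_real r * cis t)) integrable_on {0..2*pi}"
    by (intro integrable_continuous_real continuous_intros)
  have im: "(\<lambda>t. cmod (bipoly d q (of_real r * cis t))) integrable_on {0..2*pi}"
    by (intro integrable_continuous_real continuous_intros)
  have "2 * pi * cmod ?S = cmod (integral {0..2*pi} (\<lambda>t. bipoly d q (of_real r * cis t) * cis (- of_int p * t)))"
    unfolding bipoly_fourier by (simp add: norm_mult)
  also have "\<dots> \<le> integral {0..2*pi} (\<lambda>t. cmod (bipoly d q (of_real r * cis t)))"
    by (rule integral_norm_bound_integral[OF _ im])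
       (auto intro!: integrable_continuous_real continuous_intros simp: norm_mult)
  finally have le: "2 * pi * cmod ?S \<le> integral {0..2*pi} (\<lambda>t. cmod (bipoly d q (of_real r * cis t)))" .
  have "complex_of_real (integral {0..2*pi} (\<lambda>t. cmod (bipoly d q (of_real r * cis t))))
      = integral {0..2*pi} (\<lambda>t. bipoly d q (of_real r * cis t))"
    using integral_linear[OF im bounded_linear_of_real[where 'a = complex], symmetric] by (simp only: o_def re)
  also have "\<dots> = 2 * of_real pi * (\<Sum>k<d. q k k * of_real r ^ (2 * k))"
    by (rule bipoly_circle_mean)
  finally have "integral {0..2*pi} (\<lambda>t. cmod (bipoly d q (of_real r * cis t)))
     = Re (2 * of_real pi * (\<Sum>k<d. q k k * of_real r ^ (2 * k)))"
    by (metis Re_complex_of_real)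
  also have "\<dots> = 2 * pi * ?R"
    by (simp flip: of_real_power)
  finally show ?thesis using le by simp
qed

text \<open>The substitution \<open>y = r\<^sup>2 / (1 + r\<^sup>2)\<close> turns the Beta integrals into radial ones.\<close>

lemma sum_log_mass_lower:
  fixes c :: "nat \<Rightarrow> real"
  assumes pos: "\<And>r. r \<ge> 0 \<Longrightarrow> 0 \<le> (\<Sum>k<d. c k * r ^ (2 * k))"
  shows "(1/2) ^ (d + 1) * integral {0..1} (\<lambda>r. r * (\<Sum>k<d. c k * r ^ (2 * k)))
     \<le> (\<Sum>k<d. c k * log_mass k k (d + 2))"
proof -
  \<comment> \<open>In terms of the radius, \<open>F\<close> is the radial polynomial divided by
    \<open>(1 + r^2)^d\<close>.\<close>
  define F where "F y = (\<Sum>k<d. c k * (y ^ k * (1 - y) ^ (d - k)))" for y :: real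
  have cF: "continuous_on S F" for S unfolding F_def by (intro continuous_intros)
  let ?q = "\<lambda>r. \<Sum>k<d. c k * r ^ (2 * k)"
  let ?y = "\<lambda>r::real. r\<^sup>2 / (1 + r\<^sup>2)"
  have F_eq: "F (?y r) = ?q r / (1 + r\<^sup>2) ^ d" for r
  proof -
    have p: "1 + r\<^sup>2 > 0" by (smt (verit) zero_le_power2)
    hence e: "1 - ?y r = 1 / (1 + r\<^sup>2)" by (simp add: field_simps)
    have "?y r ^ k * (1 - ?y r) ^ (d - k) = r ^ (2 * k) / (1 + r\<^sup>2) ^ d" if "k < d" for k
    proof -
      have "?y r ^ k * (1 - ?y r) ^ (d - k) = r ^ (2 * k) / ((1 + r\<^sup>2) ^ k * (1 + r\<^sup>2) ^ (d - k))"
        unfolding e by (simp add: power_divide power_mult)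
      thus ?thesis using that by (simp flip: power_add)
    qed
    thus ?thesis unfolding F_def by (simp add: sum_divide_distrib)
  qed
  have F_pos: "F y \<ge> 0" if "0 \<le> y" "y \<le> 1" for y
  proof (cases "y = 1")
    \<comment> \<open>The value \<open>y = 1\<close> corresponds to no finite radius; there every
      exponent \<open>d - k\<close> is positive, so \<open>F\<close> vanishes.\<close>
    case True
    have z: "y ^ k * (1 - y) ^ (d - k) = 0" if "k < d" for k using True that by simp
    have "F y = 0" unfolding F_def by (intro sum.neutral ballI) (simp only: z lessThan_iff mult_zero_right)
    thus ?thesis by simp
  next
    case False
    define r where "r = sqrt (y / (1 - y))"
    have r: "r \<ge> 0" "r\<^sup>2 = y / (1 - y)" using that False by (auto simp: r_def)
    have "?y r = y" unfolding r using that False by (simp add: field_simps)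
    moreover have "F (?y r) \<ge> 0" unfolding F_eq using pos[OF r(1)] by simp
    ultimately show ?thesis by simp
  qed
  have 1: "(\<Sum>k<d. c k * log_mass k k (d + 2)) = integral {0..1} F"
    unfolding F_def log_mass_def
    by (subst integral_sum) (auto intro!: integrable_continuous_real continuous_intros)
  \<comment> \<open>The range of \<open>y\<close> up to 1/2 corresponds to radii up to 1. There
    \<open>1 + r^2\<close> is at most 2, and the total power \<open>d + 2\<close>, from
    \<open>F\<close> and the Jacobian, together with the factor 2 of the Jacobian gives
    \<open>(1/2)^(d + 1)\<close>.\<close>
  have 2: "integral {0..1/2} F \<le> integral {0..1} F"
    by (rule integral_subset_le) (auto intro!: integrable_continuous_real cF F_pos)
  have 3: "integral {0..1/2} F = integral {0..1} (\<lambda>r. (2 * r / (1 + r\<^sup>2)\<^sup>2) *\<^sub>R F (?y r))"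
  proof -
    have p: "1 + r\<^sup>2 > 0" "1 + r\<^sup>2 \<noteq> 0" for r :: real by (smt (verit) zero_le_power2)+
    have "((\<lambda>r. (2 * r / (1 + r\<^sup>2)\<^sup>2) *\<^sub>R F (?y r)) has_integral integral {?y 0..?y 1} F) {0..1::real}"
    proof (rule has_integral_substitution[where c = 0 and d = 1])
      fix x :: real
      have "(?y has_real_derivative ((2 * x) * (1 + x\<^sup>2) - x\<^sup>2 * (2 * x)) / ((1 + x\<^sup>2) * (1 + x\<^sup>2))) (at x within {0..1})"
        by (rule DERIV_divide) (use p[of x] in \<open>auto intro!: derivative_eq_intros\<close>)
      also have "((2 * x) * (1 + x\<^sup>2) - x\<^sup>2 * (2 * x)) / ((1 + x\<^sup>2) * (1 + x\<^sup>2)) = 2 * x / (1 + x\<^sup>2)\<^sup>2"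
        by (simp add: distrib_left power2_eq_square)
      finally show "(?y has_real_derivative 2 * x / (1 + x\<^sup>2)\<^sup>2) (at x within {0..1})" .
    next
      show "?y ` {0..1} \<subseteq> {0..1}"
      proof
        fix y assume "y \<in> ?y ` {0..1}"
        then obtain r where "y = ?y r" by blast
        thus "y \<in> {0..1}" using p(1)[of r] by (simp add: divide_le_eq)
      qed
    qed (simp_all add: cF)
    from integral_unique[OF this] show ?thesis by simp
  qed
  have 4: "integral {0..1} (\<lambda>r. (1/2) ^ (d + 1) * (r * ?q r))
      \<le> integral {0..1} (\<lambda>r. (2 * r / (1 + r\<^sup>2)\<^sup>2) *\<^sub>R F (?y r))"
  proof (rule integral_le)
    show "(\<lambda>r. (1/2) ^ (d + 1) * (r * ?q r)) integrable_on {0..1}"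
      by (intro integrable_continuous_real continuous_intros)
    have p: "1 + r\<^sup>2 \<noteq> 0" for r :: real by (smt (verit) zero_le_power2)
    show "(\<lambda>r. (2 * r / (1 + r\<^sup>2)\<^sup>2) *\<^sub>R F (?y r)) integrable_on {0..1}"
      by (intro integrable_continuous_real continuous_intros continuous_on_compose2[OF cF[of UNIV]]) (auto simp: p)
    fix r :: real assume r: "r \<in> {0..1}"
    let ?t = "1 + r\<^sup>2"
    have t: "?t \<ge> 1" "?t \<le> 2" using r by (auto simp: power_le_one)
    have "?t ^ (d + 2) \<le> 2 ^ (d + 2)" using t by (intro power_mono) auto
    moreover have "?t ^ (d + 2) > 0" using t(1) by (intro zero_less_power) linarith
    ultimately have "1 / 2 ^ (d + 2) \<le> 1 / ?t ^ (d + 2)" by (intro divide_left_mono) simp_all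
    hence "(2 * r * ?q r) * (1 / 2 ^ (d + 2)) \<le> (2 * r * ?q r) * (1 / ?t ^ (d + 2))"
      using r pos[of r] by (intro mult_left_mono) auto
    moreover have "(2 * r / ?t\<^sup>2) *\<^sub>R F (?y r) = (2 * r * ?q r) * (1 / ?t ^ (d + 2))"
      unfolding F_eq by (simp add: power_add mult.commute power2_eq_square)
    moreover have "(2 * r * ?q r) * (1 / 2 ^ (d + 2)) = (1/2) ^ (d + 1) * (r * ?q r)"
      by (simp add: power_divide)
    ultimately show "(1/2) ^ (d + 1) * (r * ?q r) \<le> (2 * r / ?t\<^sup>2) *\<^sub>R F (?y r)" by (simp only:)
  qed
  show ?thesis using 1 2 3 4 unfolding integral_mult_right by linarith
qed

text \<open>A coefficient is bounded by the radial norm of its diagonal, this by the integral of the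
  main diagonal, and this by the total mass of the weighted polynomial. The constant precedes
  \<open>q\<close>; it yields the uniform lower bound for the logarithmic growth.\<close>

lemma coeff_le_log_mass:
  "\<exists>C>0. \<forall>q. (\<forall>w. \<exists>y\<ge>0. bipoly d q w = of_real y) \<longrightarrow>
     (\<forall>j<d. \<forall>k<d. cmod (q j k) \<le> C * (\<Sum>k<d. Re (q k k) * log_mass k k (d + 2)))"
proof -
  let ?D = "\<lambda>p. {(j, k)\<in>{..<d} \<times> {..<d}. int j - int k = p}"
  let ?Q = "\<lambda>p C. C \<ge> 0 \<and> (\<forall>x. \<forall>i\<in>?D p. cmod (x i) \<le> C * radial_norm (\<lambda>r. \<Sum>i\<in>?D p. x i * of_real r ^ (fst i + snd i)))"
  have "\<exists>C. ?Q p C" for p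
  proof (rule coeff_le_radial_norm)
    show "finite (?D p)" by (rule finite_subset[of _ "{..<d} \<times> {..<d}"]) auto
    show "inj_on (\<lambda>i. fst i + snd i) (?D p)" by (auto simp: inj_on_def)
  qed
  hence "\<exists>C. \<forall>p. ?Q p (C p)" by (intro choice[of ?Q] allI)
  then obtain C where C': "\<And>p. ?Q p (C p)" by blast
  hence C: "\<And>p. C p \<ge> 0" "\<And>p x i. i \<in> ?D p \<Longrightarrow>
      cmod (x i) \<le> C p * radial_norm (\<lambda>r. \<Sum>i\<in>?D p. x i * of_real r ^ (fst i + snd i))"
    by blast+
  \<comment> \<open>The sum dominates the constant of every diagonal that occurs; the summand 1
    makes it positive also for \<open>d = 0\<close>.\<close>
  define C0 where "C0 = (\<Sum>(j, k)\<in>{..<d} \<times> {..<d}. C (int j - int k)) + 1"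
  have C0: "C0 > 0" unfolding C0_def by (intro add_nonneg_pos sum_nonneg) (auto simp: C)
  have le: "cmod (q j k) \<le> C0 * 2 ^ (d + 1) * (\<Sum>k<d. Re (q k k) * log_mass k k (d + 2))"
    if pos: "\<forall>w. \<exists>y\<ge>0. bipoly d q w = of_real y" and jk: "j < d" "k < d" for q j k
  proof -
    define p where "p = int j - int k"
    let ?q = "\<lambda>r. \<Sum>k<d. Re (q k k) * r ^ (2 * k)"
    have dl: "cmod (\<Sum>i\<in>?D p. q (fst i) (snd i) * of_real r ^ (fst i + snd i)) \<le> ?q r" for r
      using diagonal_le_of_nonneg[of d q r p] pos by (simp add: case_prod_unfold)
    have q0: "0 \<le> ?q r" for r using dl[of r] norm_ge_zero order_trans by blast
    have "cmod (q j k) \<le> C p * radial_norm (\<lambda>r. \<Sum>i\<in>?D p. q (fst i) (snd i) * of_real r ^ (fst i + snd i))"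
      using C(2)[of "(j, k)" p "\<lambda>i. q (fst i) (snd i)"] jk by (simp add: p_def)
    also have "\<dots> \<le> C p * integral {0..1} (\<lambda>r. r * ?q r)"
      unfolding radial_norm_def
      by (intro mult_left_mono integral_le C integrable_continuous_real continuous_intros)
         (use dl in \<open>auto intro!: mult_left_mono\<close>)
    also have "\<dots> \<le> C0 * integral {0..1} (\<lambda>r. r * ?q r)"
    proof (rule mult_right_mono)
      have "C p \<le> (\<Sum>(j, k)\<in>{..<d} \<times> {..<d}. C (int j - int k))"
        using member_le_sum[of "(j, k)" "{..<d} \<times> {..<d}" "\<lambda>x. C (int (fst x) - int (snd x))"] jk C(1)
        by (simp add: p_def case_prod_unfold)
      thus "C p \<le> C0" by (simp add: C0_def)
      show "0 \<le> integral {0..1} (\<lambda>r. r * ?q r)"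
        by (rule integral_nonneg) (auto intro!: integrable_continuous_real continuous_intros q0 mult_nonneg_nonneg)
    qed
    also have "\<dots> = C0 * 2 ^ (d + 1) * ((1/2) ^ (d + 1) * integral {0..1} (\<lambda>r. r * ?q r))"
      by (simp add: power_divide)
    also have "\<dots> \<le> C0 * 2 ^ (d + 1) * (\<Sum>k<d. Re (q k k) * log_mass k k (d + 2))"
      using C0 q0 by (intro mult_left_mono sum_log_mass_lower) auto
    finally show ?thesis .
  qed
  show ?thesis
  proof (intro exI[of _ "C0 * 2 ^ (d + 1)"] conjI allI impI)
    show "C0 * 2 ^ (d + 1) > 0" using C0 by simp
  qed (rule le; assumption)
qed

section \<open>Discs in the normalized domain\<close>

text \<open>Shifting both exponents by one builds in the absence of harmonic terms; every monomial
  has the factor \<open>|w|^2\<close>.\<close>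

definition mixed_poly :: "nat \<Rightarrow> (nat \<Rightarrow> nat \<Rightarrow> complex) \<Rightarrow> complex \<Rightarrow> complex" where
  "mixed_poly d p w = (\<Sum>(j, k)\<in>{..<d} \<times> {..<d}. p j k * w ^ Suc j * cnj w ^ Suc k)"

definition mixed_ddbar :: "nat \<Rightarrow> (nat \<Rightarrow> nat \<Rightarrow> complex) \<Rightarrow> complex \<Rightarrow> complex" where
  "mixed_ddbar d p = bipoly d (\<lambda>j k. of_nat (Suc j) * of_nat (Suc k) * p j k)"

lemma mixed_poly_0 [simp]: "mixed_poly d p 0 = 0"
  by (simp add: mixed_poly_def case_prod_unfold)

lemma continuous_on_mixed_poly [continuous_intros]:
  "continuous_on S f \<Longrightarrow> continuous_on S (\<lambda>x. mixed_poly d p (f x))"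
  unfolding mixed_poly_def case_prod_unfold by (intro continuous_intros)

lemma norm_mixed_poly_le:
  assumes "\<And>j k. j < d \<Longrightarrow> k < d \<Longrightarrow> cmod (p j k) \<le> 1" "cmod w \<le> 1"
  shows "cmod (mixed_poly d p w) \<le> real (d * d) * (cmod w)\<^sup>2"
proof -
  have "cmod (mixed_poly d p w) \<le> (\<Sum>x\<in>{..<d} \<times> {..<d}. (cmod w)\<^sup>2)"
    unfolding mixed_poly_def case_prod_unfold
  proof (rule sum_norm_le)
    fix x assume x: "x \<in> {..<d} \<times> {..<d}"
    have "cmod (p (fst x) (snd x) * w ^ Suc (fst x) * cnj w ^ Suc (snd x))
      = cmod (p (fst x) (snd x)) * (cmod w ^ (fst x + snd x) * (cmod w)\<^sup>2)"
      by (simp add: norm_mult norm_power power_add power2_eq_square)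
    also have "\<dots> \<le> 1 * (1 * (cmod w)\<^sup>2)"
      using assms x by (intro mult_mono power_le_one) auto
    finally show "cmod (p (fst x) (snd x) * w ^ Suc (fst x) * cnj w ^ Suc (snd x)) \<le> (cmod w)\<^sup>2" by simp
  qed
  thus ?thesis by simp
qed

lemma has_ddbar_monomial:
  "has_ddbar S (\<lambda>w. w ^ Suc j * cnj w ^ Suc k) (\<lambda>w. of_nat (Suc j) * of_nat (Suc k) * (w ^ j * cnj w ^ k))"
proof (rule has_ddbarI)
  show "has_wirtinger S (\<lambda>w. w ^ Suc j * cnj w ^ Suc k)
     (\<lambda>w. of_nat (Suc j) * (w ^ j * cnj w ^ Suc k)) (\<lambda>w. w ^ Suc j * (of_nat (Suc k) * cnj w ^ k))"
    by (rule has_wirtinger_cong[OF has_wirtinger_mult[OF has_wirtinger_power[of _ "Suc j"] has_wirtinger_cnj_power[of _ "Suc k"]]]) simp_all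
  show "has_wirtinger S (\<lambda>w. of_nat (Suc j) * (w ^ j * cnj w ^ Suc k))
     (\<lambda>w. of_nat (Suc j) * (of_nat j * w ^ (j - 1) * cnj w ^ Suc k))
     (\<lambda>w. of_nat (Suc j) * of_nat (Suc k) * (w ^ j * cnj w ^ k))"
    by (rule has_wirtinger_cong[OF has_wirtinger_cmult[where c = "of_nat (Suc j)", OF has_wirtinger_mult[OF has_wirtinger_power[of _ j]
            has_wirtinger_cnj_power[of _ "Suc k"]]]]) (simp_all add: algebra_simps)
qed (intro continuous_intros)+

lemma has_ddbar_mixed_poly: "has_ddbar S (mixed_poly d p) (mixed_ddbar d p)"
proof -
  have "has_ddbar S (\<lambda>w. \<Sum>x\<in>{..<d} \<times> {..<d}. p (fst x) (snd x) * (w ^ Suc (fst x) * cnj w ^ Suc (snd x)))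
     (\<lambda>w. \<Sum>x\<in>{..<d} \<times> {..<d}. p (fst x) (snd x) *
        (of_nat (Suc (fst x)) * of_nat (Suc (snd x)) * (w ^ fst x * cnj w ^ snd x)))"
    by (intro has_ddbar_sum has_ddbar_cmult has_ddbar_monomial) simp
  thus ?thesis
    unfolding mixed_poly_def mixed_ddbar_def bipoly_def case_prod_unfold
    by (simp only: mult.assoc mult.left_commute)
qed

text \<open>This is the factor left when the weighted Laplacian is subtracted from the full one; its
  sign makes the difference with the potential subharmonic.\<close>

lemma one_minus_inverse_power_nonneg: "0 \<le> 1 - Re (inverse (1 + w * cnj w) ^ n)"
proof -
  have "inverse (1 + w * cnj w) ^ n = of_real (inverse (1 + (cmod w)\<^sup>2) ^ n)"
    unfolding one_plus_norm_sq by simp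
  moreover have "inverse (1 + (cmod w)\<^sup>2) ^ n \<le> 1"
    by (intro power_le_one) (auto simp: inverse_le_1_iff)
  ultimately show ?thesis by (simp del: of_real_power)
qed

text \<open>\<open>B\<close> is chosen before \<open>p\<close> and \<open>F\<close>. With potential
  \<open>Ev + \<kappa> L\<close>, the polynomial and \<open>L\<close> vanish at
  \<open>F 0 = 0\<close> and \<open>Ev\<close> is bounded, so the sub-mean value inequality bounds
  \<kappa> times the mean of \<open>L\<close> by the mean of the polynomial plus a constant.\<close>

lemma circle_mean_log_bound:
  assumes \<eta>: "\<eta> > 0"
  shows "\<exists>B. \<forall>p F. (\<forall>j<d. \<forall>k<d. cmod (p j k) \<le> 1) \<longrightarrow> (\<exists>j<d. \<exists>k<d. \<eta> \<le> cmod (p j k)) \<longrightarrow>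
     (\<forall>w. \<exists>y\<ge>0. mixed_ddbar d p w = of_real y) \<longrightarrow> F holomorphic_on ball 0 1 \<longrightarrow> F 0 = 0 \<longrightarrow>
     Re (integral {0..2*pi} (\<lambda>t. mixed_poly d p (F (of_real (1/2) * cis t)))) \<le> 2 * pi \<longrightarrow>
     integral {0..2*pi} (\<lambda>t. ln (1 + (cmod (F (of_real (1/2) * cis t)))\<^sup>2)) \<le> B"
proof -
  let ?N = "d + 2" and ?I = "{..<d} \<times> {..<d}"
  let ?P = "\<lambda>x EC. has_ddbar UNIV (fst EC) (\<lambda>z. weighted_monomial (fst x) (snd x) ?N z - of_real (log_mass (fst x) (snd x) ?N) * weighted_monomial 0 0 2 z)
       \<and> (\<forall>z. cmod (fst EC z) \<le> snd EC)"
  have "\<forall>x\<in>?I. \<exists>EC. ?P x EC"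
  proof
    fix x assume "x \<in> ?I"
    hence "max (fst x) (snd x) + 2 \<le> ?N" by auto
    from ex_bounded_potential[OF this] show "\<exists>EC. ?P x EC" by auto
  qed
  hence "\<exists>EC. \<forall>x\<in>?I. ?P x (EC x)" by (rule bchoice)
  then obtain EC where EC: "\<And>x. x \<in> ?I \<Longrightarrow> ?P x (EC x)" by blast
  define E where "E x = fst (EC x)" for x
  define C where "C x = snd (EC x)" for x
  have E: "has_ddbar UNIV (E x) (\<lambda>z. weighted_monomial (fst x) (snd x) ?N z - of_real (log_mass (fst x) (snd x) ?N) * weighted_monomial 0 0 2 z)"
    and C: "cmod (E x z) \<le> C x" if "x \<in> ?I" for x z
    using EC[OF that] by (auto simp: E_def C_def)
  obtain A where A: "A > 0" "\<And>q j k. (\<forall>w. \<exists>y\<ge>0. bipoly d q w = of_real y) \<Longrightarrow> j < d \<Longrightarrow> k < d \<Longrightarrow>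
      cmod (q j k) \<le> A * (\<Sum>k<d. Re (q k k) * log_mass k k ?N)"
    using coeff_le_log_mass[of d] by blast
  \<comment> \<open>The Laplacian coefficients \<open>(j + 1) (k + 1) p j k\<close> are bounded
    through \<open>|p j k| <= 1\<close>; hence \<open>K\<close> bounds the error potential
    uniformly. It enters \<open>B\<close> twice, once for the centre and once for the
    circle.\<close>
  define K where "K = (\<Sum>x\<in>?I. real (Suc (fst x)) * real (Suc (snd x)) * C x)"
  define B where "B = A / \<eta> * (2 * pi * (1 + 2 * K))"
  have main: "integral {0..2*pi} (\<lambda>t. ln (1 + (cmod (F (of_real (1/2) * cis t)))\<^sup>2)) \<le> B"
    if p1: "\<And>j k. j < d \<Longrightarrow> k < d \<Longrightarrow> cmod (p j k) \<le> 1"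
      and p\<eta>: "j0 < d" "k0 < d" "\<eta> \<le> cmod (p j0 k0)"
      and pos: "\<forall>w. \<exists>y\<ge>0. mixed_ddbar d p w = of_real y"
      and F: "F holomorphic_on ball 0 1" "F 0 = 0"
      and le: "Re (integral {0..2*pi} (\<lambda>t. mixed_poly d p (F (of_real (1/2) * cis t)))) \<le> 2 * pi"
    for p F j0 k0
  proof -
    define q where "q j k = of_nat (Suc j) * of_nat (Suc k) * p j k" for j k
    define L where "L w = complex_of_real (ln (1 + (cmod w)\<^sup>2))" for w
    define Ev where "Ev w = (\<Sum>x\<in>?I. q (fst x) (snd x) * E x w)" for w
    define \<kappa> where "\<kappa> = (\<Sum>x\<in>?I. q (fst x) (snd x) * of_real (log_mass (fst x) (snd x) ?N))"
    have q: "bipoly d q = mixed_ddbar d p" unfolding mixed_ddbar_def q_def[abs_def] by simp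
    have dL: "has_ddbar UNIV L (weighted_monomial 0 0 2)" unfolding L_def[abs_def] by (rule has_ddbar_ln)
    have dE: "has_ddbar UNIV Ev (\<lambda>z. \<Sum>x\<in>?I. q (fst x) (snd x) *
        (weighted_monomial (fst x) (snd x) ?N z - of_real (log_mass (fst x) (snd x) ?N) * weighted_monomial 0 0 2 z))"
      unfolding Ev_def[abs_def] by (intro has_ddbar_sum has_ddbar_cmult E) auto
    have sumE: "(\<Sum>x\<in>?I. q (fst x) (snd x) *
        (weighted_monomial (fst x) (snd x) ?N z - of_real (log_mass (fst x) (snd x) ?N) * weighted_monomial 0 0 2 z))
       = bipoly d q z * inverse (1 + z * cnj z) ^ ?N - \<kappa> * weighted_monomial 0 0 2 z" for z
      unfolding bipoly_def \<kappa>_def weighted_monomial_def case_prod_unfold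
      by (simp only: right_diff_distrib sum_subtractf sum_distrib_right mult.assoc)
    \<comment> \<open>In the Laplacian of this difference the two reference densities cancel,
      leaving \<open>mixed_ddbar d p\<close> times one minus the weight.\<close>
    have dU: "has_ddbar UNIV (\<lambda>w. mixed_poly d p w + ((-1) * Ev w + (- \<kappa>) * L w))
       (\<lambda>w. mixed_ddbar d p w + ((-1) * (bipoly d q w * inverse (1 + w * cnj w) ^ ?N - \<kappa> * weighted_monomial 0 0 2 w)
             + (- \<kappa>) * weighted_monomial 0 0 2 w))"
      using has_ddbar_add[OF has_ddbar_mixed_poly has_ddbar_add[OF has_ddbar_cmult[OF dE] has_ddbar_cmult[OF dL]]]
      unfolding sumE by blast
    have U_pos: "0 \<le> Re (mixed_ddbar d p w + ((-1) * (bipoly d q w * inverse (1 + w * cnj w) ^ ?N - \<kappa> * weighted_monomial 0 0 2 w)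
             + (- \<kappa>) * weighted_monomial 0 0 2 w))" for w
    proof -
      obtain y where y: "y \<ge> 0" "mixed_ddbar d p w = of_real y" using pos by blast
      have "mixed_ddbar d p w + ((-1) * (bipoly d q w * inverse (1 + w * cnj w) ^ ?N - \<kappa> * weighted_monomial 0 0 2 w)
             + (- \<kappa>) * weighted_monomial 0 0 2 w) = of_real y * (1 - inverse (1 + w * cnj w) ^ ?N)"
        unfolding q y by (simp only: algebra_simps) simp
      also have "Re \<dots> = y * (1 - Re (inverse (1 + w * cnj w) ^ ?N))" by (simp only: Re_complex_of_real times_complex.sel minus_complex.sel one_complex.sel Im_complex_of_real mult_zero_left diff_zero)
      finally show ?thesis using y one_minus_inverse_power_nonneg[of w ?N] by (simp only: mult_nonneg_nonneg)
    qed
    let ?\<gamma> = "\<lambda>t. F (of_real (1/2) * cis t)"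
    have c\<gamma>: "continuous_on {0..2*pi} ?\<gamma>"
      by (rule continuous_on_compose2[OF holomorphic_on_imp_continuous_on[OF F(1)]])
         (auto intro!: continuous_intros simp: norm_mult)
    have cL: "continuous_on {0..2*pi} (\<lambda>t. L (?\<gamma> t))"
      by (rule continuous_on_compose2[OF has_ddbar_continuous_on[OF dL] c\<gamma>]) auto
    have cE: "continuous_on {0..2*pi} (\<lambda>t. Ev (?\<gamma> t))"
      by (rule continuous_on_compose2[OF has_ddbar_continuous_on[OF dE] c\<gamma>]) auto
    have EvK: "cmod (Ev w) \<le> K" for w
    proof -
      have "cmod (Ev w) \<le> (\<Sum>x\<in>?I. cmod (q (fst x) (snd x) * E x w))"
        unfolding Ev_def by (rule norm_sum)
      also have "\<dots> \<le> K" unfolding K_def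
      proof (rule sum_mono)
        fix x assume x: "x \<in> ?I"
        have "cmod (q (fst x) (snd x)) \<le> real (Suc (fst x)) * real (Suc (snd x)) * 1"
          unfolding q_def norm_mult norm_of_nat
          by (rule mult_left_mono) (use p1 x in auto)
        thus "cmod (q (fst x) (snd x) * E x w) \<le> real (Suc (fst x)) * real (Suc (snd x)) * C x"
          unfolding norm_mult using C[OF x] by (intro mult_mono) auto
      qed
      finally show ?thesis .
    qed
    define IQ IE IL where "IQ = integral {0..2*pi} (\<lambda>t. mixed_poly d p (?\<gamma> t))"
      and "IE = integral {0..2*pi} (\<lambda>t. Ev (?\<gamma> t))" and "IL = integral {0..2*pi} (\<lambda>t. ln (1 + (cmod (?\<gamma> t))\<^sup>2))"
    have ln_int: "(\<lambda>t. ln (1 + (cmod (?\<gamma> t))\<^sup>2)) integrable_on {0..2*pi}"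
    proof (intro integrable_continuous_real continuous_intros c\<gamma> ballI)
      show "1 + (cmod (?\<gamma> t))\<^sup>2 \<noteq> 0" for t by (smt (verit) zero_le_power2)
    qed
    have iL: "integral {0..2*pi} (\<lambda>t. L (?\<gamma> t)) = of_real IL"
    proof -
      from integral_linear[OF ln_int bounded_linear_of_real[where 'a = complex]] show ?thesis
        unfolding L_def IL_def by (simp only: o_def)
    qed
    have mean: "2 * pi * Re (mixed_poly d p (F 0) + ((-1) * Ev (F 0) + (- \<kappa>) * L (F 0))) \<le>
       Re (integral {0..2*pi} (\<lambda>t. mixed_poly d p (?\<gamma> t) + ((-1) * Ev (?\<gamma> t) + (- \<kappa>) * L (?\<gamma> t))))"
    proof (rule circle_mean_ge[OF has_ddbar_compose[OF dU F(1)]])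
      fix z
      show "0 \<le> Re ((mixed_ddbar d p (F z) + ((-1) * (bipoly d q (F z) * inverse (1 + F z * cnj (F z)) ^ ?N
            - \<kappa> * weighted_monomial 0 0 2 (F z)) + (- \<kappa>) * weighted_monomial 0 0 2 (F z))) * of_real ((cmod (deriv F z))\<^sup>2))"
        unfolding times_complex.sel(1)[of _ "of_real _"] Re_complex_of_real Im_complex_of_real mult_zero_right diff_zero
        by (rule mult_nonneg_nonneg[OF U_pos]) simp
    qed auto
    have "integral {0..2*pi} (\<lambda>t. mixed_poly d p (?\<gamma> t) + ((-1) * Ev (?\<gamma> t) + (- \<kappa>) * L (?\<gamma> t)))
       = IQ + ((-1) * IE + (- \<kappa>) * of_real IL)"
    proof -
      have i: "(\<lambda>t. mixed_poly d p (?\<gamma> t)) integrable_on {0..2*pi}"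
        "(\<lambda>t. (-1) * Ev (?\<gamma> t)) integrable_on {0..2*pi}" "(\<lambda>t. (- \<kappa>) * L (?\<gamma> t)) integrable_on {0..2*pi}"
        by (intro integrable_continuous_real continuous_intros c\<gamma> cE cL)+
      show ?thesis
        unfolding integral_add[OF i(1) integrable_add[OF i(2,3)]] integral_add[OF i(2,3)] integral_mult_right
          IQ_def IE_def iL ..
    qed
    with mean have "2 * pi * Re (- Ev 0) \<le> Re IQ - Re IE - Re \<kappa> * IL"
      by (simp add: F(2) L_def)
    moreover have "\<bar>Re (Ev 0)\<bar> \<le> K" using EvK[of 0] abs_Re_le_cmod[of "Ev 0"] by linarith
    hence "2 * pi * Re (- Ev 0) \<ge> 2 * pi * (- K)" by (intro mult_left_mono) auto
    moreover have "cmod IE \<le> K * (2 * pi - 0)"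
      unfolding IE_def by (rule integral_bound[OF _ cE]) (auto simp: EvK)
    hence "Re IE \<ge> - (K * (2 * pi))" using abs_Re_le_cmod[of IE] unfolding diff_zero by linarith
    moreover have "Re IQ \<le> 2 * pi" using le by (simp add: IQ_def)
    moreover have "2 * pi * (1 + 2 * K) = 2 * pi + 2 * (K * (2 * pi))" "2 * pi * (- K) = - (K * (2 * pi))"
      by (simp_all add: algebra_simps)
    ultimately have kl: "Re \<kappa> * IL \<le> 2 * pi * (1 + 2 * K)" by linarith
    \<comment> \<open>Off-diagonal monomials have mass 0, so only the diagonal remains, in the form
      that \<open>coeff_le_log_mass\<close> estimates from below.\<close>
    have "\<kappa> = (\<Sum>j<d. \<Sum>k<d. q j k * of_real (log_mass j k ?N))"
      unfolding \<kappa>_def by (simp add: sum.cartesian_product case_prod_unfold)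
    also have "\<dots> = (\<Sum>j<d. \<Sum>k<d. if k = j then q j j * of_real (log_mass j j ?N) else 0)"
      by (intro sum.cong refl) (auto simp: log_mass_def)
    also have "\<dots> = (\<Sum>j<d. q j j * of_real (log_mass j j ?N))"
      by (simp add: sum.delta')
    finally have "Re \<kappa> = (\<Sum>k<d. Re (q k k) * log_mass k k ?N)" by simp
    hence "cmod (q j0 k0) \<le> A * Re \<kappa>" using A(2)[of q j0 k0] pos p\<eta> q by simp
    moreover have "1 * \<eta> \<le> cmod (q j0 k0)"
    proof -
      have "1 * 1 \<le> real (Suc j0) * real (Suc k0)" by (intro mult_mono) auto
      hence "1 * \<eta> \<le> (real (Suc j0) * real (Suc k0)) * cmod (p j0 k0)"
        using p\<eta> \<eta> by (intro mult_mono) auto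
      thus ?thesis unfolding q_def norm_mult norm_of_nat .
    qed
    ultimately have k\<eta>: "\<eta> \<le> A * Re \<kappa>" by simp
    \<comment> \<open>The sign of \<open>IL\<close> is what allows \<open>Re \<kappa>\<close> to be
      replaced by its lower bound \<open>\<eta> / A\<close>.\<close>
    have "IL \<ge> 0" unfolding IL_def
      by (rule integral_nonneg[OF ln_int]) simp
    hence "\<eta> * IL \<le> A * Re \<kappa> * IL" using k\<eta> by (intro mult_right_mono)
    also have "\<dots> \<le> A * (2 * pi * (1 + 2 * K))"
      unfolding mult.assoc[of A] using kl A(1) by (intro mult_left_mono) auto
    finally show ?thesis unfolding B_def IL_def[symmetric] using \<eta> by (simp add: field_simps)
  qed
  show ?thesis
  proof (intro exI[of _ B] allI impI)
  qed (use main in blast)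
qed

section \<open>From circle means to bounds near the centre\<close>

lemma circle_mean_ln_ge:
  assumes "H holomorphic_on ball 0 1" "0 < s" "s < 1"
  shows "2 * pi * ln (1 + (cmod (H 0))\<^sup>2) \<le> integral {0..2*pi} (\<lambda>t. ln (1 + (cmod (H (of_real s * cis t)))\<^sup>2))"
    and "(\<lambda>t. ln (1 + (cmod (H (of_real s * cis t)))\<^sup>2)) integrable_on {0..2*pi}"
proof -
  have c: "continuous_on {0..2*pi} (\<lambda>t. H (of_real s * cis t))"
    by (rule continuous_on_compose2[OF holomorphic_on_imp_continuous_on[OF assms(1)]])
       (use assms in \<open>auto intro!: continuous_intros simp: norm_mult\<close>)
  show i: "(\<lambda>t. ln (1 + (cmod (H (of_real s * cis t)))\<^sup>2)) integrable_on {0..2*pi}"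
  proof (intro integrable_continuous_real continuous_intros c ballI)
    show "1 + (cmod (H (of_real s * cis t)))\<^sup>2 \<noteq> 0" for t by (smt (verit) zero_le_power2)
  qed
  have "2 * pi * Re (of_real (ln (1 + (cmod (H 0))\<^sup>2)))
     \<le> Re (integral {0..2*pi} (\<lambda>t. of_real (ln (1 + (cmod (H (of_real s * cis t)))\<^sup>2))))"
  proof (rule circle_mean_ge[OF has_ddbar_compose[OF has_ddbar_ln assms(1)]])
    fix z
    have "weighted_monomial 0 0 2 (H z) * of_real ((cmod (deriv H z))\<^sup>2)
       = of_real (inverse (1 + (cmod (H z))\<^sup>2) ^ 2 * (cmod (deriv H z))\<^sup>2)"
      unfolding weighted_monomial_def one_plus_norm_sq by simp
    thus "0 \<le> Re (weighted_monomial 0 0 2 (H z) * of_real ((cmod (deriv H z))\<^sup>2))"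
      by (simp only: Re_complex_of_real) simp
  qed (use assms in auto)
  thus "2 * pi * ln (1 + (cmod (H 0))\<^sup>2) \<le> integral {0..2*pi} (\<lambda>t. ln (1 + (cmod (H (of_real s * cis t)))\<^sup>2))"
    using integral_linear[OF i bounded_linear_of_real[where 'a = complex]]
    by (simp only: o_def Re_complex_of_real)
qed

text \<open>The difference quotient of \<open>F\<close> at \<open>t1\<close> has the value
  \<open>F(t1) / t1\<close> at 0, so a bound for its logarithmic mean gives a bound for
  \<open>F(t1)\<close> proportional to \<open>|t1|\<close>.\<close>

lemma small_values_of_log_mean:
  "\<exists>\<rho>>0. \<rho> \<le> 1/4 \<and> (\<forall>F. F holomorphic_on ball 0 1 \<longrightarrow> F 0 = 0 \<longrightarrow>
     integral {0..2*pi} (\<lambda>t. ln (1 + (cmod (F (of_real (1/2) * cis t)))\<^sup>2)) \<le> B \<longrightarrow>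
     (\<forall>t. cmod t \<le> \<rho> \<longrightarrow> cmod (F t) \<le> 1))"
proof -
  \<comment> \<open>33 is 1 + 32, with 32 = 2 * 4^2: the 4 is the inverse distance from the circle
    of radius 1/2 to the disc of radius 1/4, the 2 comes from the square of a sum. The exponential
    undoes the logarithm of the mean.\<close>
  define K where "K = 33 * exp (B / (2 * pi))"
  have K: "K > 0" by (simp add: K_def)
  define \<rho> where "\<rho> = min (1/4) (sqrt (1 / (2 * K)))"
  have \<rho>: "\<rho> > 0" "\<rho> \<le> 1/4" "K * \<rho>\<^sup>2 \<le> 1/2"
  proof -
    show "\<rho> > 0" "\<rho> \<le> 1/4" using K by (auto simp: \<rho>_def)
    have "\<rho>\<^sup>2 \<le> (sqrt (1 / (2 * K)))\<^sup>2" by (rule power_mono) (use \<open>\<rho> > 0\<close> in \<open>auto simp: \<rho>_def\<close>)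
    also have "\<dots> = 1 / (2 * K)" using K by simp
    finally show "K * \<rho>\<^sup>2 \<le> 1/2" using K by (simp add: field_simps)
  qed
  have "cmod (F t1) \<le> 1" if F: "F holomorphic_on ball 0 1" "F 0 = 0"
    and B: "integral {0..2*pi} (\<lambda>t. ln (1 + (cmod (F (of_real (1/2) * cis t)))\<^sup>2)) \<le> B"
    and t1: "cmod t1 \<le> \<rho>" for F t1
  proof (cases "t1 = 0")
    case False
    define a where "a = F t1"
    let ?m = "1 + (cmod a)\<^sup>2"
    have m: "?m \<ge> 1" by simp
    define G where "G t = (if t = t1 then deriv F t1 else (F t - F t1) / (t - t1))" for t
    \<comment> \<open>The unknown \<open>|a|\<close> enters the bound for \<open>G\<close> on the
      circle. Dividing by \<open>sqrt (1 + |a|^2)\<close> absorbs it, and the final inequality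
      \<open>|a|^2 <= (1 + |a|^2) / 2\<close> gives \<open>|a| <= 1\<close>.\<close>
    define H where "H t = G t / of_real (sqrt ?m)" for t
    have G: "G holomorphic_on ball 0 1"
      unfolding G_def[abs_def] using F(1) by (rule pole_lemma_open) simp
    have H: "H holomorphic_on ball 0 1"
      unfolding H_def[abs_def] using m by (intro holomorphic_intros G) auto
    have H2: "(cmod (H t))\<^sup>2 = (cmod (G t))\<^sup>2 / ?m" for t
      unfolding H_def norm_divide power_divide using m by simp
    have bound: "ln (1 + (cmod (H (of_real (1/2) * cis t)))\<^sup>2)
        \<le> ln 33 + ln (1 + (cmod (F (of_real (1/2) * cis t)))\<^sup>2)" for t
    proof -
      let ?z = "of_real (1/2) * cis t"
      have z: "cmod ?z = 1/2" by (simp add: norm_mult)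
      have d: "cmod (?z - t1) \<ge> 1/4" using norm_triangle_ineq2[of ?z t1] z t1 \<rho>(2) by linarith
      hence "?z \<noteq> t1" by auto
      hence "G ?z = (F ?z - a) / (?z - t1)" by (simp add: G_def a_def)
      hence "cmod (G ?z) = cmod (F ?z - a) / cmod (?z - t1)" by (simp only: norm_divide)
      also have "\<dots> \<le> cmod (F ?z - a) / (1/4)" using d by (intro divide_left_mono) auto
      finally have "cmod (G ?z) \<le> 4 * (cmod (F ?z) + cmod a)"
        using norm_triangle_ineq4[of "F ?z" a] by simp
      hence "(cmod (G ?z))\<^sup>2 \<le> (4 * (cmod (F ?z) + cmod a))\<^sup>2" by (rule power_mono) simp
      also have "\<dots> \<le> 32 * ((cmod (F ?z))\<^sup>2 + (cmod a)\<^sup>2)"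
        using sum_squares_bound[of "cmod (F ?z)" "cmod a"] by (simp add: power2_eq_square algebra_simps)
      also have "\<dots> \<le> 32 * ((1 + (cmod (F ?z))\<^sup>2) * ?m)"
        by (simp add: algebra_simps)
      finally have *: "(cmod (H ?z))\<^sup>2 \<le> 32 * (1 + (cmod (F ?z))\<^sup>2)"
        unfolding H2 using pos_divide_le_eq[of ?m] m by (simp only: mult.assoc)
      have "1 + (cmod (H ?z))\<^sup>2 \<le> 33 * (1 + (cmod (F ?z))\<^sup>2)"
      proof -
        have "1 + x \<le> 33 * (1 + y)" if "x \<le> 32 * (1 + y)" "0 \<le> y" for x y :: real
          using that by simp
        from this[OF * zero_le_power2] show ?thesis .
      qed
      moreover have p: "1 + x\<^sup>2 > 0" for x :: real by (smt (verit) zero_le_power2)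
      ultimately have "ln (1 + (cmod (H ?z))\<^sup>2) \<le> ln (33 * (1 + (cmod (F ?z))\<^sup>2))"
        by (intro ln_mono)
      thus ?thesis using p[of "cmod (F ?z)"] by (simp only: ln_mult_pos zero_less_numeral)
    qed
    have "2 * pi * ln (1 + (cmod (H 0))\<^sup>2) \<le> integral {0..2*pi} (\<lambda>t. ln (1 + (cmod (H (of_real (1/2) * cis t)))\<^sup>2))"
      using circle_mean_ln_ge(1)[OF H, of "1/2"] by simp
    also have "\<dots> \<le> integral {0..2*pi} (\<lambda>t. ln 33 + ln (1 + (cmod (F (of_real (1/2) * cis t)))\<^sup>2))"
      by (rule integral_le[OF circle_mean_ln_ge(2)[OF H] integrable_add[OF _ circle_mean_ln_ge(2)[OF F(1)]]])
         (use bound in auto)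
    also have "\<dots> = 2 * pi * ln 33 + integral {0..2*pi} (\<lambda>t. ln (1 + (cmod (F (of_real (1/2) * cis t)))\<^sup>2))"
      by (subst integral_add[OF _ circle_mean_ln_ge(2)[OF F(1)]]) auto
    also have "\<dots> \<le> 2 * pi * ln 33 + B" using B by simp
    also have "\<dots> = 2 * pi * (ln 33 + B / (2 * pi))" by (simp add: field_simps)
    finally have "ln (1 + (cmod (H 0))\<^sup>2) \<le> ln 33 + B / (2 * pi)" by simp
    hence "exp (ln (1 + (cmod (H 0))\<^sup>2)) \<le> exp (ln 33 + B / (2 * pi))" by simp
    moreover have "1 + (cmod (H 0))\<^sup>2 > 0" by (smt (verit) zero_le_power2)
    ultimately have "1 + (cmod (H 0))\<^sup>2 \<le> K" by (simp add: K_def exp_add)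
    hence "(cmod (H 0))\<^sup>2 \<le> K" by simp
    moreover have "G 0 = a / t1" using False F(2) by (simp add: G_def a_def)
    ultimately have "((cmod a)\<^sup>2 / (cmod t1)\<^sup>2) / ?m \<le> K" unfolding H2 by (simp add: norm_divide power_divide)
    hence "(cmod a)\<^sup>2 \<le> K * ?m * (cmod t1)\<^sup>2"
      using False m by (simp add: pos_divide_le_eq add_pos_nonneg) (simp only: mult.assoc mult.left_commute mult.commute)
    also have "\<dots> \<le> K * ?m * \<rho>\<^sup>2" using t1 K m by (intro mult_left_mono power_mono) auto
    also have "\<dots> = K * \<rho>\<^sup>2 * ?m" by (simp only: mult.assoc mult.commute mult.left_commute)
    also have "\<dots> \<le> 1/2 * ?m" using \<rho>(3) m by (intro mult_right_mono) auto
    finally have "(cmod a)\<^sup>2 \<le> 1" by simp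
    thus ?thesis by (simp add: a_def power2_le_iff_abs_le abs_square_le_1)
  qed (use F in simp)
  thus ?thesis using \<rho> by blast
qed

lemma deriv_bound_of_bounded:
  assumes "f holomorphic_on ball 0 1" "0 < \<rho>" "\<rho> < 1" "\<And>t. cmod t \<le> \<rho> \<Longrightarrow> cmod (f t) \<le> M"
  shows "cmod (deriv f 0) \<le> M / \<rho>"
proof -
  have s: "cball 0 \<rho> \<subseteq> ball (0::complex) 1" "ball 0 \<rho> \<subseteq> ball (0::complex) 1" using assms by auto
  have "cmod ((deriv ^^ 1) f 0) \<le> fact 1 * M / \<rho> ^ 1"
    by (rule Cauchy_inequality[OF holomorphic_on_subset[OF assms(1) s(2)]
          continuous_on_subset[OF holomorphic_on_imp_continuous_on[OF assms(1)] s(1)] assms(2)])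
       (use assms in auto)
  thus ?thesis by simp
qed

text \<open>Borel-Caratheodory at the centre: the Moebius map \<open>w / (2 M - w)\<close> sends the
  half-plane \<open>Re w < M\<close> into the unit disc and 0 to 0.\<close>

lemma deriv_bound_of_Re_bounded:
  assumes "g holomorphic_on ball 0 1" "0 < \<rho>" "\<rho> < 1" "\<And>t. cmod t \<le> \<rho> \<Longrightarrow> Re (g t) < Re (g 0) + M"
  shows "cmod (deriv g 0) \<le> 2 * M / \<rho>"
proof -
  have M: "M > 0" using assms(4)[of 0] assms(2) by simp
  define w where "w t = g t - g 0" for t
  define \<phi> where "\<phi> t = w t / (of_real (2 * M) - w t)" for t
  have Re_w: "Re (w t) < M" if "cmod t \<le> \<rho>" for t using assms(4)[OF that] by (simp add: w_def)
  have nz: "of_real (2 * M) - w t \<noteq> 0" if "cmod t \<le> \<rho>" for t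
    using Re_w[OF that] M by (auto simp: complex_eq_iff)
  have s: "cball 0 \<rho> \<subseteq> ball (0::complex) 1" "ball 0 \<rho> \<subseteq> ball (0::complex) 1" using assms by auto
  have hol: "\<phi> holomorphic_on ball 0 \<rho>"
    unfolding \<phi>_def[abs_def] w_def using nz
    by (intro holomorphic_intros holomorphic_on_subset[OF assms(1) s(2)]) (auto simp: w_def)
  have cont: "continuous_on (cball 0 \<rho>) \<phi>"
    unfolding \<phi>_def[abs_def] w_def using nz
    by (intro continuous_intros continuous_on_subset[OF holomorphic_on_imp_continuous_on[OF assms(1)] s(1)])
       (auto simp: w_def)
  have le1: "cmod (\<phi> t) \<le> 1" if "cmod t \<le> \<rho>" for t
  proof -
    have "(Re (w t))\<^sup>2 \<le> (2 * M - Re (w t))\<^sup>2"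
      by (rule iffD1[OF abs_le_square_iff]) (use Re_w[OF that] M in auto)
    hence "cmod (w t) \<le> cmod (of_real (2 * M) - w t)"
      unfolding cmod_def by (intro real_sqrt_le_mono) simp
    thus ?thesis unfolding \<phi>_def norm_divide using nz[OF that] by (simp add: divide_le_eq)
  qed
  have "cmod ((deriv ^^ 1) \<phi> 0) \<le> fact 1 * 1 / \<rho> ^ 1"
    by (rule Cauchy_inequality[OF hol cont assms(2)]) (use le1 in auto)
  hence "cmod (deriv \<phi> 0) \<le> 1 / \<rho>" by simp
  moreover have "deriv \<phi> 0 = deriv g 0 / of_real (2 * M)"
  proof (rule DERIV_imp_deriv)
    have dg: "(g has_field_derivative deriv g 0) (at 0)"
      by (rule holomorphic_derivI[OF assms(1)]) auto
    have dw: "(w has_field_derivative deriv g 0) (at 0)"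
      unfolding w_def[abs_def] using dg by (auto intro!: derivative_eq_intros)
    have dv: "((\<lambda>t. of_real (2 * M) - w t) has_field_derivative - deriv g 0) (at 0)"
      using dw by (auto intro!: derivative_eq_intros)
    have "(\<phi> has_field_derivative (deriv g 0 * (of_real (2 * M) - w 0) - w 0 * (- deriv g 0)) /
        ((of_real (2 * M) - w 0) * (of_real (2 * M) - w 0))) (at 0)"
      unfolding \<phi>_def[abs_def] by (rule DERIV_divide[OF dw dv nz]) (use assms in simp)
    thus "(\<phi> has_field_derivative deriv g 0 / of_real (2 * M)) (at 0)"
      using M by (simp add: w_def)
  qed
  ultimately have "cmod (deriv g 0) / (2 * M) \<le> 1 / \<rho>" using M by (simp add: norm_divide norm_mult)
  thus ?thesis using M assms(2) by (simp add: field_simps)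
qed

text \<open>The sub-mean value property of \<open>|w|^2\<close> is applied to
  \<open>f(t) / t\<close>, whose value at 0 is the derivative. On the circle of radius 1/2 the
  division costs the factor 4 in the square.\<close>

lemma deriv_bound_of_square_mean:
  assumes f: "f holomorphic_on ball 0 1" "f 0 = 0"
    and le: "integral {0..2*pi} (\<lambda>t. (cmod (f (of_real (1/2) * cis t)))\<^sup>2) \<le> 2 * pi"
  shows "cmod (deriv f 0) \<le> 2"
proof -
  define G where "G t = (if t = 0 then deriv f 0 else (f t - f 0) / (t - 0))" for t
  have G: "G holomorphic_on ball 0 1"
    unfolding G_def[abs_def] using f(1) by (rule pole_lemma_open) simp
  have c: "continuous_on {0..2*pi} (\<lambda>t. G (of_real (1/2) * cis t))"
    by (rule continuous_on_compose2[OF holomorphic_on_imp_continuous_on[OF G]])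
       (auto intro!: continuous_intros simp: norm_mult)
  have i: "(\<lambda>t. (cmod (G (of_real (1/2) * cis t)))\<^sup>2) integrable_on {0..2*pi}"
    by (intro integrable_continuous_real continuous_intros c)
  have dd: "has_ddbar UNIV (\<lambda>w. w ^ Suc 0 * cnj w ^ Suc 0) (\<lambda>w. 1)"
    using has_ddbar_monomial[of UNIV 0 0] by simp
  have "2 * pi * Re (G 0 ^ Suc 0 * cnj (G 0) ^ Suc 0)
     \<le> Re (integral {0..2*pi} (\<lambda>t. G (of_real (1/2) * cis t) ^ Suc 0 * cnj (G (of_real (1/2) * cis t)) ^ Suc 0))"
    by (rule circle_mean_ge[OF has_ddbar_compose[OF dd G]]) auto
  hence "2 * pi * (cmod (G 0))\<^sup>2 \<le> Re (integral {0..2*pi} (\<lambda>t. of_real ((cmod (G (of_real (1/2) * cis t)))\<^sup>2)))"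
    by (simp only: power_Suc power_0 mult_1_right complex_norm_square[symmetric] Re_complex_of_real)
  also have "\<dots> = integral {0..2*pi} (\<lambda>t. (cmod (G (of_real (1/2) * cis t)))\<^sup>2)"
    using integral_linear[OF i bounded_linear_of_real[where 'a = complex]]
    by (simp only: o_def Re_complex_of_real)
  also have "\<dots> = integral {0..2*pi} (\<lambda>t. 4 * (cmod (f (of_real (1/2) * cis t)))\<^sup>2)"
    by (rule integral_cong) (simp add: G_def f(2) norm_divide norm_mult power_mult_distrib)
  also have "\<dots> \<le> 4 * (2 * pi)" unfolding integral_mult_right using le by simp
  finally have "(cmod (G 0))\<^sup>2 \<le> 2\<^sup>2" by simp
  hence "cmod (G 0) \<le> 2" by (rule power2_le_imp_le) simp
  thus ?thesis by (simp add: G_def)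
qed

text \<open>The constant precedes the polynomial and the disc, which is the uniformity needed when
  the centre varies over the whole unbounded domain.\<close>

lemma normalized_disc_derivative_bound:
  assumes \<eta>: "\<eta> > 0"
  shows "\<exists>C\<ge>2. \<forall>p g0 g1 (g :: 'i \<Rightarrow> complex \<Rightarrow> complex) I.
     (\<forall>j<d. \<forall>k<d. cmod (p j k) \<le> 1) \<longrightarrow> (\<exists>j<d. \<exists>k<d. \<eta> \<le> cmod (p j k)) \<longrightarrow>
     (\<forall>w. \<exists>y\<ge>0. mixed_ddbar d p w = of_real y) \<longrightarrow> finite I \<longrightarrow>
     g0 holomorphic_on ball 0 1 \<longrightarrow> g1 holomorphic_on ball 0 1 \<longrightarrow> (\<forall>\<alpha>\<in>I. g \<alpha> holomorphic_on ball 0 1) \<longrightarrow>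
     g0 0 = -1 \<longrightarrow> g1 0 = 0 \<longrightarrow> (\<forall>\<alpha>\<in>I. g \<alpha> 0 = 0) \<longrightarrow>
     (\<forall>t\<in>ball 0 1. Re (g0 t) + Re (mixed_poly d p (g1 t)) + (\<Sum>\<alpha>\<in>I. (cmod (g \<alpha> t))\<^sup>2) < 0) \<longrightarrow>
     cmod (deriv g0 0) \<le> C \<and> cmod (deriv g1 0) \<le> C \<and> (\<forall>\<alpha>\<in>I. cmod (deriv (g \<alpha>) 0) \<le> C)"
proof -
  obtain B where B: "\<And>p F. \<lbrakk>\<forall>j<d. \<forall>k<d. cmod (p j k) \<le> 1; \<exists>j<d. \<exists>k<d. \<eta> \<le> cmod (p j k);
     \<forall>w. \<exists>y\<ge>0. mixed_ddbar d p w = of_real y; F holomorphic_on ball 0 1; F 0 = 0;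
     Re (integral {0..2*pi} (\<lambda>t. mixed_poly d p (F (of_real (1/2) * cis t)))) \<le> 2 * pi\<rbrakk> \<Longrightarrow>
     integral {0..2*pi} (\<lambda>t. ln (1 + (cmod (F (of_real (1/2) * cis t)))\<^sup>2)) \<le> B"
    using circle_mean_log_bound[OF \<eta>, of d] by blast
  obtain \<rho> where \<rho>: "\<rho> > 0" "\<rho> \<le> 1/4" "\<And>F t. \<lbrakk>F holomorphic_on ball 0 1; F 0 = 0;
     integral {0..2*pi} (\<lambda>t. ln (1 + (cmod (F (of_real (1/2) * cis t)))\<^sup>2)) \<le> B; cmod t \<le> \<rho>\<rbrakk> \<Longrightarrow> cmod (F t) \<le> 1"
    using small_values_of_log_mean[of B] by blast
  \<comment> \<open>Where \<open>|g1| <= 1\<close>, the polynomial is at least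
    \<open>- d * d\<close>, so \<open>Re g0 < d * d\<close>; the additional 1 is
    \<open>- Re (g0 0)\<close>. In \<open>C\<close>, the 2 serves the remaining components.\<close>
  define M where "M = real (d * d) + 1"
  define C where "C = max 2 (2 * M / \<rho>)"
  have "cmod (deriv g0 0) \<le> C \<and> cmod (deriv g1 0) \<le> C \<and> (\<forall>\<alpha>\<in>I. cmod (deriv (g \<alpha>) 0) \<le> C)"
    if p1: "\<forall>j<d. \<forall>k<d. cmod (p j k) \<le> 1" and p\<eta>: "\<exists>j<d. \<exists>k<d. \<eta> \<le> cmod (p j k)"
      and pos: "\<forall>w. \<exists>y\<ge>0. mixed_ddbar d p w = of_real y" and I: "finite I"
      and g0: "g0 holomorphic_on ball 0 1" and g1: "g1 holomorphic_on ball 0 1"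
      and g: "\<forall>\<alpha>\<in>I. g \<alpha> holomorphic_on ball 0 1"
      and z: "g0 0 = -1" "g1 0 = 0" "\<forall>\<alpha>\<in>I. g \<alpha> 0 = 0"
      and neg: "\<forall>t\<in>ball 0 1. Re (g0 t) + Re (mixed_poly d p (g1 t)) + (\<Sum>\<alpha>\<in>I. (cmod (g \<alpha> t))\<^sup>2) < 0"
    for p g0 g1 and g :: "'i \<Rightarrow> complex \<Rightarrow> complex" and I
  proof -
    let ?\<gamma> = "\<lambda>t. of_real (1/2) * cis t"
    have \<gamma>: "?\<gamma> t \<in> ball 0 1" for t by (simp add: norm_mult)
    have ch: "continuous_on {0..2*pi} (\<lambda>t. h (?\<gamma> t))" if "h holomorphic_on ball 0 1" for h
      by (rule continuous_on_compose2[OF holomorphic_on_imp_continuous_on[OF that]])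
         (auto intro!: continuous_intros simp: norm_mult)
    have i0: "(\<lambda>t. g0 (?\<gamma> t)) integrable_on {0..2*pi}"
      by (intro integrable_continuous_real ch g0)
    have i1: "(\<lambda>t. mixed_poly d p (g1 (?\<gamma> t))) integrable_on {0..2*pi}"
      by (intro integrable_continuous_real continuous_intros ch g1)
    have ig: "(\<lambda>t. (cmod (g \<alpha> (?\<gamma> t)))\<^sup>2) integrable_on {0..2*pi}" if "\<alpha> \<in> I" for \<alpha>
      using g that by (intro integrable_continuous_real continuous_intros ch) auto
    have Re_i: "Re (integral {0..2*pi} h) = integral {0..2*pi} (\<lambda>t. Re (h t))"
       "(\<lambda>t. Re (h t)) integrable_on {0..2*pi}"
      if "h integrable_on {0..2*pi}" for h :: "real \<Rightarrow> complex"
      using integral_linear[OF that bounded_linear_Re] integrable_linear[OF that bounded_linear_Re]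
      by (simp_all add: o_def)
    define I0 I1 where "I0 = integral {0..2*pi} (\<lambda>t. Re (g0 (?\<gamma> t)))"
      and "I1 = integral {0..2*pi} (\<lambda>t. Re (mixed_poly d p (g1 (?\<gamma> t))))"
    define J where "J \<alpha> = integral {0..2*pi} (\<lambda>t. (cmod (g \<alpha> (?\<gamma> t)))\<^sup>2)" for \<alpha>
    have dd0: "has_ddbar UNIV (\<lambda>w. w) (\<lambda>_. 0)"
      by (rule has_ddbarI[OF has_wirtinger_id has_wirtinger_const]) auto
    have "2 * pi * Re (g0 0) \<le> Re (integral {0..2*pi} (\<lambda>t. g0 (?\<gamma> t)))"
      by (rule circle_mean_ge[OF has_ddbar_compose[OF dd0 g0]]) auto
    hence I0: "- (2 * pi) \<le> I0" unfolding Re_i(1)[OF i0] I0_def z by simp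
    have "2 * pi * Re (mixed_poly d p (g1 0)) \<le> Re (integral {0..2*pi} (\<lambda>t. mixed_poly d p (g1 (?\<gamma> t))))"
    proof (rule circle_mean_ge[OF has_ddbar_compose[OF has_ddbar_mixed_poly g1]])
      fix t
      obtain y where "y \<ge> 0" "mixed_ddbar d p (g1 t) = of_real y" using pos by blast
      thus "0 \<le> Re (mixed_ddbar d p (g1 t) * of_real ((cmod (deriv g1 t))\<^sup>2))" by simp
    qed auto
    hence I1: "0 \<le> I1" unfolding Re_i(1)[OF i1] I1_def z by simp
    have J: "0 \<le> J \<alpha>" if "\<alpha> \<in> I" for \<alpha>
      unfolding J_def by (rule integral_nonneg[OF ig[OF that]]) simp
    have "integral {0..2*pi} (\<lambda>t. Re (g0 (?\<gamma> t)) + Re (mixed_poly d p (g1 (?\<gamma> t))) + (\<Sum>\<alpha>\<in>I. (cmod (g \<alpha> (?\<gamma> t)))\<^sup>2))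
      \<le> integral {0..2*pi} (\<lambda>_. 0)"
    proof (rule integral_le)
      show "(\<lambda>t. Re (g0 (?\<gamma> t)) + Re (mixed_poly d p (g1 (?\<gamma> t))) + (\<Sum>\<alpha>\<in>I. (cmod (g \<alpha> (?\<gamma> t)))\<^sup>2))
         integrable_on {0..2*pi}"
        by (intro integrable_add Re_i(2) i0 i1 integrable_sum I ig)
    qed (use neg \<gamma> in \<open>auto intro: less_imp_le\<close>)
    also have "integral {0..2*pi} (\<lambda>t. Re (g0 (?\<gamma> t)) + Re (mixed_poly d p (g1 (?\<gamma> t))) + (\<Sum>\<alpha>\<in>I. (cmod (g \<alpha> (?\<gamma> t)))\<^sup>2))
      = I0 + I1 + (\<Sum>\<alpha>\<in>I. J \<alpha>)"
      unfolding I0_def I1_def J_def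
      by (intro integral_unique has_integral_add has_integral_sum integrable_integral Re_i(2) i0 i1 I ig)
    finally have sum: "I0 + I1 + (\<Sum>\<alpha>\<in>I. J \<alpha>) \<le> 0" by simp
    have sJ: "(\<Sum>\<alpha>\<in>I. J \<alpha>) \<ge> 0" by (intro sum_nonneg J)
    have "Re (integral {0..2*pi} (\<lambda>t. mixed_poly d p (g1 (?\<gamma> t)))) \<le> 2 * pi"
      using sum sJ I0 unfolding Re_i(1)[OF i1] I1_def by linarith
    from B[OF p1 p\<eta> pos g1 z(2) this]
    have small: "cmod (g1 t) \<le> 1" if "cmod t \<le> \<rho>" for t using \<rho>(3)[OF g1 z(2)] that by blast
    have r1: "\<rho> < 1" using \<rho>(2) by simp
    have "cmod (deriv g1 0) \<le> 1 / \<rho>" by (rule deriv_bound_of_bounded[OF g1 \<rho>(1) r1 small])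
    also have "\<dots> \<le> 2 * M / \<rho>" using \<rho>(1) by (intro divide_right_mono) (auto simp: M_def)
    finally have C1: "cmod (deriv g1 0) \<le> C" by (simp add: C_def)
    have "cmod (deriv g0 0) \<le> 2 * M / \<rho>"
    proof (rule deriv_bound_of_Re_bounded[OF g0 \<rho>(1) r1])
      fix t :: complex assume t: "cmod t \<le> \<rho>"
      have "cmod (mixed_poly d p (g1 t)) \<le> real (d * d) * (cmod (g1 t))\<^sup>2"
        by (rule norm_mixed_poly_le) (use p1 small[OF t] in auto)
      also have "\<dots> \<le> real (d * d) * 1" using small[OF t] by (intro mult_left_mono power_le_one) auto
      finally have "- real (d * d) \<le> Re (mixed_poly d p (g1 t))"
        using abs_Re_le_cmod[of "mixed_poly d p (g1 t)"] by linarith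
      moreover have "(\<Sum>\<alpha>\<in>I. (cmod (g \<alpha> t))\<^sup>2) \<ge> 0" by (intro sum_nonneg) auto
      moreover have "t \<in> ball 0 1" using t r1 by simp
      ultimately show "Re (g0 t) < Re (g0 0) + M" using neg z(1) unfolding M_def by fastforce
    qed
    hence C0: "cmod (deriv g0 0) \<le> C" by (simp add: C_def)
    have "cmod (deriv (g \<alpha>) 0) \<le> C" if \<alpha>: "\<alpha> \<in> I" for \<alpha>
    proof -
      have "J \<alpha> \<le> (\<Sum>\<alpha>\<in>I. J \<alpha>)" using \<alpha> I J by (intro member_le_sum) auto
      hence "J \<alpha> \<le> 2 * pi" using sum I0 I1 by linarith
      hence "cmod (deriv (g \<alpha>) 0) \<le> 2"
        using deriv_bound_of_square_mean[of "g \<alpha>"] g z(3) \<alpha> unfolding J_def by blast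
      thus ?thesis by (simp add: C_def)
    qed
    thus ?thesis using C0 C1 by blast
  qed
  moreover have "C \<ge> 2" by (simp add: C_def)
  ultimately show ?thesis by blast
qed

section \<open>Recentring the polynomial\<close>

text \<open>The value of the mixed derivative of order \<open>a\<close> in \<open>z\<close> and
  \<open>b\<close> in \<open>cnj z\<close>. The summation range stays \<open>n\<close> for all
  orders, at the price of terms with coefficients beyond the range, which are assumed to vanish
  where needed.\<close>

definition bipoly_deriv :: "nat \<Rightarrow> (nat \<Rightarrow> nat \<Rightarrow> complex) \<Rightarrow> nat \<Rightarrow> nat \<Rightarrow> complex \<Rightarrow> complex" where
  "bipoly_deriv n c a b = bipoly n (\<lambda>j k. fact (j + a) / fact j * (fact (k + b) / fact k) * c (j + a) (k + b))"

lemma bipoly_deriv_0_0: "bipoly_deriv n c 0 0 = bipoly n c"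
  by (simp add: bipoly_deriv_def)

lemma bipoly_double_sum: "bipoly n c z = (\<Sum>j<n. \<Sum>k<n. c j k * z ^ j * cnj z ^ k)"
  by (simp add: bipoly_def sum.cartesian_product)

lemma bipoly_deriv_eq_0:
  assumes "\<And>j k. N < j + k \<Longrightarrow> c j k = 0" "N < a + b"
  shows "bipoly_deriv n c a b z = 0"
  unfolding bipoly_deriv_def bipoly_def using assms by (intro sum.neutral) auto

lemma sum_lessThan_shift:
  fixes e :: "nat \<Rightarrow> 'a::comm_monoid_add"
  assumes "e 0 = 0" "e n = 0"
  shows "(\<Sum>j<n. e j) = (\<Sum>j<n. e (Suc j))"
proof -
  have "(\<Sum>j<n. e j) = (\<Sum>j<Suc n. e j)" using assms by simp
  also have "\<dots> = (\<Sum>j<n. e (Suc j))" unfolding sum.lessThan_Suc_shift using assms by simp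
  finally show ?thesis .
qed

text \<open>Differentiation kills the term of index 0, and the term of index \<open>n\<close> has
  coefficient 0, so the sum may be reindexed by one without changing its length.\<close>

lemma has_wirtinger_bipoly_deriv:
  assumes c: "\<And>j k. n \<le> j \<or> n \<le> k \<Longrightarrow> c j k = 0"
  shows "has_wirtinger S (bipoly_deriv n c a b) (bipoly_deriv n c (Suc a) b) (bipoly_deriv n c a (Suc b))"
proof -
  let ?e = "\<lambda>j k. fact (j + a) / fact j * (fact (k + b) / fact k) * c (j + a) (k + b)"
  have "has_wirtinger S (\<lambda>z. \<Sum>j<n. \<Sum>k<n. ?e j k * (z ^ j * cnj z ^ k))
     (\<lambda>z. \<Sum>j<n. \<Sum>k<n. ?e j k * (z ^ j * 0 + of_nat j * z ^ (j - 1) * cnj z ^ k))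
     (\<lambda>z. \<Sum>j<n. \<Sum>k<n. ?e j k * (z ^ j * (of_nat k * cnj z ^ (k - 1)) + 0 * cnj z ^ k))"
    by (intro has_wirtinger_sum has_wirtinger_cmult has_wirtinger_mult has_wirtinger_power
        has_wirtinger_cnj_power) auto
  thus ?thesis
  proof (rule has_wirtinger_cong)
    fix z
    show "bipoly_deriv n c a b z = (\<Sum>j<n. \<Sum>k<n. ?e j k * (z ^ j * cnj z ^ k))"
      by (simp add: bipoly_deriv_def bipoly_double_sum mult.assoc)
    have "(\<Sum>j<n. \<Sum>k<n. ?e j k * (z ^ j * 0 + of_nat j * z ^ (j - 1) * cnj z ^ k))
      = (\<Sum>j<n. \<Sum>k<n. ?e (Suc j) k * (z ^ Suc j * 0 + of_nat (Suc j) * z ^ (Suc j - 1) * cnj z ^ k))"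
      by (rule sum_lessThan_shift) (auto simp: c)
    also have "\<dots> = bipoly_deriv n c (Suc a) b z"
      unfolding bipoly_deriv_def bipoly_double_sum
    proof (intro sum.cong refl)
      fix j k
      have "fact (Suc j + a) / fact (Suc j) * of_nat (Suc j) = (fact (j + Suc a) / fact j :: complex)"
        by (simp add: field_simps del: of_nat_Suc)
      moreover have "?e (Suc j) k * (z ^ Suc j * 0 + of_nat (Suc j) * z ^ (Suc j - 1) * cnj z ^ k)
        = (fact (Suc j + a) / fact (Suc j) * of_nat (Suc j)) * (fact (k + b) / fact k) * c (Suc j + a) (k + b) * z ^ j * cnj z ^ k"
        by (simp only: mult_zero_right mult_zero_left add_0 diff_Suc_1 mult.assoc mult.commute mult.left_commute)
      ultimately show "?e (Suc j) k * (z ^ Suc j * 0 + of_nat (Suc j) * z ^ (Suc j - 1) * cnj z ^ k)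
        = fact (j + Suc a) / fact j * (fact (k + b) / fact k) * c (j + Suc a) (k + b) * z ^ j * cnj z ^ k"
        by (simp only: add_Suc add_Suc_right)
    qed
    finally show "bipoly_deriv n c (Suc a) b z
      = (\<Sum>j<n. \<Sum>k<n. ?e j k * (z ^ j * 0 + of_nat j * z ^ (j - 1) * cnj z ^ k))" by simp
    have "(\<Sum>k<n. ?e j k * (z ^ j * (of_nat k * cnj z ^ (k - 1)) + 0 * cnj z ^ k))
      = (\<Sum>k<n. ?e j (Suc k) * (z ^ j * (of_nat (Suc k) * cnj z ^ (Suc k - 1)) + 0 * cnj z ^ Suc k))" for j
      by (rule sum_lessThan_shift) (auto simp: c)
    hence "(\<Sum>j<n. \<Sum>k<n. ?e j k * (z ^ j * (of_nat k * cnj z ^ (k - 1)) + 0 * cnj z ^ k))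
      = (\<Sum>j<n. \<Sum>k<n. ?e j (Suc k) * (z ^ j * (of_nat (Suc k) * cnj z ^ (Suc k - 1)) + 0 * cnj z ^ Suc k))"
      by simp
    also have "\<dots> = bipoly_deriv n c a (Suc b) z"
      unfolding bipoly_deriv_def bipoly_double_sum
    proof (intro sum.cong refl)
      fix j k
      have "fact (Suc k + b) / fact (Suc k) * of_nat (Suc k) = (fact (k + Suc b) / fact k :: complex)"
        by (simp add: field_simps del: of_nat_Suc)
      moreover have "?e j (Suc k) * (z ^ j * (of_nat (Suc k) * cnj z ^ (Suc k - 1)) + 0 * cnj z ^ Suc k)
        = (fact (j + a) / fact j) * (fact (Suc k + b) / fact (Suc k) * of_nat (Suc k)) * c (j + a) (Suc k + b) * z ^ j * cnj z ^ k"
        by (simp only: mult_zero_left mult_zero_right add_0_right diff_Suc_1 mult.assoc mult.commute mult.left_commute)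
      ultimately show "?e j (Suc k) * (z ^ j * (of_nat (Suc k) * cnj z ^ (Suc k - 1)) + 0 * cnj z ^ Suc k)
        = fact (j + a) / fact j * (fact (k + Suc b) / fact k) * c (j + a) (k + Suc b) * z ^ j * cnj z ^ k"
        by (simp only: add_Suc add_Suc_right)
    qed
    finally show "bipoly_deriv n c a (Suc b) z
      = (\<Sum>j<n. \<Sum>k<n. ?e j k * (z ^ j * (of_nat k * cnj z ^ (k - 1)) + 0 * cnj z ^ k))" by simp
  qed
qed

lemma dz_eq: "has_wirtinger UNIV u g h \<Longrightarrow> dz u = g"
  and dzbar_eq: "has_wirtinger UNIV u g h \<Longrightarrow> dzbar u = h"
proof -
  assume w: "has_wirtinger UNIV u g h"
  have "frechet_derivative u (at z) = (\<lambda>x. g z * x + h z * cnj x)" for z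
    by (rule frechet_derivative_at[OF has_wirtingerD[OF w UNIV_I], symmetric])
  thus "dz u = g" "dzbar u = h"
    by (simp_all add: fun_eq_iff dz_def dzbar_def algebra_simps)
qed

lemma iterated_dz_dzbar_bipoly:
  assumes c: "\<And>j k. n \<le> j \<or> n \<le> k \<Longrightarrow> c j k = 0"
  shows "(dz ^^ a) ((dzbar ^^ b) (bipoly n c)) = bipoly_deriv n c a b"
proof -
  have "(dzbar ^^ b) (bipoly n c) = bipoly_deriv n c 0 b"
    by (induction b) (simp_all add: bipoly_deriv_0_0 dzbar_eq[OF has_wirtinger_bipoly_deriv[OF c]])
  thus ?thesis
    by (induction a) (simp_all add: dz_eq[OF has_wirtinger_bipoly_deriv[OF c]])
qed

lemma polynomial_recentre:
  fixes x :: "nat \<Rightarrow> complex"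
  assumes x: "\<And>j. n \<le> j \<Longrightarrow> x j = 0"
  shows "(\<Sum>j<n. x j * (z + w) ^ j) = (\<Sum>i<n. (\<Sum>j<n. fact (j + i) / fact j * x (j + i) * z ^ j) / fact i * w ^ i)"
proof -
  let ?g = "\<lambda>i l. x (l + i) * (fact (l + i) / (fact i * fact l)) * w ^ i * z ^ l"
  have "(\<Sum>j<n. x j * (z + w) ^ j) = (\<Sum>j<n. \<Sum>i\<le>j. ?g i (j - i))"
  proof (rule sum.cong[OF refl])
    fix j
    have "x j * (z + w) ^ j = (\<Sum>i\<le>j. x j * (of_nat (j choose i) * w ^ i * z ^ (j - i)))"
      by (simp add: add.commute[of z] binomial_ring sum_distrib_left)
    also have "\<dots> = (\<Sum>i\<le>j. ?g i (j - i))"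
      by (intro sum.cong refl) (simp add: binomial_fact)
    finally show "x j * (z + w) ^ j = (\<Sum>i\<le>j. ?g i (j - i))" .
  qed
  also have "\<dots> = (\<Sum>(i, l)\<in>{(i, l). i + l < n}. ?g i l)"
    by (rule sum.triangle_reindex[symmetric])
  also have "\<dots> = (\<Sum>(i, l)\<in>{..<n} \<times> {..<n}. ?g i l)"
  proof (rule sum.mono_neutral_left)
    have "i + l < n" if "x (l + i) \<noteq> 0" for i l using x[of "l + i"] that by (metis add.commute not_less)
    thus "\<forall>y\<in>{..<n} \<times> {..<n} - {(i, l). i + l < n}. (case y of (i, l) \<Rightarrow> ?g i l) = 0" by auto
  qed auto
  also have "\<dots> = (\<Sum>i<n. \<Sum>l<n. ?g i l)" by (simp add: sum.cartesian_product)
  also have "\<dots> = (\<Sum>i<n. (\<Sum>j<n. fact (j + i) / fact j * x (j + i) * z ^ j) / fact i * w ^ i)"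
    unfolding sum_divide_distrib sum_distrib_right by (intro sum.cong refl) (simp add: field_simps)
  finally show ?thesis .
qed

text \<open>Taylor expansion in two independent variables: the one-variable formula is applied to
  the powers of \<open>z + w\<close> and then to those of the conjugate.\<close>

lemma bipoly_recentre:
  assumes c: "\<And>j k. n \<le> j \<or> n \<le> k \<Longrightarrow> c j k = 0"
  shows "bipoly n c (z + w) = bipoly n (\<lambda>j k. bipoly_deriv n c j k z / (fact j * fact k)) w"
proof -
  have "bipoly n c (z + w) = (\<Sum>j<n. (\<Sum>k<n. c j k * cnj (z + w) ^ k) * (z + w) ^ j)"
    unfolding bipoly_double_sum sum_distrib_right by (intro sum.cong refl) (simp add: algebra_simps)
  also have "\<dots> = (\<Sum>i<n. (\<Sum>j<n. fact (j + i) / fact j * (\<Sum>k<n. c (j + i) k * cnj (z + w) ^ k) * z ^ j) / fact i * w ^ i)"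
    by (rule polynomial_recentre) (simp add: c)
  also have "\<dots> = (\<Sum>i<n. (\<Sum>j<n. fact (j + i) / fact j *
       (\<Sum>l<n. (\<Sum>k<n. fact (k + l) / fact k * c (j + i) (k + l) * cnj z ^ k) / fact l * cnj w ^ l) * z ^ j) / fact i * w ^ i)"
    unfolding complex_cnj_add by (subst polynomial_recentre) (simp_all add: c)
  also have "\<dots> = (\<Sum>i<n. \<Sum>j<n. \<Sum>l<n. \<Sum>k<n. fact (j + i) / fact j * (fact (k + l) / fact k) * c (j + i) (k + l)
       * z ^ j * cnj z ^ k / (fact i * fact l) * w ^ i * cnj w ^ l)"
    unfolding sum_divide_distrib sum_distrib_left sum_distrib_right
    by (intro sum.cong refl) (simp add: field_simps)
  also have "\<dots> = (\<Sum>i<n. \<Sum>l<n. \<Sum>j<n. \<Sum>k<n. fact (j + i) / fact j * (fact (k + l) / fact k) * c (j + i) (k + l)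
       * z ^ j * cnj z ^ k / (fact i * fact l) * w ^ i * cnj w ^ l)"
    by (intro sum.cong refl sum.swap)
  also have "\<dots> = bipoly n (\<lambda>j k. bipoly_deriv n c j k z / (fact j * fact k)) w"
    unfolding bipoly_double_sum bipoly_deriv_def sum_divide_distrib sum_distrib_right by simp
  finally show ?thesis .
qed

text \<open>A derivative is again a polynomial of the same kind, with the array \<open>e\<close>, to
  which recentring applies.\<close>

lemma bipoly_deriv_recentre:
  assumes c: "\<And>j k. n \<le> j \<or> n \<le> k \<Longrightarrow> c j k = 0"
  shows "bipoly_deriv n c a b (z + w) = bipoly n (\<lambda>j k. bipoly_deriv n c (a + j) (b + k) z / (fact j * fact k)) w"
proof -
  define e where "e j k = fact (j + a) / fact j * (fact (k + b) / fact k) * c (j + a) (k + b)" for j k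
  have e0: "e j k = 0" if "n \<le> j \<or> n \<le> k" for j k
  proof -
    have "c (j + a) (k + b) = 0" by (rule c) (use that in auto)
    thus ?thesis by (simp add: e_def)
  qed
  have "bipoly_deriv n e j k z = bipoly_deriv n c (a + j) (b + k) z" for j k
    unfolding bipoly_deriv_def bipoly_def e_def
    by (intro sum.cong refl) (simp add: case_prod_unfold ac_simps)
  moreover have "bipoly_deriv n c a b (z + w) = bipoly n e (z + w)"
    unfolding bipoly_deriv_def e_def ..
  moreover have "bipoly n e (z + w) = bipoly n (\<lambda>j k. bipoly_deriv n e j k z / (fact j * fact k)) w"
    by (rule bipoly_recentre) (rule e0)
  ultimately show ?thesis by simp
qed

lemma bipoly_deriv_cnj:
  assumes "\<And>j k. c k j = cnj (c j k)"
  shows "bipoly_deriv n c b a z = cnj (bipoly_deriv n c a b z)"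
proof -
  have "cnj (bipoly_deriv n c a b z) = (\<Sum>j<n. \<Sum>k<n. fact (j + a) / fact j * (fact (k + b) / fact k) * c (k + b) (j + a) * cnj z ^ j * z ^ k)"
    unfolding bipoly_deriv_def bipoly_double_sum cnj_sum
    by (intro sum.cong refl) (simp add: assms[symmetric])
  also have "\<dots> = (\<Sum>k<n. \<Sum>j<n. fact (j + a) / fact j * (fact (k + b) / fact k) * c (k + b) (j + a) * cnj z ^ j * z ^ k)"
    by (rule sum.swap)
  also have "\<dots> = bipoly_deriv n c b a z"
    unfolding bipoly_deriv_def bipoly_double_sum by (intro sum.cong refl) (simp add: algebra_simps)
  finally show ?thesis by simp
qed

text \<open>The excess of the circle mean over the central value is \<open>\<rho>^2\<close> times
  the Taylor coefficient of bidegree (1, 1), up to higher order. Divide by \<open>\<rho>^2\<close>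
  and let the radius tend to 0.\<close>

lemma subharmonic_bipoly_ddbar_nonneg:
  assumes c: "\<And>j k. n \<le> j \<or> n \<le> k \<Longrightarrow> c j k = 0" and herm: "\<And>j k. c k j = cnj (c j k)"
    and P: "\<And>z. of_real (P z) = bipoly n c z" and sub: "subharmonic_on UNIV P"
  shows "\<exists>y\<ge>0. bipoly_deriv n c 1 1 z = of_real y"
proof (cases "n \<le> 1")
  case True
  hence "bipoly_deriv n c 1 1 z = 0" unfolding bipoly_deriv_def bipoly_def
    by (intro sum.neutral) (auto simp: c)
  thus ?thesis by (intro exI[of _ 0]) auto
next
  case False
  define \<tau> where "\<tau> j k = bipoly_deriv n c j k z / (fact j * fact k)" for j k
  define n' where "n' = n - 1"
  have n: "n = Suc n'" "n' > 0" using False by (auto simp: n'_def)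
  \<comment> \<open>The quotient as a polynomial in \<open>x\<close>, the squared radius: the
    constant term of the mean is the central value, hence the index shift.\<close>
  define f where "f x = (\<Sum>k<n'. Re (\<tau> (Suc k) (Suc k)) * x ^ k)" for x :: real
  have f_nonneg: "f (\<rho>\<^sup>2) \<ge> 0" if \<rho>: "\<rho> > 0" for \<rho>
  proof -
    have i: "(\<lambda>\<theta>. bipoly n \<tau> (of_real \<rho> * cis \<theta>)) integrable_on {0..2*pi}"
      by (intro integrable_continuous_real continuous_intros)
    have e: "P (z + w) = Re (bipoly n \<tau> w)" for w
    proof -
      have "of_real (P (z + w)) = bipoly n \<tau> w"
        unfolding P \<tau>_def[abs_def] by (rule bipoly_recentre) (rule c)
      from arg_cong[OF this, of Re] show ?thesis by simp
    qed
    have "P z \<le> 1 / (2 * pi) * integral {0..2 * pi} (\<lambda>\<theta>. P (z + of_real \<rho> * cis \<theta>))"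
      using sub \<rho> unfolding subharmonic_on_def by blast
    also have "integral {0..2 * pi} (\<lambda>\<theta>. P (z + of_real \<rho> * cis \<theta>)) = Re (integral {0..2*pi} (\<lambda>\<theta>. bipoly n \<tau> (of_real \<rho> * cis \<theta>)))"
      using integral_linear[OF i bounded_linear_Re] by (simp add: e o_def)
    also have "\<dots> = 2 * pi * (\<Sum>k<n. Re (\<tau> k k) * \<rho> ^ (2 * k))"
      unfolding bipoly_circle_mean by (simp flip: of_real_power)
    finally have "P z \<le> (\<Sum>k<n. Re (\<tau> k k) * \<rho> ^ (2 * k))" by simp
    also have "\<dots> = Re (\<tau> 0 0) + \<rho>\<^sup>2 * f (\<rho>\<^sup>2)"
    proof -
      have "\<rho> ^ (2 * Suc k) = \<rho>\<^sup>2 * (\<rho>\<^sup>2) ^ k" for k by (simp only: power_mult power_Suc)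
      thus ?thesis unfolding n(1) sum.lessThan_Suc_shift f_def sum_distrib_left
        by (simp only: mult.left_commute power_0 mult_0_right mult_1_right)
    qed
    also have "Re (\<tau> 0 0) = P z"
      using arg_cong[OF P[of z], of Re] by (simp add: \<tau>_def bipoly_deriv_0_0)
    finally have "0 \<le> \<rho>\<^sup>2 * f (\<rho>\<^sup>2)" by simp
    thus ?thesis using \<rho> by (simp add: zero_le_mult_iff)
  qed
  have "(f \<longlongrightarrow> f 0) (at_right 0)"
    unfolding f_def by (intro tendsto_intros) 
  moreover have "\<forall>\<^sub>F x in at_right 0. 0 \<le> f x"
  proof -
    have "0 \<le> f y" if "0 < y" for y using f_nonneg[of "sqrt y"] that by simp
    thus ?thesis unfolding eventually_at_right_field by (intro exI[of _ 1]) auto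
  qed
  ultimately have "0 \<le> f 0" by (intro tendsto_lowerbound[of f _ "at_right 0"]) auto
  moreover have "f 0 = Re (\<tau> 1 1)"
    unfolding f_def using n(2) by (simp add: power_0_left sum.delta if_distrib[of "\<lambda>x. _ * x"] cong: if_cong)
  ultimately have "0 \<le> Re (bipoly_deriv n c 1 1 z)" by (simp add: \<tau>_def)
  moreover have "bipoly_deriv n c 1 1 z = of_real (Re (bipoly_deriv n c 1 1 z))"
  proof -
    have "bipoly_deriv n c 1 1 z = cnj (bipoly_deriv n c 1 1 z)" by (rule bipoly_deriv_cnj[OF herm])
    thus ?thesis by (simp add: complex_eq_iff)
  qed
  ultimately show ?thesis by blast
qed

section \<open>Normalization of the model polynomial at a point\<close>

locale model_polynomial =
  fixes m :: nat and c :: "nat \<Rightarrow> nat \<Rightarrow> complex" and P :: "complex \<Rightarrow> real"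
  assumes degree: "\<And>j k. 2 * m < j + k \<Longrightarrow> c j k = 0"
    and no_harmonic: "\<And>j. c j 0 = 0" "\<And>j. c 0 j = 0"
    and hermitian: "\<And>j k. c k j = cnj (c j k)"
    and nonzero: "\<exists>j k. c j k \<noteq> 0"
    and P_eq: "\<And>z. of_real (P z) = bipoly (Suc (2 * m)) c z"
    and subharmonic: "subharmonic_on UNIV P"
begin

abbreviation D :: "nat \<Rightarrow> nat \<Rightarrow> complex \<Rightarrow> complex" where
  "D \<equiv> bipoly_deriv (Suc (2 * m)) c"

text \<open>Comparable to the reciprocal of the width \<open>tau\<close>: a minimum of inverse roots
  has become a sum of roots. With the sum, it is exactly the coefficient of \<open>|x_1|\<close> in
  the comparison metric.\<close>

definition inv_width :: "real \<Rightarrow> complex \<Rightarrow> real" where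
  "inv_width \<delta> z = (\<Sum>l = 2..2 * m. root l (mixed_derivative_max P l z / \<delta>))"

definition recentred :: "complex \<Rightarrow> nat \<Rightarrow> nat \<Rightarrow> complex" where
  "recentred z j k = D (Suc j) (Suc k) z / (fact (Suc j) * fact (Suc k))"

text \<open>The pure holomorphic Taylor terms, doubled because the real part must also account for
  their conjugates.\<close>

definition harmonic_part :: "complex \<Rightarrow> complex \<Rightarrow> complex" where
  "harmonic_part z w = 2 * (\<Sum>j<2*m. D (Suc j) 0 z / fact (Suc j) * w ^ Suc j)"

definition normalized :: "real \<Rightarrow> complex \<Rightarrow> nat \<Rightarrow> nat \<Rightarrow> complex" where
  "normalized \<delta> z j k = recentred z j k / of_real (\<delta> * inv_width \<delta> z ^ (Suc j + Suc k))"

lemma support: "Suc (2 * m) \<le> j \<or> Suc (2 * m) \<le> k \<Longrightarrow> c j k = 0"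
  by (rule degree) auto

lemma iterated_D: "(dz ^^ a) ((dzbar ^^ b) (bipoly (Suc (2 * m)) c)) = D a b"
  by (rule iterated_dz_dzbar_bipoly) (rule support)

lemma P_fun: "(\<lambda>w. complex_of_real (P w)) = bipoly (Suc (2 * m)) c"
  using P_eq by auto

lemma dz_P: "dz (\<lambda>w. complex_of_real (P w)) z = D 1 0 z"
  using iterated_D[of 1 0] unfolding P_fun by simp

lemma max_eq: "mixed_derivative_max P l z = Max {cmod (D j k z) | j k. j > 0 \<and> k > 0 \<and> j + k = l}"
  unfolding mixed_derivative_max_def P_fun iterated_D ..

lemma max_set_finite: "finite {cmod (D j k z) | j k. j > 0 \<and> k > 0 \<and> j + k = l}"
proof -
  have "{cmod (D j k z) | j k. j > 0 \<and> k > 0 \<and> j + k = l} \<subseteq> (\<lambda>(j, k). cmod (D j k z)) ` ({..l} \<times> {..l})" by auto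
  thus ?thesis by (rule finite_subset) simp
qed

lemma max_ge: "j > 0 \<Longrightarrow> k > 0 \<Longrightarrow> cmod (D j k z) \<le> mixed_derivative_max P (j + k) z"
  unfolding max_eq by (rule Max_ge[OF max_set_finite]) blast

lemma max_attained:
  assumes "2 \<le> l"
  shows "\<exists>j k. j > 0 \<and> k > 0 \<and> j + k = l \<and> mixed_derivative_max P l z = cmod (D j k z)"
proof -
  have "cmod (D 1 (l - 1) z) \<in> {cmod (D j k z) | j k. j > 0 \<and> k > 0 \<and> j + k = l}"
    using assms by (intro CollectI exI[of _ 1] exI[of _ "l - 1"]) auto
  hence "Max {cmod (D j k z) | j k. j > 0 \<and> k > 0 \<and> j + k = l} \<in> {cmod (D j k z) | j k. j > 0 \<and> k > 0 \<and> j + k = l}"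
    by (intro Max_in max_set_finite) blast
  thus ?thesis unfolding max_eq by blast
qed

lemma max_nonneg: "2 \<le> l \<Longrightarrow> 0 \<le> mixed_derivative_max P l z"
  using max_attained[of l z] by auto

text \<open>A coefficient of maximal total degree has a constant, nonzero derivative of its own
  bidegree, and this bidegree is mixed since there are no harmonic terms. So the width is finite at
  every point.\<close>

lemma max_pos: "\<exists>l\<in>{2..2*m}. 0 < mixed_derivative_max P l z"
proof -
  let ?L = "{j + k | j k. c j k \<noteq> 0}"
  have sub: "?L \<subseteq> {..2*m}" using degree not_less by auto
  have "Max ?L \<in> ?L" by (rule Max_in) (use nonzero finite_subset[OF sub] in auto)
  then obtain j0 k0 where jk: "Max ?L = j0 + k0" "c j0 k0 \<noteq> 0" by blast
  have le: "j + k \<le> j0 + k0" if "c j k \<noteq> 0" for j k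
    unfolding jk(1)[symmetric] by (rule Max_ge[OF finite_subset[OF sub]]) (use that in auto)
  have pos: "j0 > 0" "k0 > 0" using jk(2) no_harmonic by (metis gr0I)+
  have "D j0 k0 z = (\<Sum>j<Suc (2*m). \<Sum>k<Suc (2*m). if k = 0 then if j = 0 then fact j0 * fact k0 * c j0 k0 else 0 else 0)"
    unfolding bipoly_deriv_def bipoly_double_sum
  proof (intro sum.cong refl)
    fix j k
    have "c (j + j0) (k + k0) = 0" if "j \<noteq> 0 \<or> k \<noteq> 0" using le[of "j + j0" "k + k0"] that by fastforce
    thus "fact (j + j0) / fact j * (fact (k + k0) / fact k) * c (j + j0) (k + k0) * z ^ j * cnj z ^ k
      = (if k = 0 then if j = 0 then fact j0 * fact k0 * c j0 k0 else 0 else 0)" by auto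
  qed
  also have "\<dots> = fact j0 * fact k0 * c j0 k0" by (simp add: sum.delta)
  finally have "D j0 k0 z \<noteq> 0" using jk(2) by simp
  hence "0 < mixed_derivative_max P (j0 + k0) z" using max_ge[OF pos, of z] by (smt (verit) zero_less_norm_iff)
  moreover have "j0 + k0 \<in> {2..2*m}" using pos degree[of j0 k0] jk(2) by fastforce
  ultimately show ?thesis by blast
qed

lemma root_le_inv_width:
  assumes "\<delta> > 0" "l \<in> {2..2*m}"
  shows "root l (mixed_derivative_max P l z / \<delta>) \<le> inv_width \<delta> z"
  unfolding inv_width_def using assms max_nonneg by (intro member_le_sum) auto

lemma inv_width_pos:
  assumes "\<delta> > 0"
  shows "inv_width \<delta> z > 0"
proof -
  obtain l where l: "l \<in> {2..2*m}" "0 < mixed_derivative_max P l z" using max_pos by blast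
  hence "0 < root l (mixed_derivative_max P l z / \<delta>)" using assms by simp
  thus ?thesis using root_le_inv_width[OF assms l(1)] by (rule less_le_trans)
qed

text \<open>Each single root is at most the sum \<open>inv_width\<close>; raising to the power
  \<open>l\<close> gives the bound, and the factorials in the Taylor coefficients only help.\<close>

lemma normalized_le_1:
  assumes "\<delta> > 0"
  shows "cmod (normalized \<delta> z j k) \<le> 1"
proof (cases "Suc j + Suc k \<le> 2 * m")
  case True
  let ?l = "Suc j + Suc k" and ?S = "inv_width \<delta> z"
  let ?A = "mixed_derivative_max P ?l z"
  have l: "?l \<in> {2..2*m}" using True by auto
  note S = inv_width_pos[OF assms, of z]
  have A0: "?A \<ge> 0" using max_nonneg[of ?l z] by simp
  have "cmod (recentred z j k) = cmod (D (Suc j) (Suc k) z) / (fact (Suc j) * fact (Suc k))"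
    unfolding recentred_def by (simp add: norm_divide norm_mult del: fact_Suc)
  also have "\<dots> \<le> cmod (D (Suc j) (Suc k) z) / 1"
  proof (rule divide_left_mono)
    have "1 * 1 \<le> (fact (Suc j) * fact (Suc k) :: real)" by (intro mult_mono fact_ge_1) auto
    thus "1 \<le> (fact (Suc j) * fact (Suc k) :: real)" by simp
  qed auto
  also have "\<dots> \<le> ?A" using max_ge[of "Suc j" "Suc k" z] by simp
  also have "?A = \<delta> * root ?l (?A / \<delta>) ^ ?l"
    using assms A0 real_root_pow_pos2[of ?l "?A / \<delta>"] by (simp del: power_Suc)
  also have "\<dots> \<le> \<delta> * ?S ^ ?l"
    using assms A0 by (intro mult_left_mono power_mono root_le_inv_width[OF assms l]) auto
  finally have "cmod (recentred z j k) \<le> \<delta> * ?S ^ ?l" .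
  moreover have "\<delta> * ?S ^ ?l > 0" using assms S by simp
  ultimately show ?thesis
    unfolding normalized_def norm_divide norm_of_real by (simp add: divide_le_eq del: power_Suc)
next
  case False
  hence "D (Suc j) (Suc k) z = 0" by (intro bipoly_deriv_eq_0[OF degree]) auto
  thus ?thesis by (simp add: normalized_def recentred_def)
qed

text \<open>One of the fewer than \<open>2m\<close> roots is at least
  \<open>inv_width / (2m)\<close>. Raising this to a power of at most \<open>2m\<close> gives the
  first factor of the constant, the Taylor factorials give the second.\<close>

lemma normalized_large:
  assumes "\<delta> > 0"
  shows "\<exists>j<2*m. \<exists>k<2*m. 1 / (real (2*m) ^ (2*m) * (fact (2*m))\<^sup>2) \<le> cmod (normalized \<delta> z j k)"
proof -
  let ?S = "inv_width \<delta> z"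
  note S = inv_width_pos[OF assms, of z]
  obtain l0 where "l0 \<in> {2..2*m}" using max_pos by blast
  hence m: "2 \<le> 2 * m" by auto
  have "\<exists>l\<in>{2..2*m}. ?S / real (2*m) \<le> root l (mixed_derivative_max P l z / \<delta>)"
  proof (rule ccontr)
    assume "\<not> ?thesis"
    hence "(\<Sum>l = 2..2 * m. root l (mixed_derivative_max P l z / \<delta>)) < (\<Sum>l = 2..2 * m. ?S / real (2*m))"
      by (intro sum_strict_mono) (use m in \<open>auto simp: not_le\<close>)
    also have "\<dots> = real (2*m - 1) * (?S / real (2*m))" using m by simp
    also have "\<dots> \<le> real (2*m) * (?S / real (2*m))" using S by (intro mult_right_mono) auto
    also have "\<dots> = ?S" using m by simp
    finally show False by (simp add: inv_width_def)
  qed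
  then obtain l where l: "l \<in> {2..2*m}" "?S / real (2*m) \<le> root l (mixed_derivative_max P l z / \<delta>)" by blast
  obtain j k where jk: "j > 0" "k > 0" "j + k = l" "mixed_derivative_max P l z = cmod (D j k z)"
    using max_attained[of l z] l by auto
  then obtain j' k' where [simp]: "j = Suc j'" "k = Suc k'" by (metis gr0_implies_Suc)
  have "(?S / real (2*m)) ^ l \<le> root l (mixed_derivative_max P l z / \<delta>) ^ l"
    using l(2) S by (intro power_mono) auto
  also have "\<dots> = cmod (D j k z) / \<delta>" using l assms jk(4) by simp
  finally have "?S ^ l / real (2*m) ^ l \<le> cmod (D j k z) / \<delta>" by (simp add: power_divide)
  hence ge: "1 / real (2*m) ^ l \<le> cmod (D j k z) / (\<delta> * ?S ^ l)"
    using S assms by (simp add: field_simps)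
  have "j \<le> 2 * m" "k \<le> 2 * m" using l(1) jk(3) by auto
  hence f: "(fact j * fact k :: real) \<le> (fact (2*m))\<^sup>2"
    unfolding power2_eq_square by (intro mult_mono fact_mono fact_ge_zero)
  have f_pos: "(fact j * fact k :: real) > 0" by (intro mult_pos_pos fact_gt_zero)
  have "1 / (real (2*m) ^ (2*m) * (fact (2*m))\<^sup>2) = (1 / real (2*m) ^ (2*m)) * (1 / (fact (2*m))\<^sup>2)" by simp
  also have "\<dots> \<le> (1 / real (2*m) ^ l) * (1 / (fact j * fact k))"
    using l m f f_pos by (intro mult_mono divide_left_mono power_increasing) auto
  also have "\<dots> \<le> cmod (D j k z) / (\<delta> * ?S ^ l) * (1 / (fact j * fact k))"
    using ge f_pos by (intro mult_right_mono) auto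
  also have "\<dots> = cmod (normalized \<delta> z j' k')"
    unfolding normalized_def recentred_def norm_divide norm_of_real norm_mult norm_fact
    using jk(3) S assms by (simp add: abs_mult del: fact_Suc power_Suc)
  finally show ?thesis using jk l by (intro exI[of _ j'] exI[of _ k'] conjI) auto
qed

lemma mixed_poly_normalized:
  assumes "\<delta> > 0"
  shows "mixed_poly (2*m) (recentred z) w = of_real \<delta> * mixed_poly (2*m) (normalized \<delta> z) (of_real (inv_width \<delta> z) * w)"
proof -
  note S = inv_width_pos[OF assms, of z]
  show ?thesis
    unfolding mixed_poly_def case_prod_unfold sum_distrib_left
  proof (intro sum.cong refl)
    fix x
    let ?s = "complex_of_real (inv_width \<delta> z)"
    have s: "?s \<noteq> 0" "complex_of_real \<delta> \<noteq> 0" using S assms by auto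
    have "of_real \<delta> * (recentred z j k / (of_real \<delta> * ?s ^ (Suc j + Suc k)) * (?s * w) ^ Suc j * (?s * cnj w) ^ Suc k)
       = recentred z j k * w ^ Suc j * cnj w ^ Suc k" for j k
      unfolding power_add power_mult_distrib using s by (simp del: power_Suc)
    thus "recentred z (fst x) (snd x) * w ^ Suc (fst x) * cnj w ^ Suc (snd x) =
      of_real \<delta> * (normalized \<delta> z (fst x) (snd x) * (?s * w) ^ Suc (fst x) * cnj (?s * w) ^ Suc (snd x))"
      unfolding normalized_def by (simp del: power_Suc)
  qed
qed

text \<open>Harmonic terms do not affect the Laplacian, so it is that of \<open>P\<close> at
  \<open>z + w / inv_width\<close>, up to a positive factor.\<close>

lemma mixed_ddbar_normalized:
  assumes "\<delta> > 0"
  shows "\<exists>y\<ge>0. mixed_ddbar (2*m) (normalized \<delta> z) w = of_real y"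
proof -
  let ?s = "complex_of_real (inv_width \<delta> z)"
  note S = inv_width_pos[OF assms, of z]
  obtain y where y: "y \<ge> 0" "D 1 1 (z + w / ?s) = of_real y"
    using subharmonic_bipoly_ddbar_nonneg[OF support hermitian P_eq subharmonic] by blast
  have "mixed_ddbar (2*m) (normalized \<delta> z) w = of_real (1 / (\<delta> * (inv_width \<delta> z)\<^sup>2)) * D 1 1 (z + w / ?s)"
  proof -
    let ?I = "{..<2*m} \<times> {..<2*m}" and ?J = "{..<Suc (2*m)} \<times> {..<Suc (2*m)}"
    let ?f = "\<lambda>j k. D (1 + j) (1 + k) z / (fact j * fact k) * (w / ?s) ^ j * cnj (w / ?s) ^ k"
    have s: "?s \<noteq> 0" "complex_of_real \<delta> \<noteq> 0" using S assms by auto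
    have "D 1 1 (z + w / ?s) = (\<Sum>(j, k)\<in>?J. ?f j k)"
      unfolding bipoly_def[symmetric] by (rule bipoly_deriv_recentre) (rule support)
    also have "\<dots> = (\<Sum>(j, k)\<in>?I. ?f j k)"
    \<comment> \<open>An index \<open>2m\<close> in either place would belong to a derivative of
      total order above the degree, so the range shrinks by one.\<close>
    proof (rule sum.mono_neutral_right)
      have "D (1 + j) (1 + k) z = 0" if "2 * m \<le> j \<or> 2 * m \<le> k" for j k
        by (rule bipoly_deriv_eq_0[OF degree]) (use that in auto)
      hence "?f j k = 0" if "2 * m \<le> j \<or> 2 * m \<le> k" for j k using that by simp
      moreover have "2 * m \<le> fst x \<or> 2 * m \<le> snd x" if "x \<in> ?J - ?I" for x using that by auto
      ultimately show "\<forall>x\<in>?J - ?I. (case x of (j, k) \<Rightarrow> ?f j k) = 0"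
        unfolding case_prod_unfold by blast
    qed auto
    finally have "of_real (1 / (\<delta> * (inv_width \<delta> z)\<^sup>2)) * D 1 1 (z + w / ?s)
      = (\<Sum>x\<in>?I. of_real (1 / (\<delta> * (inv_width \<delta> z)\<^sup>2)) * ?f (fst x) (snd x))"
      by (simp add: sum_distrib_left case_prod_unfold)
    also have "\<dots> = mixed_ddbar (2*m) (normalized \<delta> z) w"
      unfolding mixed_ddbar_def bipoly_def case_prod_unfold
    proof (intro sum.cong refl)
      fix x
      have f: "(fact (Suc i) :: complex) = of_nat (Suc i) * fact i" "of_nat (Suc i) \<noteq> (0::complex)" for i
        by (simp_all del: of_nat_Suc)
      have p: "?s ^ (Suc j + Suc k) = ?s\<^sup>2 * ?s ^ j * ?s ^ k" for j k by (simp add: power_add power2_eq_square)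
      have "of_real (1 / (\<delta> * (inv_width \<delta> z)\<^sup>2)) * ?f j k
        = of_nat (Suc j) * of_nat (Suc k) * normalized \<delta> z j k * w ^ j * cnj w ^ k" for j k
        unfolding normalized_def recentred_def of_real_mult of_real_power p f(1) of_real_divide
        using s f(2) by (simp add: power_divide field_simps del: of_nat_Suc fact_Suc)
      thus "of_real (1 / (\<delta> * (inv_width \<delta> z)\<^sup>2)) * ?f (fst x) (snd x)
        = of_nat (Suc (fst x)) * of_nat (Suc (snd x)) * normalized \<delta> z (fst x) (snd x) * w ^ fst x * cnj w ^ snd x" .
    qed
    finally show ?thesis by simp
  qed
  also have "\<dots> = of_real (1 / (\<delta> * (inv_width \<delta> z)\<^sup>2) * y)" using y by simp
  finally show ?thesis using y assms S by (intro exI[of _ "1 / (\<delta> * (inv_width \<delta> z)\<^sup>2) * y"]) auto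
qed

text \<open>Hermitian symmetry makes the antiholomorphic Taylor terms conjugate to the holomorphic
  ones, so together they are the real part of one holomorphic function.\<close>

lemma P_recentre: "P (z + w) = P z + Re (harmonic_part z w) + Re (mixed_poly (2*m) (recentred z) w)"
proof -
  define \<tau> where "\<tau> j k = D j k z / (fact j * fact k)" for j k
  have "of_real (P (z + w)) = bipoly (Suc (2*m)) \<tau> w"
    unfolding P_eq \<tau>_def[abs_def] by (rule bipoly_recentre) (rule support)
  also have "\<dots> = \<tau> 0 0 + (\<Sum>k<2*m. \<tau> 0 (Suc k) * cnj w ^ Suc k) + (\<Sum>j<2*m. \<tau> (Suc j) 0 * w ^ Suc j)
      + (\<Sum>j<2*m. \<Sum>k<2*m. \<tau> (Suc j) (Suc k) * w ^ Suc j * cnj w ^ Suc k)"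
    unfolding bipoly_double_sum sum.lessThan_Suc_shift by (simp add: sum.distrib del: power_Suc)
  also have "\<tau> 0 0 = of_real (P z)" by (simp add: \<tau>_def bipoly_deriv_0_0 P_eq)
  also have "(\<Sum>k<2*m. \<tau> 0 (Suc k) * cnj w ^ Suc k) = cnj (\<Sum>j<2*m. \<tau> (Suc j) 0 * w ^ Suc j)"
    unfolding cnj_sum \<tau>_def
    by (intro sum.cong refl) (simp add: bipoly_deriv_cnj[OF hermitian, where b = 0] del: fact_Suc power_Suc)
  also have "(\<Sum>j<2*m. \<Sum>k<2*m. \<tau> (Suc j) (Suc k) * w ^ Suc j * cnj w ^ Suc k) = mixed_poly (2*m) (recentred z) w"
    unfolding mixed_poly_def \<tau>_def recentred_def by (simp add: sum.cartesian_product del: fact_Suc power_Suc)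
  also have "(\<Sum>j<2*m. \<tau> (Suc j) 0 * w ^ Suc j) = harmonic_part z w / 2"
    unfolding harmonic_part_def \<tau>_def by simp
  finally have "of_real (P (z + w)) = of_real (P z) + cnj (harmonic_part z w / 2) + harmonic_part z w / 2
     + mixed_poly (2*m) (recentred z) w" .
  from arg_cong[OF this, of Re] show ?thesis by simp
qed

end

section \<open>The Kobayashi metric of the model domain\<close>

no_notation fps_nth (infixl "$" 75)

context model_polynomial
begin

lemma m_pos: "0 < 2 * m"
  using max_pos[of 0] by auto

lemma harmonic_part_0 [simp]: "harmonic_part z 0 = 0"
  by (simp add: harmonic_part_def)

lemma harmonic_part_deriv: "(harmonic_part z has_field_derivative 2 * D 1 0 z) (at 0)"
proof -
  have "(harmonic_part z has_field_derivative
     2 * (\<Sum>j<2*m. D (Suc j) 0 z / fact (Suc j) * (of_nat (Suc j) * 0 ^ j))) (at 0)"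
    unfolding harmonic_part_def[abs_def]
    by (auto intro!: derivative_eq_intros simp del: fact_Suc power_Suc of_nat_Suc)
       (simp add: mult.commute del: fact_Suc power_Suc of_nat_Suc)
  moreover have "(\<Sum>j<2*m. D (Suc j) 0 z / fact (Suc j) * (of_nat (Suc j) * 0 ^ j)) = D 1 0 z"
  proof -
    obtain d where d: "2 * m = Suc d" using m_pos by (cases "2 * m") auto
    show ?thesis unfolding d by (subst sum.lessThan_Suc_shift) simp
  qed
  ultimately show ?thesis by simp
qed

lemma holomorphic_harmonic_part [holomorphic_intros]:
  "f holomorphic_on S \<Longrightarrow> (\<lambda>t. harmonic_part z (f t)) holomorphic_on S"
  unfolding harmonic_part_def by (intro holomorphic_intros) auto

text \<open>The first component of the normalizing map at \<open>z\<close>. It absorbs the harmonic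
  part of \<open>P\<close> and the linear terms of the squares \<open>|\<zeta>_\<alpha>|^2\<close>
  about \<open>z\<close>; the final \<open>- 1\<close> places \<open>z\<close> at -1.\<close>

definition normal_coord :: "'n::finite \<Rightarrow> 'n \<Rightarrow> complex^'n \<Rightarrow> complex^'n \<Rightarrow> complex" where
  "normal_coord i0 i1 z \<zeta> = (\<zeta> $ i0 - z $ i0 + harmonic_part (z $ i1) (\<zeta> $ i1 - z $ i1)
     + 2 * (\<Sum>\<alpha>\<in>- {i0, i1}. cnj (z $ \<alpha>) * (\<zeta> $ \<alpha> - z $ \<alpha>))) / of_real (- rP i0 i1 P z) - 1"

lemma rP_normalized:
  assumes z: "rP i0 i1 P z < 0"
  shows "rP i0 i1 P \<zeta> = - rP i0 i1 P z * (Re (normal_coord i0 i1 z \<zeta>)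
      + Re (mixed_poly (2*m) (normalized (- rP i0 i1 P z) (z $ i1))
              (of_real (inv_width (- rP i0 i1 P z) (z $ i1)) * (\<zeta> $ i1 - z $ i1)))
      + (\<Sum>\<alpha>\<in>- {i0, i1}. (cmod ((\<zeta> $ \<alpha> - z $ \<alpha>) / of_real (sqrt (- rP i0 i1 P z))))\<^sup>2))"
proof -
  define \<delta> where "\<delta> = - rP i0 i1 P z"
  have \<delta>: "\<delta> > 0" using z by (simp add: \<delta>_def)
  let ?I = "- {i0, i1}"
  define N where "N = \<zeta> $ i0 - z $ i0 + harmonic_part (z $ i1) (\<zeta> $ i1 - z $ i1)
     + 2 * (\<Sum>\<alpha>\<in>?I. cnj (z $ \<alpha>) * (\<zeta> $ \<alpha> - z $ \<alpha>))"
  have sq: "(cmod b)\<^sup>2 = (cmod a)\<^sup>2 + 2 * Re (cnj a * (b - a)) + (cmod (b - a))\<^sup>2" for a b :: complex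
    unfolding cmod_power2 by (simp add: power2_eq_square algebra_simps)
  have "(\<Sum>\<alpha>\<in>?I. (cmod (\<zeta> $ \<alpha>))\<^sup>2) = (\<Sum>\<alpha>\<in>?I. (cmod (z $ \<alpha>))\<^sup>2)
     + Re (2 * (\<Sum>\<alpha>\<in>?I. cnj (z $ \<alpha>) * (\<zeta> $ \<alpha> - z $ \<alpha>))) + (\<Sum>\<alpha>\<in>?I. (cmod (\<zeta> $ \<alpha> - z $ \<alpha>))\<^sup>2)"
  proof -
    have "(\<Sum>\<alpha>\<in>?I. (cmod (\<zeta> $ \<alpha>))\<^sup>2) = (\<Sum>\<alpha>\<in>?I. (cmod (z $ \<alpha>))\<^sup>2
      + 2 * Re (cnj (z $ \<alpha>) * (\<zeta> $ \<alpha> - z $ \<alpha>)) + (cmod (\<zeta> $ \<alpha> - z $ \<alpha>))\<^sup>2)"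
      by (intro sum.cong refl sq)
    moreover have "Re (2 * (\<Sum>\<alpha>\<in>?I. cnj (z $ \<alpha>) * (\<zeta> $ \<alpha> - z $ \<alpha>)))
      = (\<Sum>\<alpha>\<in>?I. 2 * Re (cnj (z $ \<alpha>) * (\<zeta> $ \<alpha> - z $ \<alpha>)))"
      by (simp only: sum_distrib_left Re_sum) simp
    ultimately show ?thesis by (simp only: sum.distrib)
  qed
  moreover have "P (\<zeta> $ i1) = P (z $ i1) + Re (harmonic_part (z $ i1) (\<zeta> $ i1 - z $ i1))
     + Re (mixed_poly (2*m) (recentred (z $ i1)) (\<zeta> $ i1 - z $ i1))"
    using P_recentre[of "z $ i1" "\<zeta> $ i1 - z $ i1"] by simp
  ultimately have "rP i0 i1 P \<zeta> = rP i0 i1 P z + Re N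
     + Re (mixed_poly (2*m) (recentred (z $ i1)) (\<zeta> $ i1 - z $ i1)) + (\<Sum>\<alpha>\<in>?I. (cmod (\<zeta> $ \<alpha> - z $ \<alpha>))\<^sup>2)"
    unfolding rP_def N_def by simp
  also have "rP i0 i1 P z + Re N = \<delta> * Re (normal_coord i0 i1 z \<zeta>)"
    unfolding normal_coord_def N_def[symmetric] \<delta>_def[symmetric] using \<delta> by (simp add: algebra_simps \<delta>_def)
  also have "Re (mixed_poly (2*m) (recentred (z $ i1)) (\<zeta> $ i1 - z $ i1))
     = \<delta> * Re (mixed_poly (2*m) (normalized \<delta> (z $ i1)) (of_real (inv_width \<delta> (z $ i1)) * (\<zeta> $ i1 - z $ i1)))"
    unfolding mixed_poly_normalized[OF \<delta>] by simp
  also have "(\<Sum>\<alpha>\<in>?I. (cmod (\<zeta> $ \<alpha> - z $ \<alpha>))\<^sup>2) = \<delta> * (\<Sum>\<alpha>\<in>?I. (cmod ((\<zeta> $ \<alpha> - z $ \<alpha>) / of_real (sqrt \<delta>)))\<^sup>2)"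
    unfolding sum_distrib_left norm_divide power_divide using \<delta> by simp
  finally show ?thesis unfolding \<delta>_def[symmetric] by (simp add: distrib_left)
qed

text \<open>The three parts are the moduli of the components of the differential of the normalizing
  map at \<open>z\<close>, applied to \<open>X\<close>.\<close>

lemma M_metric_eq:
  assumes z: "rP i0 i1 P z < 0"
  shows "M_metric i0 i1 m P z X =
     cmod ((X $ i0 + 2 * D 1 0 (z $ i1) * X $ i1 + 2 * (\<Sum>\<alpha>\<in>- {i0, i1}. cnj (z $ \<alpha>) * X $ \<alpha>)) / of_real (- rP i0 i1 P z))
     + cmod (of_real (inv_width (- rP i0 i1 P z) (z $ i1)) * X $ i1)
     + (\<Sum>\<alpha>\<in>- {i0, i1}. cmod (X $ \<alpha> / of_real (sqrt (- rP i0 i1 P z))))"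
proof -
  have a: "(\<Sum>l = 2..2 * m. root l \<bar>mixed_derivative_max P l (z $ i1) / rP i0 i1 P z\<bar>)
      = inv_width (- rP i0 i1 P z) (z $ i1)"
    unfolding inv_width_def
  proof (intro sum.cong refl)
    fix l assume "l \<in> {2..2*m}"
    hence "0 \<le> mixed_derivative_max P l (z $ i1)" using max_nonneg by simp
    hence "\<bar>mixed_derivative_max P l (z $ i1) / rP i0 i1 P z\<bar> = mixed_derivative_max P l (z $ i1) / (- rP i0 i1 P z)"
      using z by (simp only: abs_divide abs_of_nonneg abs_of_neg)
    thus "root l \<bar>mixed_derivative_max P l (z $ i1) / rP i0 i1 P z\<bar> = root l (mixed_derivative_max P l (z $ i1) / (- rP i0 i1 P z))"
      by (simp only:)
  qed
  have pos: "inv_width (- rP i0 i1 P z) (z $ i1) > 0" by (rule inv_width_pos) (use z in simp)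
  define W where "W = X $ i0 + 2 * D 1 0 (z $ i1) * X $ i1 + 2 * (\<Sum>\<alpha>\<in>- {i0, i1}. cnj (z $ \<alpha>) * X $ \<alpha>)"
  have w: "X $ i0 + 2 * X $ i1 * D 1 0 (z $ i1) + 2 * (\<Sum>\<alpha>\<in>- {i0, i1}. X $ \<alpha> * cnj (z $ \<alpha>)) = W"
    unfolding W_def by (simp only: mult.assoc mult.commute[of "X $ _"])
  show ?thesis
    unfolding M_metric_def dz_P w a W_def[symmetric] using z pos
    by (simp add: norm_divide norm_mult)
qed

lemma M_metric_nonneg: "rP i0 i1 P z < 0 \<Longrightarrow> 0 \<le> M_metric i0 i1 m P z X"
  unfolding M_metric_eq by (intro add_nonneg_nonneg sum_nonneg) auto

lemma M_metric_scale:
  assumes z: "rP i0 i1 P z < 0"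
  shows "M_metric i0 i1 m P z (a *s X) = cmod a * M_metric i0 i1 m P z X"
proof -
  define W where "W = X $ i0 + 2 * D 1 0 (z $ i1) * X $ i1 + 2 * (\<Sum>\<alpha>\<in>- {i0, i1}. cnj (z $ \<alpha>) * X $ \<alpha>)"
  have e: "(a *s X) $ i0 + 2 * D 1 0 (z $ i1) * (a *s X) $ i1 + 2 * (\<Sum>\<alpha>\<in>- {i0, i1}. cnj (z $ \<alpha>) * (a *s X) $ \<alpha>)
     = a * W"
    by (simp add: W_def sum_distrib_left algebra_simps)
  show ?thesis
    unfolding M_metric_eq[OF z] e W_def[symmetric]
    by (simp add: norm_mult norm_divide sum_distrib_left algebra_simps)
qed

text \<open>In normalized coordinates the disc is affine through \<open>(-1, 0, 0)\<close>. A short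
  velocity keeps it inside, because the normalized polynomial has coefficients at most 1.\<close>

lemma ex_disc:
  fixes i0 i1 :: "'n::finite"
  assumes i: "i0 \<noteq> i1" and z: "rP i0 i1 P z < 0"
    and v: "M_metric i0 i1 m P z v \<le> 1 / real (4 * m * m + CARD('n) + 2)"
  shows "\<exists>f. holomorphic_curve_on f (ball 0 1) \<and> f ` ball 0 1 \<subseteq> limit_domain i0 i1 P \<and> f 0 = z \<and>
     (\<forall>i. deriv (\<lambda>t. f t $ i) 0 = v $ i)"
proof -
  let ?I = "- {i0, i1}"
  define \<delta> where "\<delta> = - rP i0 i1 P z"
  have \<delta>: "\<delta> > 0" using z by (simp add: \<delta>_def)
  define h where "h = harmonic_part (z $ i1)"
  \<comment> \<open>Subtracting \<open>h\<close> cancels the harmonic part in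
    \<open>normal_coord\<close>; its linear part is added back so that the derivative at 0 is still
    \<open>v\<close>.\<close>
  define f where "f t = (\<chi> i. if i = i0 then z $ i0 + t * v $ i0 + 2 * D 1 0 (z $ i1) * (t * v $ i1) - h (t * v $ i1)
     else z $ i + t * v $ i)" for t
  define Y where "Y = (v $ i0 + 2 * D 1 0 (z $ i1) * v $ i1 + 2 * (\<Sum>\<alpha>\<in>?I. cnj (z $ \<alpha>) * v $ \<alpha>)) / of_real \<delta>"
  define Y1 where "Y1 = of_real (inv_width \<delta> (z $ i1)) * v $ i1"
  define Ya where "Ya \<alpha> = v $ \<alpha> / of_real (sqrt \<delta>)" for \<alpha>
  \<comment> \<open>The linear term, the polynomial and the squares contribute at most
    \<open>c0\<close>, \<open>4 m^2 c0\<close> and \<open>CARD('n) c0\<close>. The summand 2 leaves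
    a margin of \<open>c0\<close> below 1.\<close>
  define c0 where "c0 = 1 / real (4 * m * m + CARD('n) + 2)"
  have c0: "0 < c0" "c0 \<le> 1"
  proof -
    have "1 \<le> real k" "0 < 1 / real k" "1 / real k \<le> 1" if "k \<ge> 1" for k using that by simp_all
    from this[of "4 * m * m + CARD('n) + 2"] show "0 < c0" "c0 \<le> 1" unfolding c0_def by simp_all
  qed
  have sum: "cmod Y + cmod Y1 + (\<Sum>\<alpha>\<in>?I. cmod (Ya \<alpha>)) \<le> c0"
    using v unfolding M_metric_eq[OF z] \<delta>_def[symmetric] Y_def Y1_def Ya_def c0_def by simp
  have sI: "(\<Sum>\<alpha>\<in>?I. cmod (Ya \<alpha>)) \<ge> 0" by (intro sum_nonneg) auto
  have Y: "cmod Y \<le> c0" "cmod Y1 \<le> c0" using sum sI norm_ge_zero[of Y] norm_ge_zero[of Y1] by linarith+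
  have Ya: "cmod (Ya \<alpha>) \<le> c0" if "\<alpha> \<in> ?I" for \<alpha>
  proof -
    have "cmod (Ya \<alpha>) \<le> (\<Sum>\<alpha>\<in>?I. cmod (Ya \<alpha>))" by (rule member_le_sum[OF that]) auto
    thus ?thesis using sum norm_ge_zero[of Y] norm_ge_zero[of Y1] by linarith
  qed
  have f0: "f t $ i0 = z $ i0 + t * v $ i0 + 2 * D 1 0 (z $ i1) * (t * v $ i1) - h (t * v $ i1)" for t
    by (simp add: f_def)
  have fi: "f t $ i = z $ i + t * v $ i" if "i \<noteq> i0" for t i using that by (simp add: f_def)
  have "holomorphic_curve_on f (ball 0 1)"
    unfolding holomorphic_curve_on_def
  proof
    fix j show "(\<lambda>t. f t $ j) holomorphic_on ball 0 1"
      by (cases "j = i0") (auto simp: f0 fi h_def intro!: holomorphic_intros)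
  qed
  moreover have "f t \<in> limit_domain i0 i1 P" if t: "t \<in> ball 0 1" for t
  proof -
    have t1: "cmod t < 1" using t by simp
    have "normal_coord i0 i1 z (f t) = (t * v $ i0 + 2 * D 1 0 (z $ i1) * (t * v $ i1)
       + 2 * (\<Sum>\<alpha>\<in>?I. cnj (z $ \<alpha>) * (t * v $ \<alpha>))) / of_real \<delta> - 1"
    proof -
      have "(\<Sum>\<alpha>\<in>?I. cnj (z $ \<alpha>) * (f t $ \<alpha> - z $ \<alpha>)) = (\<Sum>\<alpha>\<in>?I. cnj (z $ \<alpha>) * (t * v $ \<alpha>))"
        by (intro sum.cong refl) (simp add: fi)
      thus ?thesis unfolding normal_coord_def \<delta>_def using i by (simp add: f0 fi h_def)
    qed
    also have "\<dots> = t * Y - 1"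
      unfolding Y_def by (simp add: sum_distrib_left algebra_simps)
    finally have n0: "normal_coord i0 i1 z (f t) = t * Y - 1" .
    have n1: "of_real (inv_width \<delta> (z $ i1)) * (f t $ i1 - z $ i1) = t * Y1"
      using i by (simp add: fi Y1_def)
    have na: "(f t $ \<alpha> - z $ \<alpha>) / of_real (sqrt \<delta>) = t * Ya \<alpha>" if "\<alpha> \<in> ?I" for \<alpha>
      using that by (simp add: fi Ya_def)
    have tc: "cmod (t * y) \<le> c0" if "cmod y \<le> c0" for y
      using mult_mono[of "cmod t" 1 "cmod y" c0] t1 that c0 by (simp add: norm_mult)
    have tc2: "(cmod (t * y))\<^sup>2 \<le> c0" if "cmod y \<le> c0" for y
    proof -
      have "(cmod (t * y))\<^sup>2 \<le> c0\<^sup>2" using tc[OF that] by (intro power_mono) auto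
      also have "\<dots> \<le> c0" using c0 by (simp add: power2_eq_square mult_left_le)
      finally show ?thesis .
    qed
    have "Re (t * Y) \<le> c0" using tc[OF Y(1)] complex_Re_le_cmod[of "t * Y"] by linarith
    moreover have "Re (mixed_poly (2*m) (normalized \<delta> (z $ i1)) (t * Y1)) \<le> real (2*m * (2*m)) * c0"
    proof -
      have "cmod (mixed_poly (2*m) (normalized \<delta> (z $ i1)) (t * Y1)) \<le> real (2*m * (2*m)) * (cmod (t * Y1))\<^sup>2"
        by (rule norm_mixed_poly_le) (use normalized_le_1[OF \<delta>] tc[OF Y(2)] c0 in auto)
      also have "\<dots> \<le> real (2*m * (2*m)) * c0" using tc2[OF Y(2)] by (intro mult_left_mono) auto
      finally show ?thesis using complex_Re_le_cmod order_trans by blast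
    qed
    moreover have "(\<Sum>\<alpha>\<in>?I. (cmod ((f t $ \<alpha> - z $ \<alpha>) / of_real (sqrt \<delta>)))\<^sup>2) \<le> real CARD('n) * c0"
    proof -
      have "(\<Sum>\<alpha>\<in>?I. (cmod ((f t $ \<alpha> - z $ \<alpha>) / of_real (sqrt \<delta>)))\<^sup>2) \<le> (\<Sum>\<alpha>\<in>?I. c0)"
        by (intro sum_mono) (use na tc2[OF Ya] in auto)
      also have "\<dots> = real (card ?I) * c0" by simp
      also have "\<dots> \<le> real CARD('n) * c0" using c0 by (intro mult_right_mono) (auto intro: card_mono)
      finally show ?thesis .
    qed
    moreover have "c0 + real (2*m * (2*m)) * c0 + real CARD('n) * c0 < 1"
    proof -
      have "c0 * real (4 * m * m + CARD('n) + 2) = 1" using c0(1) unfolding c0_def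
        by (simp only: zero_less_divide_1_iff) simp
      thus ?thesis using c0 by (simp add: algebra_simps)
    qed
    ultimately have "Re (normal_coord i0 i1 z (f t)) + Re (mixed_poly (2*m) (normalized \<delta> (z $ i1))
              (of_real (inv_width \<delta> (z $ i1)) * (f t $ i1 - z $ i1)))
      + (\<Sum>\<alpha>\<in>?I. (cmod ((f t $ \<alpha> - z $ \<alpha>) / of_real (sqrt \<delta>)))\<^sup>2) < 0"
      unfolding n0 n1 by simp
    hence "rP i0 i1 P (f t) < 0"
      unfolding rP_normalized[OF z, of "f t"] \<delta>_def[symmetric] using \<delta> by (simp add: mult_pos_neg)
    thus ?thesis by (simp add: limit_domain_def)
  qed
  moreover have "f 0 = z" by (simp add: f_def vec_eq_iff h_def)
  moreover have "deriv (\<lambda>t. f t $ j) 0 = v $ j" for j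
  proof (cases "j = i0")
    case True
    have "((\<lambda>t. t * v $ i1) has_field_derivative v $ i1) (at 0)" by (auto intro!: derivative_eq_intros)
    moreover have "(h has_field_derivative 2 * D 1 0 (z $ i1)) (at (0 * v $ i1))"
      unfolding h_def using harmonic_part_deriv by simp
    ultimately have "((\<lambda>t. h (t * v $ i1)) has_field_derivative 2 * D 1 0 (z $ i1) * v $ i1) (at 0)"
      using DERIV_chain2[of h _ "\<lambda>t. t * v $ i1" 0] by blast
    hence "((\<lambda>t. z $ i0 + t * v $ i0 + 2 * D 1 0 (z $ i1) * (t * v $ i1) - h (t * v $ i1))
       has_field_derivative v $ i0) (at 0)"
      by (auto intro!: derivative_eq_intros)
    thus ?thesis using True by (simp add: f0 DERIV_imp_deriv)
  next
    case False
    have "((\<lambda>t. z $ j + t * v $ j) has_field_derivative v $ j) (at 0)" by (auto intro!: derivative_eq_intros)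
    thus ?thesis using False by (simp add: fi DERIV_imp_deriv)
  qed
  ultimately show ?thesis by blast
qed

text \<open>The disc is pushed forward by the normalizing map at its centre. The uniform bound then
  holds for each component of the derivative, and \<open>M_metric\<close> is the sum of their
  moduli.\<close>

lemma disc_derivative_bound:
  fixes i0 i1 :: "'n::finite"
  assumes i: "i0 \<noteq> i1"
  shows "\<exists>C\<ge>1. \<forall>z X l f. rP i0 i1 P z < 0 \<longrightarrow> holomorphic_curve_on f (ball 0 1) \<longrightarrow>
     f ` ball 0 1 \<subseteq> limit_domain i0 i1 P \<longrightarrow> f 0 = z \<longrightarrow> (\<forall>i. deriv (\<lambda>t. f t $ i) 0 * l = X $ i) \<longrightarrow>
     M_metric i0 i1 m P z X \<le> C * cmod l"
proof -
  let ?I = "- {i0, i1}"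
  define \<eta> where "\<eta> = 1 / (real (2*m) ^ (2*m) * (fact (2*m))\<^sup>2)"
  have \<eta>: "\<eta> > 0" unfolding \<eta>_def using m_pos by simp
  obtain C where C: "C \<ge> 2" "\<And>p g0 g1 (g :: 'n \<Rightarrow> complex \<Rightarrow> complex) I.
     \<lbrakk>\<forall>j<2*m. \<forall>k<2*m. cmod (p j k) \<le> 1; \<exists>j<2*m. \<exists>k<2*m. \<eta> \<le> cmod (p j k);
     \<forall>w. \<exists>y\<ge>0. mixed_ddbar (2*m) p w = of_real y; finite I;
     g0 holomorphic_on ball 0 1; g1 holomorphic_on ball 0 1; \<forall>\<alpha>\<in>I. g \<alpha> holomorphic_on ball 0 1;
     g0 0 = -1; g1 0 = 0; \<forall>\<alpha>\<in>I. g \<alpha> 0 = 0;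
     \<forall>t\<in>ball 0 1. Re (g0 t) + Re (mixed_poly (2*m) p (g1 t)) + (\<Sum>\<alpha>\<in>I. (cmod (g \<alpha> t))\<^sup>2) < 0\<rbrakk> \<Longrightarrow>
     cmod (deriv g0 0) \<le> C \<and> cmod (deriv g1 0) \<le> C \<and> (\<forall>\<alpha>\<in>I. cmod (deriv (g \<alpha>) 0) \<le> C)"
    using normalized_disc_derivative_bound[OF \<eta>, of "2*m", where 'i = 'n] by blast
  have "M_metric i0 i1 m P z X \<le> (2 + real (card ?I)) * C * cmod l"
    if z: "rP i0 i1 P z < 0" and f: "holomorphic_curve_on f (ball 0 1)"
      "f ` ball 0 1 \<subseteq> limit_domain i0 i1 P" "f 0 = z" and l: "\<forall>i. deriv (\<lambda>t. f t $ i) 0 * l = X $ i"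
    for z X l f
  proof -
    define \<delta> where "\<delta> = - rP i0 i1 P z"
    have \<delta>: "\<delta> > 0" using z by (simp add: \<delta>_def)
    let ?S = "inv_width \<delta> (z $ i1)"
    define g0 where "g0 t = normal_coord i0 i1 z (f t)" for t
    define g1 where "g1 t = of_real ?S * (f t $ i1 - z $ i1)" for t
    define g where "g \<alpha> t = (f t $ \<alpha> - z $ \<alpha>) / of_real (sqrt \<delta>)" for \<alpha> t
    define f' where "f' j = deriv (\<lambda>t. f t $ j) 0" for j
    have hol: "(\<lambda>t. f t $ j) holomorphic_on ball 0 1" for j
      using f(1) by (simp add: holomorphic_curve_on_def)
    have d: "((\<lambda>t. f t $ j) has_field_derivative f' j) (at 0)" for j
      unfolding f'_def by (rule holomorphic_derivI[OF hol]) auto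
    have bounds: "cmod (deriv g0 0) \<le> C \<and> cmod (deriv g1 0) \<le> C \<and> (\<forall>\<alpha>\<in>?I. cmod (deriv (g \<alpha>) 0) \<le> C)"
    proof (rule C(2))
      show "\<forall>j<2*m. \<forall>k<2*m. cmod (normalized \<delta> (z $ i1) j k) \<le> 1" using normalized_le_1[OF \<delta>] by blast
      show "\<exists>j<2*m. \<exists>k<2*m. \<eta> \<le> cmod (normalized \<delta> (z $ i1) j k)"
        unfolding \<eta>_def by (rule normalized_large[OF \<delta>])
      show "\<forall>w. \<exists>y\<ge>0. mixed_ddbar (2*m) (normalized \<delta> (z $ i1)) w = of_real y"
        using mixed_ddbar_normalized[OF \<delta>] by blast
      show "g0 holomorphic_on ball 0 1" unfolding g0_def normal_coord_def
        using \<delta> by (intro holomorphic_intros hol) (auto simp: \<delta>_def)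
      show "g1 holomorphic_on ball 0 1" unfolding g1_def by (intro holomorphic_intros hol)
      show "\<forall>\<alpha>\<in>?I. g \<alpha> holomorphic_on ball 0 1" unfolding g_def
        using \<delta> by (intro ballI holomorphic_intros hol) auto
      show "g0 0 = -1" "g1 0 = 0" "\<forall>\<alpha>\<in>?I. g \<alpha> 0 = 0"
        by (simp_all add: g0_def g1_def g_def normal_coord_def f(3))
      show "\<forall>t\<in>ball 0 1. Re (g0 t) + Re (mixed_poly (2*m) (normalized \<delta> (z $ i1)) (g1 t)) + (\<Sum>\<alpha>\<in>?I. (cmod (g \<alpha> t))\<^sup>2) < 0"
      proof
        fix t :: complex assume "t \<in> ball 0 1"
        hence "f t \<in> limit_domain i0 i1 P" using f(2) by blast
        hence "rP i0 i1 P (f t) < 0" by (simp add: limit_domain_def)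
        hence "\<delta> * (Re (g0 t) + Re (mixed_poly (2*m) (normalized \<delta> (z $ i1)) (g1 t)) + (\<Sum>\<alpha>\<in>?I. (cmod (g \<alpha> t))\<^sup>2)) < 0"
          unfolding rP_normalized[OF z, of "f t"] \<delta>_def[symmetric] g0_def g1_def g_def .
        thus "Re (g0 t) + Re (mixed_poly (2*m) (normalized \<delta> (z $ i1)) (g1 t)) + (\<Sum>\<alpha>\<in>?I. (cmod (g \<alpha> t))\<^sup>2) < 0"
          using \<delta> by (simp add: mult_less_0_iff)
      qed
    qed simp
    have d0: "deriv g0 0 = (f' i0 + 2 * D 1 0 (z $ i1) * f' i1 + 2 * (\<Sum>\<alpha>\<in>?I. cnj (z $ \<alpha>) * f' \<alpha>)) / of_real \<delta>"
    proof (rule DERIV_imp_deriv)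
      have "((\<lambda>t. f t $ i1 - z $ i1) has_field_derivative f' i1) (at 0)"
        using d[of i1] by (auto intro!: derivative_eq_intros)
      moreover have "(harmonic_part (z $ i1) has_field_derivative 2 * D 1 0 (z $ i1)) (at (f 0 $ i1 - z $ i1))"
        using harmonic_part_deriv f(3) by simp
      ultimately have h: "((\<lambda>t. harmonic_part (z $ i1) (f t $ i1 - z $ i1)) has_field_derivative 2 * D 1 0 (z $ i1) * f' i1) (at 0)"
        using DERIV_chain2[of "harmonic_part (z $ i1)" _ "\<lambda>t. f t $ i1 - z $ i1" 0] by blast
      have s: "((\<lambda>t. \<Sum>\<alpha>\<in>?I. cnj (z $ \<alpha>) * (f t $ \<alpha> - z $ \<alpha>)) has_field_derivative (\<Sum>\<alpha>\<in>?I. cnj (z $ \<alpha>) * f' \<alpha>)) (at 0)"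
        by (intro DERIV_sum) (auto intro!: derivative_eq_intros d)
      show "(g0 has_field_derivative (f' i0 + 2 * D 1 0 (z $ i1) * f' i1 + 2 * (\<Sum>\<alpha>\<in>?I. cnj (z $ \<alpha>) * f' \<alpha>)) / of_real \<delta>) (at 0)"
        unfolding g0_def[abs_def] normal_coord_def \<delta>_def[symmetric]
        using \<delta> by (auto intro!: derivative_eq_intros d h s simp: mult.commute)
    qed
    have d1: "deriv g1 0 = of_real ?S * f' i1"
      unfolding g1_def[abs_def] by (rule DERIV_imp_deriv) (auto intro!: derivative_eq_intros d)
    have da: "deriv (g \<alpha>) 0 = f' \<alpha> / of_real (sqrt \<delta>)" for \<alpha>
      unfolding g_def[abs_def] by (rule DERIV_imp_deriv) (use \<delta> in \<open>auto intro!: derivative_eq_intros d\<close>)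
    have X: "X = l *s (\<chi> j. f' j)" using l by (simp add: vec_eq_iff f'_def mult.commute)
    have "M_metric i0 i1 m P z X = cmod l * M_metric i0 i1 m P z (\<chi> j. f' j)"
      unfolding X by (rule M_metric_scale[OF z])
    also have "\<dots> = cmod l * (cmod (deriv g0 0) + cmod (deriv g1 0) + (\<Sum>\<alpha>\<in>?I. cmod (deriv (g \<alpha>) 0)))"
      unfolding M_metric_eq[OF z] \<delta>_def[symmetric] d0 d1 da by simp
    also have "\<dots> \<le> cmod l * (C + C + (\<Sum>\<alpha>\<in>?I. C))"
      using bounds by (intro mult_left_mono add_mono sum_mono) auto
    also have "\<dots> = (2 + real (card ?I)) * C * cmod l" by (simp add: algebra_simps)
    finally show ?thesis .
  qed
  moreover have "(2 + real (card ?I)) * C \<ge> 1"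
    using mult_mono[of 1 "2 + real (card ?I)" 1 C] C(1) by simp
  ultimately show ?thesis by blast
qed

lemma kobayashi_estimate:
  fixes i0 i1 :: "'n::finite"
  assumes i: "i0 \<noteq> i1"
  shows "\<exists>A\<ge>1. \<forall>z\<in>limit_domain i0 i1 P. \<forall>X.
           inverse A * M_metric i0 i1 m P z X \<le> kobayashi (limit_domain i0 i1 P) z X \<and>
           kobayashi (limit_domain i0 i1 P) z X \<le> A * M_metric i0 i1 m P z X"
proof -
  obtain C where C: "C \<ge> 1" "\<And>z X l f. \<lbrakk>rP i0 i1 P z < 0; holomorphic_curve_on f (ball 0 1);
     f ` ball 0 1 \<subseteq> limit_domain i0 i1 P; f 0 = z; \<forall>i. deriv (\<lambda>t. f t $ i) 0 * l = X $ i\<rbrakk> \<Longrightarrow>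
     M_metric i0 i1 m P z X \<le> C * cmod l"
    using disc_derivative_bound[OF i] by blast
  define B where "B = real (4 * m * m + CARD('n) + 2)"
  have B: "B > 0" unfolding B_def of_nat_0_less_iff by simp
  define A where "A = max C B"
  have A: "A \<ge> 1" "A \<ge> C" "A \<ge> B" using C(1) by (auto simp: A_def)
  have "inverse A * M_metric i0 i1 m P z X \<le> kobayashi (limit_domain i0 i1 P) z X \<and>
        kobayashi (limit_domain i0 i1 P) z X \<le> A * M_metric i0 i1 m P z X"
    if "z \<in> limit_domain i0 i1 P" for z X
  proof -
    have z: "rP i0 i1 P z < 0" using that by (simp add: limit_domain_def)
    let ?M = "M_metric i0 i1 m P z X"
    let ?K = "{cmod l | l. \<exists>f. holomorphic_curve_on f (ball 0 1) \<and> f ` ball 0 1 \<subseteq> limit_domain i0 i1 P \<and>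
      f 0 = z \<and> (\<forall>i. deriv (\<lambda>t. f t $ i) 0 * l = X $ i)}"
    have M: "?M \<ge> 0" by (rule M_metric_nonneg[OF z])
    \<comment> \<open>Dividing \<open>X\<close> by \<open>l\<close> makes it short enough for
      \<open>ex_disc\<close>; the resulting disc has derivative \<open>X / l\<close>.\<close>
    have mem: "l \<in> ?K" if l: "l > 0" "B * ?M \<le> l" for l
    proof -
      have "M_metric i0 i1 m P z (of_real (1 / l) *s X) = (1 / l) * ?M"
        unfolding M_metric_scale[OF z] norm_of_real using l by simp
      also have "\<dots> \<le> 1 / B" using l B by (simp add: field_simps)
      finally obtain f where f: "holomorphic_curve_on f (ball 0 1)" "f ` ball 0 1 \<subseteq> limit_domain i0 i1 P"
        "f 0 = z" "\<And>j. deriv (\<lambda>t. f t $ j) 0 = (of_real (1 / l) *s X) $ j"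
        using ex_disc[OF i z] unfolding B_def by blast
      have "deriv (\<lambda>t. f t $ j) 0 * of_real l = X $ j" for j unfolding f(4) using l by simp
      hence "cmod (of_real l) \<in> ?K" using f(1-3) by blast
      thus ?thesis using l by simp
    qed
    have bdd: "bdd_below ?K" by (rule bdd_belowI[of _ 0]) auto
    have "inverse A * ?M \<le> kobayashi (limit_domain i0 i1 P) z X"
      unfolding kobayashi_def
    proof (rule cInf_greatest)
      have "0 \<le> B * ?M" using M B by simp
      hence "B * ?M + 1 \<in> ?K" by (intro mem) linarith+
      thus "?K \<noteq> {}" by blast
      fix x assume "x \<in> ?K"
      then obtain l where l: "x = cmod l" "?M \<le> C * cmod l" using C(2)[OF z] by blast
      have "C * cmod l \<le> A * cmod l" using A by (intro mult_right_mono) auto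
      hence "?M \<le> A * x" using l by simp
      thus "inverse A * ?M \<le> x" using A(1) by (simp add: field_simps)
    qed
    moreover have "kobayashi (limit_domain i0 i1 P) z X \<le> A * ?M"
    \<comment> \<open>The admissible \<open>l\<close> must be positive, whereas \<open>M\<close> is
      0 for \<open>X = 0\<close>; an arbitrarily small excess covers this case.\<close>
    proof (rule field_le_epsilon)
      fix e :: real assume e: "e > 0"
      have BA: "0 \<le> B * ?M" "B * ?M \<le> A * ?M" using A M B by (auto intro: mult_right_mono)
      hence "A * ?M + e \<in> ?K" using e by (intro mem) linarith+
      thus "kobayashi (limit_domain i0 i1 P) z X \<le> A * ?M + e"
        unfolding kobayashi_def by (rule cInf_lower[OF _ bdd])
    qed
    ultimately show ?thesis by blast
  qed
  thus ?thesis using A(1) by blast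
qed

end

text \<open>The given coefficients represent a real function but are not stated to be Hermitian.
  Averaging with the conjugate array achieves this without appeal to uniqueness of
  coefficients.\<close>

lemma limit_polynomial_hermitian:
  assumes "scaling_construction i0 i1 \<Omega> u m r W \<Phi> a b \<epsilon> s P"
  shows "\<exists>c. model_polynomial m c P"
proof -
  note limit_polynomial = scaling_construction.limit_polynomial[OF assms]
    and limit_nonzero = scaling_construction.limit_nonzero[OF assms]
    and limit_at_0 = scaling_construction.limit_at_0[OF assms]
    and limit_subharmonic = scaling_construction.limit_subharmonic[OF assms]
  obtain e m' where e: "real_polynomial_with P e" "\<And>j. j > 0 \<Longrightarrow> e j 0 = 0" "\<And>j. j > 0 \<Longrightarrow> e 0 j = 0"
    "Max {j + k | j k. e j k \<noteq> 0} = 2 * m'" "m' \<le> m"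
    using limit_polynomial by blast
  let ?S = "{(j, k). e j k \<noteq> 0}" and ?J = "{..<Suc (2*m)} \<times> {..<Suc (2*m)}"
  have fin: "finite ?S" and Pe: "\<And>z. complex_of_real (P z) = (\<Sum>(j, k)\<in>?S. e j k * z ^ j * cnj z ^ k)"
    using e(1) unfolding real_polynomial_with_def by auto
  have "{j + k | j k. e j k \<noteq> 0} = (\<lambda>(j, k). j + k) ` ?S" by auto
  hence fin2: "finite {j + k | j k. e j k \<noteq> 0}" using fin by simp
  have deg: "j + k \<le> 2 * m" if "e j k \<noteq> 0" for j k
  proof -
    have "j + k \<le> Max {j + k | j k. e j k \<noteq> 0}" by (rule Max_ge[OF fin2]) (use that in auto)
    thus ?thesis using e(4,5) by simp
  qed
  have Pb: "complex_of_real (P z) = bipoly (Suc (2*m)) e z" for z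
    unfolding Pe bipoly_def by (rule sum.mono_neutral_left) (use deg in \<open>fastforce+\<close>)
  \<comment> \<open>Absence of harmonic terms is given for positive exponents only; the constant
    term is \<open>P 0\<close>.\<close>
  have e00: "e 0 0 = 0"
  proof -
    have "(\<Sum>x\<in>?J. e (fst x) (snd x) * 0 ^ fst x * cnj 0 ^ snd x) = (\<Sum>x\<in>?J. if x = (0, 0) then e 0 0 else 0)"
      by (intro sum.cong refl) (auto simp: power_0_left)
    also have "\<dots> = e 0 0" by (subst sum.delta) auto
    finally show ?thesis using Pb[of 0] limit_at_0 by (simp add: bipoly_def case_prod_unfold)
  qed
  have eh: "e j 0 = 0" "e 0 j = 0" for j using e(2,3)[of j] e00 by (cases j; simp)+
  define c where "c j k = (e j k + cnj (e k j)) / 2" for j k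
  have Pc: "of_real (P z) = bipoly (Suc (2*m)) c z" for z
  proof -
    have "complex_of_real (P z) = (of_real (P z) + cnj (of_real (P z))) / 2" by simp
    also have "\<dots> = (bipoly (Suc (2*m)) e z + cnj (bipoly (Suc (2*m)) e z)) / 2"
      unfolding Pb ..
    also have "cnj (bipoly (Suc (2*m)) e z) = bipoly (Suc (2*m)) (\<lambda>j k. cnj (e k j)) z"
    proof -
      have "cnj (bipoly (Suc (2*m)) e z) = (\<Sum>j<Suc (2*m). \<Sum>k<Suc (2*m). cnj (e j k) * cnj z ^ j * z ^ k)"
        unfolding bipoly_double_sum by (simp add: cnj_sum del: sum.lessThan_Suc)
      also have "\<dots> = (\<Sum>k<Suc (2*m). \<Sum>j<Suc (2*m). cnj (e j k) * cnj z ^ j * z ^ k)" by (rule sum.swap)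
      also have "\<dots> = bipoly (Suc (2*m)) (\<lambda>j k. cnj (e k j)) z"
        unfolding bipoly_double_sum by (intro sum.cong refl) (simp add: mult.commute mult.left_commute)
      finally show ?thesis .
    qed
    also have "(bipoly (Suc (2*m)) e z + bipoly (Suc (2*m)) (\<lambda>j k. cnj (e k j)) z) / 2 = bipoly (Suc (2*m)) c z"
      unfolding bipoly_def c_def sum.distrib[symmetric] sum_divide_distrib
      by (intro sum.cong refl) (simp add: case_prod_unfold field_simps)
    finally show ?thesis .
  qed
  have "model_polynomial m c P"
  proof
    show "c j k = 0" if "2 * m < j + k" for j k
      using deg[of j k] deg[of k j] that by (fastforce simp: c_def)
    show "c j 0 = 0" "c 0 j = 0" "c k j = cnj (c j k)" for j k by (simp_all add: c_def eh add.commute)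
    show "\<exists>j k. c j k \<noteq> 0"
    proof (rule ccontr)
      assume "\<not> ?thesis"
      hence "complex_of_real (P z) = 0" for z unfolding Pc by (simp add: bipoly_def)
      thus False using limit_nonzero by auto
    qed
    show "of_real (P z) = bipoly (Suc (2*m)) c z" for z by (rule Pc)
    show "subharmonic_on UNIV P" by (rule limit_subharmonic)
  qed
  thus ?thesis by blast
qed

theorem lemma4p6:
  fixes i0 i1 :: "'n::finite"
    and \<Omega> :: "(complex^'n) set"
    and P :: "complex \<Rightarrow> real"
  assumes "scaling_construction i0 i1 \<Omega> u m r W \<Phi> a b \<epsilon> s P"
  shows "\<exists>A\<ge>1. \<forall>z\<in>limit_domain i0 i1 P. \<forall>X.
           inverse A * M_metric i0 i1 m P z X \<le> kobayashi (limit_domain i0 i1 P) z X \<and>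
           kobayashi (limit_domain i0 i1 P) z X \<le> A * M_metric i0 i1 m P z X"
proof -
  obtain c where "model_polynomial m c P" using limit_polynomial_hermitian[OF assms] by blast
  moreover have "i0 \<noteq> i1" using assms by (rule scaling_construction.indices)
  ultimately show ?thesis by (rule model_polynomial.kobayashi_estimate)
qed

end
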